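(* Let $\mathcal N$ be a semifinite von Neumann algebra on a separable Hilbert space with a faithful normal semifinite trace $\tau$. Let $T\in\mathcal L^{(1,\infty)}(\mathcal N,\tau)$ be positive with $\|T\|\le1$. (a) Let $\omega$ be a state on $L_\infty(\mathbb R_+^* )$ which is $D_2$-invariant and $P^\alpha$-invariant for all $\alpha>1$, and let $\tilde\omega=\omega\circ L$. Then $$\tau_\omega(T)=\tilde\omega\text{-}\lim_{r\to\infty}\frac1r\tau(T^{1+\frac1r}).$$ (b) If $\lim_{r\to\infty}\frac1r\tau(T^{1+\frac1r})$ exists, then $$\tau_\omega(T)=\lim_{r\to\infty}\frac1r\tau(T^{1+\frac1r})$$ for an arbitrary dilation ($D_2$-) invariant state $\omega$ on $L_\infty(\mathbb R_+^* )$.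
   Context: For $A\in\mathcal N$ and $t\ge0$, $\mu_t(A)=\inf\{s\ge 0:\tau(E^{|A|}(s,\infty))\le t\}$, where $E^{|A|}$ is the spectral measure of $|A|$. Let $\psi_1(t)=t\log 2$ for $0\le t\le 1$ and $\psi_1(t)=\log(1+t)$ for $t\ge 1$; $\mathcal L^{(1,\infty)}(\mathcal N,\tau)$ is the set of $A\in\mathcal N$ with $\sup_{t>0}\frac{1}{\psi_1(t)}\int_0^t\mu_s(A)\,ds<\infty$. $\mathbb R_+^*=(0,\infty)$. For functions $f$ on $\mathbb R_+^*$: $(D_af)(x)=f(x/a)$ and $(P^af)(x)=f(x^a)$, $a>0$; "invariant" means $\omega\circ D_a=\omega$, resp. $\omega\circ P^a=\omega$. $L:L_\infty(\mathbb R)\to L_\infty(\mathbb R_+^* )$ is $L(f)=f\circ\log$. Standing convention on states $\omega$ on $L_\infty(\mathbb R_+^* )$: (1) $\omega$ vanishes on continuous functions on $\mathbb R_+^*$ vanishing at $0$ and at $\infty$; (2) $\operatorname{ess\,liminf}_{t\to\infty}f(t)\le\omega(f)\le\operatorname{ess\,limsup}_{t\to\infty}f(t)$ for real-valued $f$; (3) $\omega(f)=0$ if $f$ has compact essential support. In particular $\omega(f)$ and $\tilde\omega(f)$ depend only on the values of $f$ at large arguments; we write $\omega\text{-}\lim_{t\to\infty}f(t)$ for $\omega(f)$ (similarly for $\tilde\omega$), also when $f$ is defined and bounded only for large arguments. For $0\le T\in\mathcal L^{(1,\infty)}(\mathcal N,\tau)$, the Dixmier trace is $\tau_\omega(T)=\omega\text{-}\lim_{t\to\infty}\frac1{\log(1+t)}\int_0^t\mu_s(T)\,ds$.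 *)

theory Defs
  imports "HOL-Probability.Probability"
begin

section \<open>Operators on a complex Hilbert space\<close>

text \<open>The real inner product of the superclass is the real part of the complex one, so the norm is
  the Hilbert space norm. The complex inner product is linear in its first argument.\<close>

class complex_hilbert_space = real_inner + complete_space +
  fixes scaleC :: "complex \<Rightarrow> 'a \<Rightarrow> 'a"  (infixr \<open>*\<^sub>C\<close> 75)
    and cinner :: "'a \<Rightarrow> 'a \<Rightarrow> complex"
  assumes scaleC_add_right: "c *\<^sub>C (x + y) = c *\<^sub>C x + c *\<^sub>C y"
    and scaleC_add_left: "(c + d) *\<^sub>C x = c *\<^sub>C x + d *\<^sub>C x"
    and scaleC_scaleC: "c *\<^sub>C d *\<^sub>C x = (c * d) *\<^sub>C x"
    and scaleC_of_real: "complex_of_real r *\<^sub>C x = r *\<^sub>R x"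
    and cinner_add_left: "cinner (x + y) z = cinner x z + cinner y z"
    and cinner_scaleC_left: "cinner (c *\<^sub>C x) y = c * cinner x y"
    and cinner_commute: "cinner x y = cnj (cinner y x)"
    and inner_eq_Re_cinner: "inner x y = Re (cinner x y)"

text \<open>The library's bounded operators are only real-linear; the complex-linear ones are singled
  out.\<close>

definition bounded_ops :: "('h::complex_hilbert_space \<Rightarrow>\<^sub>L 'h) set" where
  "bounded_ops = {A. \<forall>c x. blinfun_apply A (c *\<^sub>C x) = c *\<^sub>C blinfun_apply A x}"

definition is_adjoint ::
    "('h::complex_hilbert_space \<Rightarrow>\<^sub>L 'h) \<Rightarrow> ('h \<Rightarrow>\<^sub>L 'h) \<Rightarrow> bool" where
  "is_adjoint A B \<longleftrightarrow>
     B \<in> bounded_ops \<and> (\<forall>x y. cinner (blinfun_apply A x) y = cinner x (blinfun_apply B y))"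

definition adj :: "('h::complex_hilbert_space \<Rightarrow>\<^sub>L 'h) \<Rightarrow> ('h \<Rightarrow>\<^sub>L 'h)" where
  "adj A = (THE B. is_adjoint A B)"

definition pos_op :: "('h::complex_hilbert_space \<Rightarrow>\<^sub>L 'h) \<Rightarrow> bool" where
  "pos_op A \<longleftrightarrow> A \<in> bounded_ops \<and> (\<forall>x. cinner (blinfun_apply A x) x \<in> \<real>\<^sub>\<ge>\<^sub>0)"

definition op_le :: "('h::complex_hilbert_space \<Rightarrow>\<^sub>L 'h) \<Rightarrow> ('h \<Rightarrow>\<^sub>L 'h) \<Rightarrow> bool" where
  "op_le A B \<longleftrightarrow> pos_op (B - A)"

definition abs_op :: "('h::complex_hilbert_space \<Rightarrow>\<^sub>L 'h) \<Rightarrow> ('h \<Rightarrow>\<^sub>L 'h)" where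
  "abs_op A = (THE B. pos_op B \<and> B o\<^sub>L B = adj A o\<^sub>L A)"


section \<open>Spectral measures and functional calculus\<close>

definition is_projection :: "('h::complex_hilbert_space \<Rightarrow>\<^sub>L 'h) \<Rightarrow> bool" where
  "is_projection P \<longleftrightarrow> P \<in> bounded_ops \<and> P o\<^sub>L P = P \<and> is_adjoint P P"

definition is_pvm :: "(real set \<Rightarrow> ('h::complex_hilbert_space \<Rightarrow>\<^sub>L 'h)) \<Rightarrow> bool" where
  "is_pvm E \<longleftrightarrow>
     (\<forall>S \<in> sets borel. is_projection (E S)) \<and>
     E UNIV = id_blinfun \<and>
     (\<forall>S \<in> sets borel. \<forall>S' \<in> sets borel. E (S \<inter> S') = E S o\<^sub>L E S') \<and>
     (\<forall>F :: nat \<Rightarrow> real set. range F \<subseteq> sets borel \<and> disjoint_family F \<longrightarrow>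
        (\<forall>x. (\<lambda>n. blinfun_apply (E (F n)) x) sums blinfun_apply (E (\<Union>n. F n)) x))"

definition scalar_measure ::
    "(real set \<Rightarrow> ('h::complex_hilbert_space \<Rightarrow>\<^sub>L 'h)) \<Rightarrow> 'h \<Rightarrow> real measure" where
  "scalar_measure E x =
     measure_of UNIV (sets borel) (\<lambda>S. ennreal (Re (cinner (blinfun_apply (E S) x) x)))"

text \<open>\<open>is_spectral_integral E f C\<close> says that \<open>C\<close> is the integral of \<open>f\<close> against \<open>E\<close> in the weak
  sense; by polarization it suffices to test on the diagonal.\<close>

definition is_spectral_integral ::
    "(real set \<Rightarrow> ('h::complex_hilbert_space \<Rightarrow>\<^sub>L 'h)) \<Rightarrow> (real \<Rightarrow> real) \<Rightarrow> ('h \<Rightarrow>\<^sub>L 'h) \<Rightarrow> bool" where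
  "is_spectral_integral E f C \<longleftrightarrow>
     C \<in> bounded_ops \<and>
     (\<forall>x. integrable (scalar_measure E x) f \<and>
          cinner (blinfun_apply C x) x = complex_of_real (integral\<^sup>L (scalar_measure E x) f))"

text \<open>The value 0 off the Borel sets only serves to make the spectral measure unique as a total
  function.\<close>

definition spectral_measure ::
    "('h::complex_hilbert_space \<Rightarrow>\<^sub>L 'h) \<Rightarrow> real set \<Rightarrow> ('h \<Rightarrow>\<^sub>L 'h)" where
  "spectral_measure B =
     (THE E. is_pvm E \<and> (\<forall>S. S \<notin> sets borel \<longrightarrow> E S = 0) \<and> is_spectral_integral E (\<lambda>x. x) B)"

definition fun_calc ::
    "(real \<Rightarrow> real) \<Rightarrow> ('h::complex_hilbert_space \<Rightarrow>\<^sub>L 'h) \<Rightarrow> ('h \<Rightarrow>\<^sub>L 'h)" where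
  "fun_calc f B = (THE C. is_spectral_integral (spectral_measure B) f C)"

definition op_powr :: "('h::complex_hilbert_space \<Rightarrow>\<^sub>L 'h) \<Rightarrow> real \<Rightarrow> ('h \<Rightarrow>\<^sub>L 'h)" where
  "op_powr T p = fun_calc (\<lambda>x. x powr p) T"


section \<open>Von Neumann algebras and traces\<close>

definition commutant ::
    "('h::complex_hilbert_space \<Rightarrow>\<^sub>L 'h) set \<Rightarrow> ('h \<Rightarrow>\<^sub>L 'h) set" where
  "commutant S = {B \<in> bounded_ops. \<forall>A \<in> S. A o\<^sub>L B = B o\<^sub>L A}"

definition von_neumann_algebra :: "('h::complex_hilbert_space \<Rightarrow>\<^sub>L 'h) set \<Rightarrow> bool" where
  "von_neumann_algebra N \<longleftrightarrow>
     N \<subseteq> bounded_ops \<and> (\<forall>A \<in> N. adj A \<in> N) \<and> commutant (commutant N) = N"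

definition pos_part :: "('h::complex_hilbert_space \<Rightarrow>\<^sub>L 'h) set \<Rightarrow> ('h \<Rightarrow>\<^sub>L 'h) set" where
  "pos_part N = {A \<in> N. pos_op A}"

text \<open>Only the values of \<open>\<tau>\<close> on the positive cone of \<open>N\<close> are relevant.\<close>

definition trace_on ::
    "('h::complex_hilbert_space \<Rightarrow>\<^sub>L 'h) set \<Rightarrow> (('h \<Rightarrow>\<^sub>L 'h) \<Rightarrow> ennreal) \<Rightarrow> bool" where
  "trace_on N \<tau> \<longleftrightarrow>
     (\<forall>A \<in> pos_part N. \<forall>B \<in> pos_part N. \<tau> (A + B) = \<tau> A + \<tau> B) \<and>
     (\<forall>A \<in> pos_part N. \<forall>c \<ge> 0. \<tau> (c *\<^sub>R A) = ennreal c * \<tau> A) \<and>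
     (\<forall>A \<in> N. \<tau> (adj A o\<^sub>L A) = \<tau> (A o\<^sub>L adj A))"

definition faithful_on ::
    "('h::complex_hilbert_space \<Rightarrow>\<^sub>L 'h) set \<Rightarrow> (('h \<Rightarrow>\<^sub>L 'h) \<Rightarrow> ennreal) \<Rightarrow> bool" where
  "faithful_on N \<tau> \<longleftrightarrow> (\<forall>A \<in> pos_part N. \<tau> A = 0 \<longrightarrow> A = 0)"

text \<open>Normality: \<open>\<tau>\<close> preserves suprema of bounded increasing nets, here indexed by themselves, in the
  positive cone.\<close>

definition normal_on ::
    "('h::complex_hilbert_space \<Rightarrow>\<^sub>L 'h) set \<Rightarrow> (('h \<Rightarrow>\<^sub>L 'h) \<Rightarrow> ennreal) \<Rightarrow> bool" where
  "normal_on N \<tau> \<longleftrightarrow>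
     (\<forall>D \<subseteq> pos_part N. \<forall>A \<in> pos_part N.
        D \<noteq> {} \<longrightarrow>
        (\<forall>B \<in> D. \<forall>B' \<in> D. \<exists>C \<in> D. op_le B C \<and> op_le B' C) \<longrightarrow>
        (\<forall>B \<in> D. op_le B A) \<longrightarrow>
        (\<forall>C \<in> pos_part N. (\<forall>B \<in> D. op_le B C) \<longrightarrow> op_le A C) \<longrightarrow>
        \<tau> A = (SUP B \<in> D. \<tau> B))"

definition semifinite_on ::
    "('h::complex_hilbert_space \<Rightarrow>\<^sub>L 'h) set \<Rightarrow> (('h \<Rightarrow>\<^sub>L 'h) \<Rightarrow> ennreal) \<Rightarrow> bool" where
  "semifinite_on N \<tau> \<longleftrightarrow>
     (\<forall>A \<in> pos_part N. A \<noteq> 0 \<longrightarrow> (\<exists>B \<in> pos_part N. B \<noteq> 0 \<and> op_le B A \<and> \<tau> B < \<infinity>))"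

text \<open>A von Neumann algebra is semifinite iff it carries a faithful normal semifinite trace, so
  semifiniteness of \<open>N\<close> is part of this predicate.\<close>

definition semifinite_vn_algebra_with_trace ::
    "('h::complex_hilbert_space \<Rightarrow>\<^sub>L 'h) set \<Rightarrow> (('h \<Rightarrow>\<^sub>L 'h) \<Rightarrow> ennreal) \<Rightarrow> bool" where
  "semifinite_vn_algebra_with_trace N \<tau> \<longleftrightarrow>
     von_neumann_algebra N \<and> trace_on N \<tau> \<and>
     faithful_on N \<tau> \<and> normal_on N \<tau> \<and> semifinite_on N \<tau>"


section \<open>Singular values and the ideal $\mathcal{L}^{(1,\infty)}$\<close>

definition sing_val ::
    "(('h::complex_hilbert_space \<Rightarrow>\<^sub>L 'h) \<Rightarrow> ennreal) \<Rightarrow> ('h \<Rightarrow>\<^sub>L 'h) \<Rightarrow> real \<Rightarrow> real" where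
  "sing_val \<tau> A t = Inf {s. 0 \<le> s \<and> \<tau> (spectral_measure (abs_op A) {s<..}) \<le> ennreal t}"

definition psi1 :: "real \<Rightarrow> real" where
  "psi1 t = (if t \<le> 1 then t * ln 2 else ln (1 + t))"

definition L1inf ::
    "('h::complex_hilbert_space \<Rightarrow>\<^sub>L 'h) set \<Rightarrow> (('h \<Rightarrow>\<^sub>L 'h) \<Rightarrow> ennreal) \<Rightarrow> ('h \<Rightarrow>\<^sub>L 'h) set" where
  "L1inf N \<tau> =
     {A \<in> N. bdd_above ((\<lambda>t. 1 / psi1 t * integral {0..t} (sing_val \<tau> A)) ` {0<..})}"


section \<open>States on $L_\infty$ and generalized limits\<close>

text \<open>Functionals on \<open>L\<^sub>\<infinity>(S)\<close> are represented by functionals on the essentially bounded measurable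
  functions that do not distinguish functions equal almost everywhere on \<open>S\<close>. Their values outside
  \<open>Linf S\<close> are irrelevant.\<close>

definition Linf :: "real set \<Rightarrow> (real \<Rightarrow> complex) set" where
  "Linf S = {f \<in> borel_measurable (lebesgue_on S). \<exists>C. AE x in lebesgue_on S. norm (f x) \<le> C}"

definition state_on :: "real set \<Rightarrow> ((real \<Rightarrow> complex) \<Rightarrow> complex) \<Rightarrow> bool" where
  "state_on S \<omega> \<longleftrightarrow>
     (\<forall>f \<in> Linf S. \<forall>g \<in> Linf S. (AE x in lebesgue_on S. f x = g x) \<longrightarrow> \<omega> f = \<omega> g) \<and>
     (\<forall>f \<in> Linf S. \<forall>g \<in> Linf S. \<omega> (\<lambda>x. f x + g x) = \<omega> f + \<omega> g) \<and>
     (\<forall>c. \<forall>f \<in> Linf S. \<omega> (\<lambda>x. c * f x) = c * \<omega> f) \<and>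
     (\<forall>f \<in> Linf S. (AE x in lebesgue_on S. f x \<in> \<real>\<^sub>\<ge>\<^sub>0) \<longrightarrow> \<omega> f \<in> \<real>\<^sub>\<ge>\<^sub>0) \<and>
     \<omega> (\<lambda>_. 1) = 1"

definition ess_limsup :: "(real \<Rightarrow> real) \<Rightarrow> ereal" where
  "ess_limsup f = (INF a \<in> {0<..}. esssup (lebesgue_on {a<..}) (\<lambda>t. ereal (f t)))"

definition ess_liminf :: "(real \<Rightarrow> real) \<Rightarrow> ereal" where
  "ess_liminf f = - ess_limsup (\<lambda>t. - f t)"

text \<open>States on \<open>L\<^sub>\<infinity>((0,\<infinity>))\<close> satisfying the standing convention. \<open>\<omega>\<close> is complex-valued, but takes
  real values on real-valued functions by positivity.\<close>

definition admissible_state :: "((real \<Rightarrow> complex) \<Rightarrow> complex) \<Rightarrow> bool" where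
  "admissible_state \<omega> \<longleftrightarrow>
     state_on {0<..} \<omega> \<and>
     (\<forall>f. continuous_on {0<..} f \<and> (f \<longlongrightarrow> 0) (at_right 0) \<and> (f \<longlongrightarrow> 0) at_top \<longrightarrow> \<omega> f = 0) \<and>
     (\<forall>f. (\<lambda>t. complex_of_real (f t)) \<in> Linf {0<..} \<longrightarrow>
        ess_liminf f \<le> ereal (Re (\<omega> (\<lambda>t. complex_of_real (f t)))) \<and>
        ereal (Re (\<omega> (\<lambda>t. complex_of_real (f t)))) \<le> ess_limsup f) \<and>
     (\<forall>f \<in> Linf {0<..}. \<forall>K. compact K \<and> K \<subseteq> {0<..} \<and>
        (AE t in lebesgue_on {0<..}. t \<notin> K \<longrightarrow> f t = 0) \<longrightarrow> \<omega> f = 0)"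

definition dil :: "real \<Rightarrow> (real \<Rightarrow> complex) \<Rightarrow> (real \<Rightarrow> complex)" where
  "dil a f = (\<lambda>x. f (x / a))"

definition pow_sub :: "real \<Rightarrow> (real \<Rightarrow> complex) \<Rightarrow> (real \<Rightarrow> complex)" where
  "pow_sub a f = (\<lambda>x. f (x powr a))"

definition invariant_under ::
    "((real \<Rightarrow> complex) \<Rightarrow> (real \<Rightarrow> complex)) \<Rightarrow> ((real \<Rightarrow> complex) \<Rightarrow> complex) \<Rightarrow> bool" where
  "invariant_under \<Phi> \<omega> \<longleftrightarrow> (\<forall>f \<in> Linf {0<..}. \<omega> (\<Phi> f) = \<omega> f)"

text \<open>The map \<open>L : L\<^sub>\<infinity>(\<real>) \<rightarrow> L\<^sub>\<infinity>((0,\<infinity>))\<close>.\<close>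

definition log_pullback :: "(real \<Rightarrow> complex) \<Rightarrow> (real \<Rightarrow> complex)" where
  "log_pullback f = f \<circ> ln"

text \<open>\<open>\<omega>-lim\<close> of a function that needs to be defined and bounded only for large arguments: the common
  value of \<open>\<omega>\<close> on the elements of \<open>L\<^sub>\<infinity>(S)\<close> agreeing with it for large arguments.\<close>

definition gen_lim ::
    "real set \<Rightarrow> ((real \<Rightarrow> complex) \<Rightarrow> complex) \<Rightarrow> (real \<Rightarrow> real) \<Rightarrow> complex" where
  "gen_lim S \<omega> f =
     (THE c. \<exists>g \<in> Linf S. (\<forall>\<^sub>F t in at_top. g t = complex_of_real (f t)) \<and> \<omega> g = c)"

definition dixmier_trace ::
    "((real \<Rightarrow> complex) \<Rightarrow> complex) \<Rightarrow> (('h::complex_hilbert_space \<Rightarrow>\<^sub>L 'h) \<Rightarrow> ennreal) \<Rightarrow>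
     ('h \<Rightarrow>\<^sub>L 'h) \<Rightarrow> complex" where
  "dixmier_trace \<omega> \<tau> T =
     gen_lim {0<..} \<omega> (\<lambda>t. 1 / ln (1 + t) * integral {0..t} (sing_val \<tau> T))"

text \<open>The function \<open>r \<mapsto> (1/r) \<tau>(T\<^sup>1\<^sup>+\<^sup>1\<^sup>/\<^sup>r)\<close>; for positive \<open>T\<close> in \<open>L1inf N \<tau>\<close> and \<open>r > 0\<close> the trace is
  finite, so the conversion to \<open>real\<close> loses nothing.\<close>

definition scaled_zeta ::
    "(('h::complex_hilbert_space \<Rightarrow>\<^sub>L 'h) \<Rightarrow> ennreal) \<Rightarrow> ('h \<Rightarrow>\<^sub>L 'h) \<Rightarrow> real \<Rightarrow> real" where
  "scaled_zeta \<tau> T r = 1 / r * enn2real (\<tau> (op_powr T (1 + 1 / r)))"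

end

theory Submission
  imports Defs "HOL-Real_Asymp.Real_Asymp"
begin

text \<open>The projections of the spectral measure $E$ of $T$ lie in $N$, and by normality
  $\nu = \tau \circ E$ is a measure on the unit interval with $\tau(f(T)) = \int f\,d\nu$. The
  singular values are the decreasing rearrangement of $\nu$, so with
  $A(t) = \int_{\lambda > 1/t} \lambda\,d\nu$ one has $\int_0^t \mu_s\,ds \le 1 + A(t)$ for all $t$,
  and $A(t) \le \int_0^{t^\alpha} \mu_s\,ds$ for every $\alpha > 1$ and all large $t$. Karamata's
  argument (squeeze $x^{-1} 1_{x > 1/e}$ between polynomials whose integrals are almost 1) shows that
  a generalized limit of $\frac{1}{r} \tau(T^{1+1/r})$, $r = \log t$, that is unaffected by the
  substitutions $t \mapsto t^c$ is also the generalized limit of $A(t) / \log t$; letting $\alpha$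
  tend to 1, it is the Dixmier trace. In part (a) the power invariance of the state provides the
  hypothesis, in part (b) the existence of the limit does.\<close>

section \<open>Riesz representation in real Hilbert spaces\<close>

text \<open>The spectral calculus is built from moments: for each vector x the numbers <T^j x, x>
  are the moments of a measure on [0,1], because T^i (1-T)^l is positive, and an identity between
  the operators f(T) then has to be checked on powers of T only. Spectral measure, functional
  calculus and absolute value are defined as the unique objects with certain properties, so each
  construction comes with a uniqueness proof among all competitors. On the analytic side a state
  does not evaluate at points; Karamata's theorem is therefore proved for linear functionals that
  respect inequalities valid for large t. Power substitutions enter because a monomial under
  Karamata's integral rescales r = log t, which is a power of t. The exponent \<alpha> > 1 absorbs
  the logarithm in the bound O(t log t) for the mass of \<nu> above 1/t, which is what logarithmic
  growth of the integrated singular values yields. The summand 1 is t * (1/t), the contribution of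
  the levels below 1/t.\<close>

lemma linear_coeff_zero_if_quadratic_nonneg:
  fixes a b :: real
  assumes "\<And>t. 0 \<le> t * a + t\<^sup>2 * b"
  shows "a = 0"
proof (rule ccontr)
  assume "a \<noteq> 0"
  \<comment> \<open>At \<open>t = - s * a\<close> with \<open>s * b < 1\<close> the linear term
    outweighs the quadratic one.\<close>
  define s where "s = 1 / (\<bar>b\<bar> + 1)"
  have s: "s > 0" "s * b < 1" 
    unfolding s_def by (auto simp: field_simps)
  have "0 \<le> (- s * a) * a + (- s * a)\<^sup>2 * b" by (rule assms)
  also have "\<dots> = - (s * a\<^sup>2) * (1 - s * b)"
    by (simp add: power2_eq_square algebra_simps)
  finally have "s * a\<^sup>2 * (1 - s * b) \<le> 0" by simp
  moreover have "s * a\<^sup>2 * (1 - s * b) > 0"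
    using s \<open>a \<noteq> 0\<close> by simp
  ultimately show False by simp
qed

text \<open>The representing vector is a minimizer of \<open>J y = |y|^2/2 - f y\<close>. The
  parallelogram law makes minimizing sequences Cauchy, and vanishing of the first variation at the
  minimum is the equation \<open>f x = inner z x\<close>.\<close>

theorem riesz_representation:
  fixes f :: "'a::{real_inner, complete_space} \<Rightarrow> real"
  assumes "bounded_linear f"
  obtains z where "\<And>y. f y = inner z y"
proof -
  interpret f: bounded_linear f by fact
  obtain K where K: "\<And>y. \<bar>f y\<bar> \<le> norm y * K" and "K > 0"
    using f.pos_bounded by (auto simp: mult.commute)
  define J where "J y = (norm y)\<^sup>2 / 2 - f y" for y
  have J_ge: "J y \<ge> - K\<^sup>2 / 2" for y
  proof -
    have "0 \<le> (norm y - K)\<^sup>2" by simp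
    then show ?thesis using K[of y] by (simp add: J_def power2_eq_square algebra_simps)
  qed
  define m where "m = (INF y. J y)"
  have bdd: "bdd_below (range J)" using J_ge by (auto intro!: bdd_belowI2)
  have m_le: "m \<le> J y" for y
    unfolding m_def by (rule cINF_lower[OF bdd]) simp
  have "\<exists>y. J y < m + 1 / real (Suc n)" for n
    using cINF_less_iff[OF _ bdd, of "m + 1 / real (Suc n)"] by (auto simp: m_def)
  then obtain y where y: "\<And>n. J (y n) < m + 1 / real (Suc n)" by metis
  have par: "(norm (u - v))\<^sup>2 / 4 = J u + J v - 2 * J ((1/2) *\<^sub>R (u + v))" for u v
    unfolding J_def power2_norm_eq_inner
    by (simp add: f.scaleR f.add inner_add_left inner_add_right inner_diff_left inner_diff_right inner_commute field_simps)
  have "Cauchy y"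
  proof (rule metric_CauchyI)
    fix e :: real assume "e > 0"
    obtain k where k: "1 / real (Suc k) < e\<^sup>2 / 8"
      using nat_approx_posE[of "e\<^sup>2/8"] \<open>e > 0\<close> by auto
    show "\<exists>M. \<forall>i\<ge>M. \<forall>j\<ge>M. dist (y i) (y j) < e"
    proof (intro exI allI impI)
      fix i j assume ij: "k \<le> i" "k \<le> j"
      have "1 / real (Suc i) \<le> 1 / real (Suc k)" "1 / real (Suc j) \<le> 1 / real (Suc k)"
        using ij by (auto simp: frac_le)
      then have "(norm (y i - y j))\<^sup>2 / 4 < e\<^sup>2 / 4"
        using par[of "y i" "y j"] y[of i] y[of j] m_le[of "(1/2) *\<^sub>R (y i + y j)"] k by linarith
      then show "dist (y i) (y j) < e"
        using \<open>e > 0\<close> by (intro power_less_imp_less_base[of "dist (y i) (y j)" 2 e]) (simp_all add: dist_norm)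
    qed
  qed
  then obtain z where z: "y \<longlonglongrightarrow> z" using Cauchy_convergent_iff convergent_def by blast
  have "(\<lambda>n. J (y n)) \<longlonglongrightarrow> J z"
    unfolding J_def by (intro tendsto_diff tendsto_divide tendsto_power tendsto_norm f.tendsto z tendsto_const) simp
  moreover have "(\<lambda>n. m + 1 / real (Suc n)) \<longlonglongrightarrow> m + 0"
    by (intro tendsto_add tendsto_const LIMSEQ_Suc[OF lim_1_over_n])
  ultimately have "J z \<le> m + 0"
    by (rule LIMSEQ_le) (use y in \<open>auto intro: less_imp_le\<close>)
  then have "J z \<le> m" by simp
  have "f x = inner z x" for x
  proof -
    have "0 \<le> t * (inner z x - f x) + t\<^sup>2 * ((norm x)\<^sup>2 / 2)" for t
    proof -
      have "J z \<le> J (z + t *\<^sub>R x)" using \<open>J z \<le> m\<close> m_le order_trans by blast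
      then show ?thesis
        unfolding J_def power2_norm_eq_inner
        by (simp add: f.scaleR f.add inner_add_left inner_add_right inner_commute algebra_simps power2_eq_square)
    qed
    from linear_coeff_zero_if_quadratic_nonneg[OF this] show ?thesis by simp
  qed
  then show ?thesis using that by blast
qed

text \<open>The operators of the functional calculus arise from forms in this way. Only the real
  inner product enters; complex linearity is recovered later from commutation with multiplication by
  i.\<close>

lemma bounded_bilinear_form_represented:
  fixes b :: "'a::{real_inner, complete_space} \<Rightarrow> 'a \<Rightarrow> real"
  assumes "bounded_bilinear b"
  obtains B :: "'a \<Rightarrow>\<^sub>L 'a" where "\<And>x y. inner (B x) y = b x y"
proof -
  interpret b: bounded_bilinear b by fact
  have "\<exists>z. \<forall>y. b x y = inner z y" for x
    by (rule riesz_representation[OF b.bounded_linear_right]) blast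
  then obtain F where F: "\<And>x y. b x y = inner (F x) y" by metis
  obtain K where K: "\<And>x y. norm (b x y) \<le> norm x * norm y * K" "K > 0"
    using b.pos_bounded by blast
  have eqI: "u = v" if "\<And>y. inner u y = inner v y" for u v :: 'a
    using vector_eq_rdot that by blast
  have "bounded_linear F"
  proof (rule bounded_linear_intro)
    show "F (x + y) = F x + F y" for x y
      by (rule eqI) (simp add: F[symmetric] b.add_left inner_add_left)
    show "F (r *\<^sub>R x) = r *\<^sub>R F x" for r x
      by (rule eqI) (simp add: F[symmetric] b.scaleR_left)
    show "norm (F x) \<le> norm x * K" for x
    proof (cases "F x = 0")
      case False
      have "norm (F x) * norm (F x) = b x (F x)"
        by (simp add: F power2_norm_eq_inner flip: power2_eq_square)
      also have "\<dots> \<le> norm (F x) * (norm x * K)" using K(1)[of x "F x"] by (simp add: algebra_simps)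
      finally show ?thesis using False by simp
    qed (use K in simp)
  qed
  then show ?thesis using that[of "Blinfun F"] by (simp add: F bounded_linear_Blinfun_apply)
qed

lemma blinfun_adjoint_exists:
  fixes A :: "'a::{real_inner, complete_space} \<Rightarrow>\<^sub>L 'a"
  obtains B :: "'a \<Rightarrow>\<^sub>L 'a" where "\<And>x y. inner (A x) y = inner x (B y)"
proof -
  have "bounded_bilinear (\<lambda>x y. inner x (A y))"
    by (rule bounded_bilinear.comp[OF bounded_bilinear_inner bounded_linear_ident])
      (rule blinfun.bounded_linear_right)
  then obtain B :: "'a \<Rightarrow>\<^sub>L 'a" where "\<And>x y. inner (B x) y = inner x (A y)"
    using bounded_bilinear_form_represented by blast
  then show ?thesis using that[of B] by (simp add: inner_commute)
qed

section \<open>The Hausdorff moment problem\<close>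

text \<open>Both terms are products of \<open>j\<close> factors, \<open>(k - i) / (n - i)\<close>
  against \<open>k / n\<close>, and the differences of the factors add up. The condition
  \<open>2 * j \<le> n\<close> keeps the factors in [-1,1], even for \<open>k < i\<close>, and the
  denominators at least \<open>n / 2\<close>.\<close>

lemma binomial_ratio_near_power:
  fixes k n j :: nat
  assumes "k \<le> n" "2 * j \<le> n" "0 < n"
  shows "\<bar>real (k choose j) / real (n choose j) - (real k / real n) ^ j\<bar> \<le> 2 * (real j)\<^sup>2 / real n"
proof -
  have "real (k choose j) / real (n choose j) = (\<Prod>i<j. (real k - real i) / (real n - real i))"
    unfolding binomial_gbinomial gbinomial_prod_rev
    by (simp add: prod_dividef lessThan_atLeast0)
  moreover have "(real k / real n) ^ j = (\<Prod>i<j. real k / real n)" by simp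
  ultimately have "\<bar>real (k choose j) / real (n choose j) - (real k / real n) ^ j\<bar>
    = norm ((\<Prod>i<j. (real k - real i) / (real n - real i)) - (\<Prod>i<j. real k / real n))" by simp
  also have "\<dots> \<le> (\<Sum>i<j. norm ((real k - real i) / (real n - real i) - real k / real n))"
    using assms by (intro norm_prod_diff) (auto simp: abs_le_iff field_simps)
  also have "\<dots> \<le> (\<Sum>i<j. 2 * real j / real n)"
  proof (rule sum_mono)
    fix i assume i: "i \<in> {..<j}"
    have pos: "real n - real i > 0" using i assms by auto
    have "(real k - real i) / (real n - real i) - real k / real n = - (real i * (real n - real k)) / (real n * (real n - real i))"
      using pos assms by (simp add: field_simps)
    then have "norm ((real k - real i) / (real n - real i) - real k / real n)
      = real i * (real n - real k) / (real n * (real n - real i))"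
      using pos assms by (simp add: abs_mult)
    also have "\<dots> \<le> real j * real n / (real n * (real n / 2))"
      using i assms by (intro frac_le mult_mono) auto
    also have "\<dots> = 2 * real j / real n" using assms by (simp add: field_simps)
    finally show "norm ((real k - real i) / (real n - real i) - real k / real n) \<le> 2 * real j / real n" .
  qed
  also have "\<dots> = 2 * (real j)\<^sup>2 / real n" by (simp add: power2_eq_square)
  finally show ?thesis .
qed

text \<open>The measure is a limit of the distributions with mass \<open>w n k\<close> at \<open>k / n\<close>, which exists by
  Helly's selection theorem.\<close>

lemma hausdorff_moment_prob:
  fixes w :: "nat \<Rightarrow> nat \<Rightarrow> real" and c :: "nat \<Rightarrow> real"
  assumes nonneg: "\<And>n k. k \<le> n \<Longrightarrow> 0 \<le> w n k"
    and moments: "\<And>n j. j \<le> n \<Longrightarrow> (\<Sum>k\<le>n. real (k choose j) * w n k) = real (n choose j) * c j"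
    and c0: "c 0 = 1"
  obtains M where "real_distribution M" "AE x in M. x \<in> {0..1}" "\<And>j. (\<integral>x. x ^ j \<partial>M) = c j"
proof -
  have sum_w: "(\<Sum>k\<le>n. w n k) = 1" for n using moments[of 0 n] c0 by simp
  define f where "f n k = (if k \<le> n then w n k else 0)" for n k
  define p where "p n = embed_pmf (f n)" for n
  have pmf_p: "pmf (p n) k = f n k" for n k
  proof -
    have "(\<integral>\<^sup>+k. ennreal (f n k) \<partial>count_space UNIV) = (\<integral>\<^sup>+k. ennreal (w n k) * indicator {..n} k \<partial>count_space UNIV)"
      by (intro nn_integral_cong) (auto simp: f_def)
    also have "\<dots> = (\<Sum>k\<le>n. ennreal (w n k))"
      by (simp add: nn_integral_count_space_indicator[symmetric] nn_integral_count_space_finite)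
    also have "\<dots> = 1" using sum_w[of n] nonneg by (subst sum_ennreal) auto
    finally show ?thesis
      unfolding p_def by (intro pmf_embed_pmf) (auto simp: f_def nonneg)
  qed
  define \<mu> where "\<mu> n = distr (measure_pmf (p n)) borel (\<lambda>k. real k / real n)" for n
  have int_\<mu>: "(\<integral>x. h x \<partial>\<mu> n) = (\<Sum>k\<le>n. h (real k / real n) * w n k)"
    if "h \<in> borel_measurable borel" for h :: "real \<Rightarrow> real" and n
  proof -
    have "(\<integral>x. h x \<partial>\<mu> n) = (\<integral>k. h (real k / real n) \<partial>measure_pmf (p n))"
      unfolding \<mu>_def using that by (subst integral_distr) auto
    also have "\<dots> = (\<Sum>k\<le>n. h (real k / real n) * pmf (p n) k)"
      by (rule integral_measure_pmf_real) (auto simp: set_pmf_eq pmf_p f_def split: if_splits)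
    finally show ?thesis by (simp add: pmf_p f_def)
  qed
  have rd: "real_distribution (\<mu> n)" for n
    unfolding \<mu>_def by (intro prob_space.real_distribution_distr prob_space_measure_pmf) auto
  have AE\<mu>: "AE x in \<mu> n. x \<in> {0..1}" for n
    unfolding \<mu>_def
    by (subst AE_distr_iff) (auto simp: AE_measure_pmf_iff set_pmf_eq pmf_p f_def divide_le_eq_1 split: if_splits)
  have "tight \<mu>"
    unfolding tight_def
  proof (intro conjI allI impI)
    fix e :: real assume "e > 0"
    have "measure (\<mu> n) {-1<..1} = 1" for n
    proof -
      interpret real_distribution "\<mu> n" by (rule rd)
      show ?thesis using AE\<mu>[of n] by (subst prob_eq_1) auto
    qed
    then show "\<exists>a b. a < b \<and> (\<forall>n. 1 - e < measure (\<mu> n) {a<..b})"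
      using \<open>e > 0\<close> by (intro exI[of _ "-1"] exI[of _ 1]) auto
  qed (rule rd)
  from tight_imp_convergent_subsubsequence[OF this strict_mono_id]
  obtain r M where r: "strict_mono (r :: nat \<Rightarrow> nat)" and M: "real_distribution M"
    and "weak_conv_m (\<mu> \<circ> id \<circ> r) M" by blast
  then have wc: "weak_conv_m (\<lambda>n. \<mu> (r n)) M" by (simp add: comp_def)
  interpret M: real_distribution M by (rule M)
  have conv: "(\<lambda>n. \<integral>x. h x \<partial>\<mu> (r n)) \<longlonglongrightarrow> (\<integral>x. h x \<partial>M)"
    if "\<And>x. isCont h x" "\<And>x. norm (h x) \<le> B" for h :: "real \<Rightarrow> real" and B
    using weak_conv_imp_integral_bdd_continuous_conv[OF _ _ wc, of h B] rd M that by blast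
  have AEM: "AE x in M. x \<in> {0..1}"
  proof -
    \<comment> \<open>\<open>h\<close> is the distance to the unit interval, cut at 1. It is
      continuous and bounded, so its zero integrals pass to the weak limit, and it vanishes exactly
      on the interval.\<close>
    define h :: "real \<Rightarrow> real" where "h x = min 1 (max 0 (x - 1) + max 0 (- x))" for x
    have h_cont: "isCont h x" for x unfolding h_def by (intro continuous_intros)
    have h_b: "norm (h x) \<le> 1" for x unfolding h_def by auto
    have [measurable]: "h \<in> borel_measurable borel" unfolding h_def by measurable
    have "(\<integral>x. h x \<partial>\<mu> (r n)) = 0" for n
      using AE\<mu>[of "r n"] by (intro integral_eq_zero_AE) (auto simp: h_def)
    with conv[OF h_cont h_b] have "(\<integral>x. h x \<partial>M) = 0" by (simp add: LIMSEQ_const_iff)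
    then have "AE x in M. h x = 0"
      by (subst (asm) integral_nonneg_eq_0_iff_AE)
        (auto simp: h_def intro!: M.integrable_const_bound[of _ 1])
    then show ?thesis by eventually_elim (auto simp: h_def min_def max_def split: if_splits)
  qed
  have "(\<integral>x. x ^ j \<partial>M) = c j" for j
  proof -
    \<comment> \<open>Clamping makes the power bounded and continuous on the whole line and leaves
      it unchanged on the unit interval.\<close>
    define h :: "real \<Rightarrow> real" where "h x = (max 0 (min 1 x)) ^ j" for x
    have h_cont: "isCont h x" for x unfolding h_def by (intro continuous_intros)
    have h_b: "norm (h x) \<le> 1" for x unfolding h_def by (auto intro!: power_le_one)
    have [measurable]: "h \<in> borel_measurable borel" unfolding h_def by measurable
    have "(\<integral>x. x ^ j \<partial>M) = (\<integral>x. h x \<partial>M)"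
      using AEM by (intro integral_cong_AE) (auto simp: h_def)
    have bound: "\<bar>(\<integral>x. h x \<partial>\<mu> n) - c j\<bar> \<le> 2 * (real j)\<^sup>2 / real n" if n: "n \<ge> max 1 (2 * j)" for n
    proof -
      have "(\<integral>x. h x \<partial>\<mu> n) = (\<Sum>k\<le>n. (real k / real n) ^ j * w n k)"
        using n by (subst int_\<mu>) (auto simp: h_def intro!: sum.cong)
      \<comment> \<open>The hypothesis on moments is exact once \<open>(k / n) ^ j\<close> is
        replaced by the ratio of binomial coefficients.\<close>
      moreover have "c j = (\<Sum>k\<le>n. real (k choose j) / real (n choose j) * w n k)"
        using moments[of j n] n by (simp add: sum_divide_distrib[symmetric] field_simps)
      ultimately have "\<bar>(\<integral>x. h x \<partial>\<mu> n) - c j\<bar>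
        = \<bar>\<Sum>k\<le>n. (real (k choose j) / real (n choose j) - (real k / real n) ^ j) * w n k\<bar>"
        by (simp add: left_diff_distrib sum_subtractf abs_minus_commute)
      also have "\<dots> \<le> (\<Sum>k\<le>n. \<bar>real (k choose j) / real (n choose j) - (real k / real n) ^ j\<bar> * w n k)"
        by (rule order_trans[OF sum_abs]) (simp add: abs_mult nonneg)
      also have "\<dots> \<le> (\<Sum>k\<le>n. 2 * (real j)\<^sup>2 / real n * w n k)"
        using n by (intro sum_mono mult_right_mono binomial_ratio_near_power nonneg) auto
      also have "\<dots> = 2 * (real j)\<^sup>2 / real n" by (simp only: sum_distrib_left[symmetric] sum_w mult_1_right)
      finally show ?thesis .
    qed
    have "(\<lambda>n. (\<integral>x. h x \<partial>\<mu> (r n)) - c j) \<longlonglongrightarrow> 0"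
    proof (rule Lim_null_comparison)
      show "(\<lambda>n. 2 * (real j)\<^sup>2 / real (r n)) \<longlonglongrightarrow> 0"
        by (intro tendsto_divide_0[OF tendsto_const] filterlim_at_top_imp_at_infinity
            filterlim_compose[OF filterlim_real_sequentially] filterlim_subseq r)
      have "\<forall>\<^sub>F n in sequentially. r n \<ge> max 1 (2 * j)"
        using filterlim_subseq[OF r] unfolding filterlim_at_top by blast
      then show "\<forall>\<^sub>F n in sequentially. norm ((\<integral>x. h x \<partial>\<mu> (r n)) - c j) \<le> 2 * (real j)\<^sup>2 / real (r n)"
        by eventually_elim (simp add: bound)
    qed
    then have "(\<lambda>n. (\<integral>x. h x \<partial>\<mu> (r n))) \<longlonglongrightarrow> c j" by (simp add: LIM_zero_iff)
    with conv[OF h_cont h_b] \<open>(\<integral>x. x ^ j \<partial>M) = (\<integral>x. h x \<partial>M)\<close> show ?thesis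
      using LIMSEQ_unique by metis
  qed
  with M AEM show ?thesis using that by blast
qed

text \<open>The interval carries the mass only almost everywhere; the sigma-algebra stays that of
  the real line, so that these measures can be compared with \<open>scalar_measure\<close>.\<close>

definition unit_interval_measure :: "real measure \<Rightarrow> bool" where
  "unit_interval_measure M \<longleftrightarrow> finite_measure M \<and> sets M = sets borel \<and> (AE x in M. x \<in> {0..1})"

text \<open>Dividing by \<open>c 0\<close>, the total weight for each \<open>n\<close>, reduces to
  probability measures. If \<open>c 0 = 0\<close>, the nonnegative weights all vanish, and with them
  the moments.\<close>

theorem hausdorff_moment:
  fixes w :: "nat \<Rightarrow> nat \<Rightarrow> real" and c :: "nat \<Rightarrow> real"
  assumes nonneg: "\<And>n k. k \<le> n \<Longrightarrow> 0 \<le> w n k"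
    and moments: "\<And>n j. j \<le> n \<Longrightarrow> (\<Sum>k\<le>n. real (k choose j) * w n k) = real (n choose j) * c j"
  obtains M where "unit_interval_measure M" "\<And>j. (\<integral>x. x ^ j \<partial>M) = c j"
proof -
  have c0: "(\<Sum>k\<le>n. w n k) = c 0" for n using moments[of 0 n] by simp
  then have "c 0 \<ge> 0" using nonneg by (metis atMost_iff sum_nonneg)
  show ?thesis
  proof (cases "c 0 = 0")
    case True
    have "c j = 0" for j
    proof -
      have "w j k = 0" if "k \<le> j" for k
        using sum_nonneg_eq_0_iff[of "{..j}" "w j"] c0[of j] True nonneg[of _ j] that by auto
      then show ?thesis using moments[of j j] by simp
    qed
    then show ?thesis
      by (intro that[of "null_measure borel"])
        (auto simp: unit_interval_measure_def finite_measure_def finite_measure_axioms_def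
          AE_iff_null null_sets_def sigma_finite_measure_def intro!: exI[of _ "{UNIV}"])
  next
    case False
    then have c0_pos: "c 0 > 0" using \<open>c 0 \<ge> 0\<close> by simp
    obtain M where M: "real_distribution M" "AE x in M. x \<in> {0..1}" "\<And>j. (\<integral>x. x ^ j \<partial>M) = c j / c 0"
    proof (rule hausdorff_moment_prob[of "\<lambda>n k. w n k / c 0" "\<lambda>j. c j / c 0"])
      show "(\<Sum>k\<le>n. real (k choose j) * (w n k / c 0)) = real (n choose j) * (c j / c 0)" if "j \<le> n" for n j
        using moments[OF that] by (simp add: sum_divide_distrib[symmetric])
    qed (use c0_pos nonneg in auto)
    interpret M: real_distribution M by fact
    show ?thesis
    proof (intro that[of "density M (\<lambda>_. ennreal (c 0))"])
      show "unit_interval_measure (density M (\<lambda>_. ennreal (c 0)))"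
        unfolding unit_interval_measure_def
      proof (intro conjI)
        show "finite_measure (density M (\<lambda>_. ennreal (c 0)))"
          using M.emeasure_space_1 by (intro finite_measureI) (simp add: emeasure_density)
        show "AE x in density M (\<lambda>_. ennreal (c 0)). x \<in> {0..1}"
          using M(2) by (simp add: AE_density)
      qed simp
      show "(\<integral>x. x ^ j \<partial>density M (\<lambda>_. ennreal (c 0))) = c j" for j
        using c0_pos M(3) by (subst integral_density) auto
    qed
  qed
qed

text \<open>A bound is asked for on the unit interval only, where the measures live, so that the
  identity and all polynomials belong to the class.\<close>

definition bounded_borel :: "(real \<Rightarrow> real) \<Rightarrow> bool" where
  "bounded_borel f \<longleftrightarrow> f \<in> borel_measurable borel \<and> (\<exists>C. \<forall>x\<in>{0..1}. \<bar>f x\<bar> \<le> C)"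

lemma bounded_borelI:
  assumes "f \<in> borel_measurable borel" "\<And>x. 0 \<le> x \<Longrightarrow> x \<le> 1 \<Longrightarrow> \<bar>f x\<bar> \<le> C"
  shows "bounded_borel f"
  unfolding bounded_borel_def by (intro conjI exI[of _ C] ballI assms) auto

lemma bounded_borel_measurable [measurable_dest]: "bounded_borel f \<Longrightarrow> f \<in> borel_measurable borel"
  by (simp add: bounded_borel_def)

lemma bounded_borel_bound:
  assumes "bounded_borel f"
  shows "\<exists>C\<ge>0. \<forall>x\<in>{0..1}. \<bar>f x\<bar> \<le> C"
proof -
  obtain C where C: "\<forall>x\<in>{0..1}. \<bar>f x\<bar> \<le> C" using assms by (auto simp: bounded_borel_def)
  then have "\<bar>f 0\<bar> \<le> C" by auto
  then have "C \<ge> 0" by linarith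
  with C show ?thesis by blast
qed

lemma bounded_borel_const [simp, intro]: "bounded_borel (\<lambda>_. c)"
  by (rule bounded_borelI[of _ "\<bar>c\<bar>"]) auto

lemma bounded_borel_id [simp, intro]: "bounded_borel (\<lambda>x. x)"
  by (rule bounded_borelI[of _ 1]) auto

lemma bounded_borel_indicator [simp, intro]: "A \<in> sets borel \<Longrightarrow> bounded_borel (indicator A)"
  by (rule bounded_borelI[of _ 1]) (auto simp: indicator_def)

lemma bounded_borel_mult [intro]:
  assumes "bounded_borel f" "bounded_borel g"
  shows "bounded_borel (\<lambda>x. f x * g x)"
proof -
  obtain C where C: "C \<ge> 0" "\<And>x. x \<in> {0..1} \<Longrightarrow> \<bar>f x\<bar> \<le> C"
    using bounded_borel_bound[OF assms(1)] by blast
  obtain D where D: "D \<ge> 0" "\<And>x. x \<in> {0..1} \<Longrightarrow> \<bar>g x\<bar> \<le> D"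
    using bounded_borel_bound[OF assms(2)] by blast
  note [measurable] = assms
  show ?thesis
    by (rule bounded_borelI[of _ "C * D"]) (measurable, auto simp: abs_mult intro!: mult_mono C D)
qed

lemma bounded_borel_add [intro]:
  assumes "bounded_borel f" "bounded_borel g"
  shows "bounded_borel (\<lambda>x. f x + g x)"
proof -
  obtain C where C: "C \<ge> 0" "\<And>x. x \<in> {0..1} \<Longrightarrow> \<bar>f x\<bar> \<le> C"
    using bounded_borel_bound[OF assms(1)] by blast
  obtain D where D: "D \<ge> 0" "\<And>x. x \<in> {0..1} \<Longrightarrow> \<bar>g x\<bar> \<le> D"
    using bounded_borel_bound[OF assms(2)] by blast
  note [measurable] = assms
  show ?thesis
    by (rule bounded_borelI[of _ "C + D"]) (measurable, auto intro!: order_trans[OF abs_triangle_ineq] add_mono C D)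
qed

lemma bounded_borel_diff [intro]:
  assumes "bounded_borel f" "bounded_borel g"
  shows "bounded_borel (\<lambda>x. f x - g x)"
  using bounded_borel_add[OF assms(1) bounded_borel_mult[OF bounded_borel_const[of "-1"] assms(2)]] by simp

lemma bounded_borel_power [intro]: "bounded_borel f \<Longrightarrow> bounded_borel (\<lambda>x. f x ^ n)"
  by (induction n) auto

lemma bounded_borel_sum [intro]:
  "(\<And>i. i \<in> I \<Longrightarrow> bounded_borel (f i)) \<Longrightarrow> bounded_borel (\<lambda>x. \<Sum>i\<in>I. f i x)"
  by (induction I rule: infinite_finite_induct) auto

lemmas bounded_borel_intros = bounded_borel_const bounded_borel_id bounded_borel_mult bounded_borel_add
  bounded_borel_diff bounded_borel_power bounded_borel_sum

lemma bounded_borel_mono: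
  assumes "bounded_borel g" "f \<in> borel_measurable borel" "\<And>x. 0 \<le> f x" "\<And>x. f x \<le> g x"
  shows "bounded_borel f"
proof -
  obtain C where "C \<ge> 0" "\<And>x. x \<in> {0..1} \<Longrightarrow> \<bar>g x\<bar> \<le> C" using bounded_borel_bound[OF assms(1)] by blast
  then show ?thesis using assms
    by (intro bounded_borelI[of _ C]) (auto intro: order_trans[OF assms(4) order_trans[OF abs_ge_self]])
qed

lemma unit_interval_measure_AE:
  assumes "unit_interval_measure M" "\<And>x. x \<in> {0..1} \<Longrightarrow> P x"
  shows "AE x in M. P x"
proof -
  have "AE x in M. x \<in> {0..1}" using assms by (simp add: unit_interval_measure_def)
  then show ?thesis by eventually_elim (rule assms)
qed

lemma unit_interval_measure_integrable [intro]:
  assumes "unit_interval_measure M" "bounded_borel f"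
  shows "integrable M f"
proof -
  interpret finite_measure M using assms by (simp add: unit_interval_measure_def)
  have [measurable_cong]: "sets M = sets borel" using assms by (simp add: unit_interval_measure_def)
  obtain C where "C \<ge> 0" "\<And>x. x \<in> {0..1} \<Longrightarrow> \<bar>f x\<bar> \<le> C" using bounded_borel_bound[OF assms(2)] by blast
  note [measurable] = assms(2)
  have "AE x in M. norm (f x) \<le> C"
    using \<open>\<And>x. x \<in> {0..1} \<Longrightarrow> \<bar>f x\<bar> \<le> C\<close>
    by (intro unit_interval_measure_AE[OF assms(1)]) simp
  then show ?thesis by (rule integrable_const_bound) measurable
qed

lemma unit_interval_measure_integral_cong:
  assumes "unit_interval_measure M" "bounded_borel f" "g \<in> borel_measurable borel" "\<And>x. x \<in> {0..1} \<Longrightarrow> f x = g x"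
  shows "(\<integral>x. f x \<partial>M) = (\<integral>x. g x \<partial>M)"
proof -
  have [measurable_cong]: "sets M = sets borel" using assms by (simp add: unit_interval_measure_def)
  note [measurable] = assms(2,3)
  have "AE x in M. f x = g x" 
    by (intro unit_interval_measure_AE[OF assms(1)] assms(4))
  then show ?thesis by (intro integral_cong_AE) measurable
qed

lemma unit_interval_measure_integral_bound:
  assumes "unit_interval_measure M" "bounded_borel f" "\<And>x. x \<in> {0..1} \<Longrightarrow> \<bar>f x\<bar> \<le> C"
  shows "\<bar>\<integral>x. f x \<partial>M\<bar> \<le> C * (\<integral>x. 1 \<partial>M)"
proof -
  have AE: "AE x in M. \<bar>f x\<bar> \<le> C"
    by (intro unit_interval_measure_AE[OF assms(1)] assms(3))
  have "\<bar>\<integral>x. f x \<partial>M\<bar> \<le> (\<integral>x. \<bar>f x\<bar> \<partial>M)" by (rule integral_abs_bound)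
  also have "\<dots> \<le> (\<integral>x. C \<partial>M)"
    using AE assms by (intro integral_mono_AE) auto
  finally show ?thesis by (simp add: mult.commute)
qed

lemma unit_interval_measure_dominated:
  assumes M: "unit_interval_measure M" and "bounded_borel g" "\<And>n. bounded_borel (s n)" "bounded_borel f"
    "\<And>n x. x \<in> {0..1} \<Longrightarrow> \<bar>s n x\<bar> \<le> C" "\<And>x. x \<in> {0..1} \<Longrightarrow> (\<lambda>n. s n x) \<longlonglongrightarrow> f x"
  shows "(\<lambda>n. \<integral>x. g x * s n x \<partial>M) \<longlonglongrightarrow> (\<integral>x. g x * f x \<partial>M)"
proof (rule integral_dominated_convergence)
  have [measurable_cong]: "sets M = sets borel" using M by (simp add: unit_interval_measure_def)
  note [measurable] = assms(2-4)
  show "(\<lambda>x. g x * f x) \<in> borel_measurable M" "(\<lambda>x. g x * s n x) \<in> borel_measurable M" for n by measurable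
  have AE: "AE x in M. x \<in> {0..1}" using M by (simp add: unit_interval_measure_def)
  show "AE x in M. (\<lambda>n. g x * s n x) \<longlonglongrightarrow> g x * f x"
    using AE by eventually_elim (intro tendsto_intros assms)
  show "integrable M (\<lambda>x. \<bar>g x\<bar> * C)"
    using unit_interval_measure_integrable[OF M assms(2)] by auto
  show "AE x in M. norm (g x * s n x) \<le> \<bar>g x\<bar> * C" for n
    using AE by eventually_elim (auto simp: abs_mult intro!: mult_left_mono assms(5))
qed

text \<open>Vanishing on monomials passes to continuous functions by Weierstrass, to half-lines by
  continuous steps, to Borel sets by a Dynkin argument and to bounded Borel functions by monotone
  limits. Several measures with weights are allowed, so that additivity, symmetry and
  multiplicativity of the forms below are all instances.\<close>

theorem moments_determine:
  fixes M :: "'i \<Rightarrow> real measure" and g :: "'i \<Rightarrow> real \<Rightarrow> real"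
  assumes fin: "finite I" and M: "\<And>i. i \<in> I \<Longrightarrow> unit_interval_measure (M i)"
    and g: "\<And>i. i \<in> I \<Longrightarrow> bounded_borel (g i)"
    and moments: "\<And>n. (\<Sum>i\<in>I. \<integral>x. g i x * x ^ n \<partial>M i) = 0"
    and f: "bounded_borel f"
  shows "(\<Sum>i\<in>I. \<integral>x. g i x * f x \<partial>M i) = 0"
proof -
  define L where "L h = (\<Sum>i\<in>I. \<integral>x. g i x * h x \<partial>M i)" for h
  have int: "integrable (M i) (\<lambda>x. g i x * h x)" if "i \<in> I" "bounded_borel h" for h i
    using that M g by blast
  have L_add: "L (\<lambda>x. u x + v x) = L u + L v" if "bounded_borel u" "bounded_borel v" for u v
    using int that by (simp add: L_def distrib_left sum.distrib)
  have L_scale: "L (\<lambda>x. c * u x) = c * L u" for c u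
    by (simp add: L_def mult.left_commute[of _ c] sum_distrib_left)
  have L_diff: "L (\<lambda>x. u x - v x) = L u - L v" if "bounded_borel u" "bounded_borel v" for u v
    using int that by (simp add: L_def right_diff_distrib sum_subtractf)
  have L_lim: "L h = 0"
    if "\<And>n. bounded_borel (s n)" "\<And>n. L (s n) = 0" "bounded_borel h"
      "\<And>n x. x \<in> {0..1} \<Longrightarrow> \<bar>s n x\<bar> \<le> C" "\<And>x. x \<in> {0..1} \<Longrightarrow> (\<lambda>n. s n x) \<longlonglongrightarrow> h x" for s h C
  proof -
    have "(\<lambda>n. L (s n)) \<longlonglongrightarrow> L h"
      unfolding L_def by (intro tendsto_sum unit_interval_measure_dominated[where C=C] M g that)
    then show ?thesis using that(2) by (simp add: LIMSEQ_const_iff)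
  qed
  have L_poly: "bounded_borel p \<and> L p = 0" if poly: "real_polynomial_function p" for p :: "real \<Rightarrow> real"
  proof -
    obtain a n where p: "p = (\<lambda>x. \<Sum>i\<le>n. a i * x ^ i)"
      using poly unfolding real_polynomial_function_iff_sum by blast
    have b: "bounded_borel (\<lambda>x. a i * x ^ i)" for i
      by (intro bounded_borel_mult bounded_borel_power bounded_borel_const bounded_borel_id)
    have "L (\<lambda>x. \<Sum>i\<le>m. a i * x ^ i) = 0" for m
    proof (induction m)
      case 0 show ?case using moments[of 0] L_scale[of "a 0" "\<lambda>_. 1"] by (simp add: L_def)
    next
      case (Suc m)
      have "L (\<lambda>x. a (Suc m) * x ^ Suc m) = 0" using moments[of "Suc m"] by (subst L_scale) (simp add: L_def)
      then show ?case using Suc b by (subst sum.atMost_Suc, subst L_add) (auto simp del: power_Suc)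
    qed
    then show ?thesis using b unfolding p by (intro conjI bounded_borel_sum) auto
  qed
  have L_cont: "L h = 0" if h: "continuous_on UNIV h" for h
  proof -
    have [simp]: "bounded_borel h"
    proof -
      have "compact (h ` {0..1})" using h by (intro compact_continuous_image continuous_on_subset[OF h]) auto
      then obtain C where "\<forall>y\<in>h ` {0..1}. norm y \<le> C" using compact_imp_bounded bounded_iff by blast
      then show ?thesis using h by (intro bounded_borelI[of _ C] borel_measurable_continuous_onI) auto
    qed
    have "\<exists>p. real_polynomial_function p \<and> (\<forall>x\<in>{0..1}. \<bar>h x - p x\<bar> < 1 / real (Suc n))" for n
      using Stone_Weierstrass_real_polynomial_function[of "{0..1}" h "1 / real (Suc n)"] continuous_on_subset[OF h]
      by (metis compact_Icc subset_UNIV of_nat_0_less_iff zero_less_Suc zero_less_divide_1_iff)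
    then obtain p where p: "\<And>n. real_polynomial_function (p n)"
      "\<And>n x. x \<in> {0..1} \<Longrightarrow> \<bar>h x - p n x\<bar> < 1 / real (Suc n)" by metis
    obtain C where C: "\<And>x. x \<in> {0..1} \<Longrightarrow> \<bar>h x\<bar> \<le> C"
      using bounded_borel_bound[OF \<open>bounded_borel h\<close>] by blast
    show ?thesis
    proof (rule L_lim)
      show "bounded_borel (p n)" "L (p n) = 0" for n using L_poly[OF p(1)] by auto
      show "bounded_borel h" by simp
      have "1 / real (Suc n) \<le> 1" for n by simp
      then show "\<bar>p n x\<bar> \<le> C + 1" if "x \<in> {0..1}" for n x
        using p(2)[OF that, of n] C[OF that] by (smt (verit))
      show "(\<lambda>n. p n x) \<longlonglongrightarrow> h x" if "x \<in> {0..1}" for x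
      proof -
        have "(\<lambda>n. p n x - h x) \<longlonglongrightarrow> 0"
          by (rule Lim_null_comparison[OF _ LIMSEQ_Suc[OF lim_1_over_n]])
            (use p(2)[OF that] in \<open>auto simp: abs_minus_commute intro!: always_eventually less_imp_le\<close>)
        then show ?thesis by (simp add: LIM_zero_iff)
      qed
    qed
  qed
  have L_set: "L (indicator A) = 0" if A: "A \<in> sets borel" for A
  proof -
    have "sets (borel :: real measure) = sigma_sets UNIV (range atMost)"
      by (subst borel_eq_atMost) simp
    with A have A_sigma: "A \<in> sigma_sets UNIV (range atMost)" by simp
    have "Int_stable (range (atMost :: real \<Rightarrow> _))" by (auto simp: Int_stable_def)
    moreover have "range (atMost :: real \<Rightarrow> _) \<subseteq> Pow UNIV" by simp
    ultimately show ?thesis using A_sigma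
    proof (induction rule: sigma_sets_induct_disjoint)
      case (basic A)
      then obtain a where A: "A = {..a}" by auto
      define s where "s n = cts_step a (a + 1 / real (Suc n))" for n
      have cont: "continuous_on UNIV (s n)" for n
        unfolding s_def by (intro uniformly_continuous_imp_continuous cts_step_uniformly_continuous) simp
      have "\<bar>cts_step c d x\<bar> \<le> 1" if "c < d" for c d x :: real
        using that by (auto simp: cts_step_def abs_if field_simps)
      then have s01: "\<bar>s n x\<bar> \<le> 1" for n x by (simp add: s_def)
      show ?case unfolding A
      proof (rule L_lim[where C=1, OF _ _ _ s01])
        show "bounded_borel (s n)" for n
          using s01 cont by (intro bounded_borelI[of _ 1] borel_measurable_continuous_onI) auto
        show "L (s n) = 0" for n by (rule L_cont[OF cont])
        show "(\<lambda>n. s n x) \<longlonglongrightarrow> indicator {..a} x" for x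
        proof (cases "x \<le> a")
          case False
          then have "\<forall>\<^sub>F n in sequentially. 1 / real (Suc n) < x - a"
            by (intro order_tendstoD(2)[OF LIMSEQ_Suc[OF lim_1_over_n]]) auto
          then have "\<forall>\<^sub>F n in sequentially. s n x = indicator {..a} x"
            by eventually_elim (use False in \<open>auto simp: s_def cts_step_def\<close>)
          then show ?thesis by (rule tendsto_eventually)
        qed (simp add: s_def cts_step_def)
      qed auto
    next
      case empty
      show ?case by (simp add: L_def)
    next
      case (compl A)
      then have [simp]: "A \<in> sets borel" using \<open>sets borel = _\<close> by simp
      have "L (\<lambda>x. 1 - indicator A x) = L (\<lambda>_. 1) - L (indicator A)" by (rule L_diff) auto
      moreover have "(\<lambda>x. 1 - indicator A x) = (indicator (UNIV - A) :: real \<Rightarrow> real)"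
        by (auto simp: indicator_def)
      ultimately show ?case using compl L_cont[of "\<lambda>_. 1"] by simp
    next
      case (union A)
      then have [measurable]: "A i \<in> sets borel" for i using \<open>sets borel = _\<close> by auto
      define s where "s n x = (\<Sum>i<n. indicator (A i) x :: real)" for n x
      have s_eq: "s n = indicator (\<Union>i<n. A i)" for n
        unfolding s_def using union(1)
        by (intro ext indicator_UN_disjoint[symmetric]) (auto simp: disjoint_family_on_def)
      show ?case
      proof (rule L_lim[of s _ 1])
        show b: "bounded_borel (s n)" for n unfolding s_eq by auto
        show "L (s n) = 0" for n
        proof (induction n)
          case 0 show ?case by (simp add: L_def s_def)
        next
          case (Suc n)
          have "s (Suc n) = (\<lambda>x. s n x + indicator (A n) x)" by (auto simp: s_def)
          then show ?case using L_add[OF b[of n], of "indicator (A n)"] Suc union by auto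
        qed
        show "\<bar>s n x\<bar> \<le> 1" for n x unfolding s_eq by (auto simp: indicator_def)
        show "(\<lambda>n. s n x) \<longlonglongrightarrow> indicator (\<Union>i. A i) x" for x
          unfolding s_eq by (rule LIMSEQ_indicator_UN)
      qed auto
    qed
  qed
  \<comment> \<open>An implication, because the induction runs through arbitrary nonnegative Borel
    functions; the summands and approximants of a bounded one are bounded, as they lie between 0 and
    it.\<close>
  have L_nonneg: "bounded_borel u \<longrightarrow> L u = 0" if u: "u \<in> borel_measurable borel" "\<And>x. 0 \<le> u x" for u
    using u
  proof (induction rule: borel_measurable_induct_real)
    case (set A) then show ?case by (simp add: L_set)
  next
    case (mult u c)
    show ?case
    proof (cases "c = 0")
      case False
      show ?thesis
      proof
        assume "bounded_borel (\<lambda>x. c * u x)"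
        from bounded_borel_mult[OF bounded_borel_const[of "1 / c"] this]
        show "L (\<lambda>x. c * u x) = 0" using mult False by (simp add: L_scale)
      qed
    qed (simp add: L_def)
  next
    case (add u v)
    show ?case
    proof
      assume b: "bounded_borel (\<lambda>x. v x + u x)"
      have "bounded_borel u" "bounded_borel v"
        by (rule bounded_borel_mono[OF b]; use add in simp)+
      then show "L (\<lambda>x. v x + u x) = 0" using add by (simp add: L_add)
    qed
  next
    case (seq U)
    show ?case
    proof
      assume u: "bounded_borel u"
      obtain C where "C \<ge> 0" and C: "\<And>x. x \<in> {0..1} \<Longrightarrow> \<bar>u x\<bar> \<le> C" using bounded_borel_bound[OF u] by blast
      have U_le: "U i x \<le> u x" for i x
        using seq by (intro incseq_le[of "\<lambda>i. U i x"]) (auto simp: incseq_def le_fun_def)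
      have b: "bounded_borel (U i)" for i
        by (rule bounded_borel_mono[OF u]) (use seq U_le in simp_all)
      show "L u = 0"
      proof (rule L_lim[OF b _ u])
        show "L (U n) = 0" for n using seq b by auto
        show "\<bar>U n x\<bar> \<le> C" if "x \<in> {0..1}" for n x
          using U_le[of n x] C[OF that] seq(2)[of n x] by linarith
        show "(\<lambda>n. U n x) \<longlonglongrightarrow> u x" for x using seq by simp
      qed
    qed
  qed
  have "bounded_borel (\<lambda>x. max 0 (f x))" "bounded_borel (\<lambda>x. max 0 (- f x))"
  proof -
    obtain C where C: "C \<ge> 0" "\<And>x. x \<in> {0..1} \<Longrightarrow> \<bar>f x\<bar> \<le> C" using bounded_borel_bound[OF f] by blast
    note [measurable] = f
    show "bounded_borel (\<lambda>x. max 0 (f x))" "bounded_borel (\<lambda>x. max 0 (- f x))"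
      by (rule bounded_borelI[of _ C], measurable, use C in \<open>force simp: abs_le_iff\<close>)+
  qed
  moreover have "f = (\<lambda>x. max 0 (f x) - max 0 (- f x))" by auto
  ultimately show ?thesis
    using L_diff[of "\<lambda>x. max 0 (f x)" "\<lambda>x. max 0 (- f x)"] L_nonneg unfolding L_def[symmetric]
    by (simp add: bounded_borel_measurable)
qed

section \<open>Borel functional calculus of a positive contraction\<close>

text \<open>Applying the recurrence \<open>m\<close> times leads from \<open>(j, l)\<close> along
  lattice paths of length \<open>m\<close>, and the binomial coefficient counts the paths to each
  endpoint. When \<open>F i l\<close> is the integral of t^i (1-t)^l, this is the expansion of (t +
  (1-t))^m.\<close>

lemma pascal_recurrence_binomial_sum:
  fixes F :: "nat \<Rightarrow> nat \<Rightarrow> real"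
  assumes "\<And>i l. F i l = F (Suc i) l + F i (Suc l)"
  shows "(\<Sum>i\<le>m. real (m choose i) * F (j + i) (l + (m - i))) = F j l"
proof (induction m arbitrary: j l)
  case (Suc m)
  have "(\<Sum>i\<le>Suc m. real (Suc m choose i) * F (j + i) (l + (Suc m - i)))
    = F j (l + Suc m) + (\<Sum>i\<le>m. real (Suc m choose Suc i) * F (j + Suc i) (l + (m - i)))"
    by (subst sum.atMost_Suc_shift) simp
  also have "\<dots> = (F j (l + Suc m) + (\<Sum>i\<le>m. real (m choose Suc i) * F (j + Suc i) (l + (m - i))))
      + (\<Sum>i\<le>m. real (m choose i) * F (Suc j + i) (l + (m - i)))"
    by (simp add: sum.distrib distrib_right)
  also have "F j (l + Suc m) + (\<Sum>i\<le>m. real (m choose Suc i) * F (j + Suc i) (l + (m - i)))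
    = (\<Sum>i\<le>Suc m. real (m choose i) * F (j + i) (l + (Suc m - i)))"
    by (subst sum.atMost_Suc_shift) simp
  also have "\<dots> = (\<Sum>i\<le>m. real (m choose i) * F (j + i) (Suc l + (m - i)))"
    by (simp add: Suc_diff_le)
  also have "\<dots> = F j (Suc l)" by (rule Suc.IH)
  also have "(\<Sum>i\<le>m. real (m choose i) * F (Suc j + i) (l + (m - i))) = F (Suc j) l"
    by (rule Suc.IH)
  finally show ?case using assms[of j l] by simp
qed simp

text \<open>The weight of \<open>k / n\<close> is the integral that the Bernstein polynomial (n
  choose k) t^k (1-t)^(n-k) has to have. The identity (n choose k)(k choose j) = (n choose j)(n-j
  choose k-j) reduces the moment condition to the lattice path sum.\<close>

lemma completely_monotone_moments:
  fixes F :: "nat \<Rightarrow> nat \<Rightarrow> real"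
  assumes rec: "\<And>i l. F i l = F (Suc i) l + F i (Suc l)" and nonneg: "\<And>i l. 0 \<le> F i l"
  obtains M where "unit_interval_measure M" "\<And>j. (\<integral>x. x ^ j \<partial>M) = F j 0"
proof (rule hausdorff_moment[of "\<lambda>n k. real (n choose k) * F k (n - k)" "\<lambda>j. F j 0"])
  fix n j :: nat assume "j \<le> n"
  have "(\<Sum>k\<le>n. real (k choose j) * (real (n choose k) * F k (n - k)))
    = (\<Sum>k\<in>{j..n}. real (k choose j) * (real (n choose k) * F k (n - k)))"
    by (rule sum.mono_neutral_right) auto
  also have "\<dots> = (\<Sum>k\<in>{j..n}. real (n choose j) * (real ((n - j) choose (k - j)) * F k (n - k)))"
  proof (rule sum.cong[OF refl])
    fix k assume "k \<in> {j..n}"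
    then have "real ((n choose k) * (k choose j)) = real ((n choose j) * ((n - j) choose (k - j)))"
      by (subst choose_mult) auto
    then show "real (k choose j) * (real (n choose k) * F k (n - k))
      = real (n choose j) * (real ((n - j) choose (k - j)) * F k (n - k))" 
      by (metis (no_types, opaque_lifting) mult.assoc mult.commute of_nat_mult)
  qed
  also have "\<dots> = (\<Sum>i\<le>n - j. real (n choose j) * (real ((n - j) choose i) * F (j + i) (0 + (n - j - i))))"
    using \<open>j \<le> n\<close> by (intro sum.reindex_bij_witness[of _ "\<lambda>i. j + i" "\<lambda>k. k - j"]) auto
  also have "\<dots> = real (n choose j) * F j 0"
    unfolding sum_distrib_left[symmetric] using pascal_recurrence_binomial_sum[of F, OF rec, of "n - j" j 0] by simp
  finally show "(\<Sum>k\<le>n. real (k choose j) * (real (n choose k) * F k (n - k))) = real (n choose j) * F j 0" .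
qed (use nonneg that in auto)

lemma inner_eqI: "(\<And>y. inner u y = inner v y) \<Longrightarrow> u = v" for u v :: "'a::real_inner"
  using vector_eq_rdot by blast

section \<open>Scalar spectral measures and the functional calculus on a real Hilbert space\<close>

locale positive_contraction =
  fixes T :: "'h::{real_inner, complete_space} \<Rightarrow>\<^sub>L 'h"
  assumes selfadjoint: "inner (T x) y = inner x (T y)"
    and inner_nonneg: "0 \<le> inner (T x) x"
    and inner_le: "inner (T x) x \<le> inner x x"
begin

abbreviation Tpow :: "nat \<Rightarrow> 'h \<Rightarrow> 'h" where
  "Tpow n \<equiv> (blinfun_apply T) ^^ n"

definition Tcompl :: "'h \<Rightarrow> 'h" where "Tcompl x = x - T x"

lemma Tpow_add: "Tpow n (x + y) = Tpow n x + Tpow n y"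
  by (induction n) (auto simp: blinfun.add_right)

lemma Tpow_scaleR: "Tpow n (c *\<^sub>R x) = c *\<^sub>R Tpow n x"
  by (induction n) (auto simp: blinfun.scaleR_right)

lemma Tpow_diff: "Tpow n (x - y) = Tpow n x - Tpow n y"
  by (induction n) (auto simp: blinfun.diff_right)

lemma Tpow_selfadjoint: "inner (Tpow n x) y = inner x (Tpow n y)"
  by (induction n arbitrary: x y) (auto simp: selfadjoint funpow_swap1)

lemma Tcompl_selfadjoint: "inner (Tcompl x) y = inner x (Tcompl y)"
  by (simp add: Tcompl_def inner_diff_left inner_diff_right selfadjoint)

lemma T_Tcompl_commute: "T (Tcompl x) = Tcompl (T x)"
  by (simp add: Tcompl_def blinfun.diff_right)

lemma Tcompl_pow_selfadjoint: "inner ((Tcompl ^^ n) x) y = inner x ((Tcompl ^^ n) y)"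
  by (induction n arbitrary: x y) (auto simp: Tcompl_selfadjoint funpow_swap1)

lemma T_Tcompl_pow_commute: "T ((Tcompl ^^ l) x) = (Tcompl ^^ l) (T x)"
  by (induction l) (auto simp: T_Tcompl_commute)

lemma Tpow_Tcompl_pow_commute: "Tpow k ((Tcompl ^^ l) x) = (Tcompl ^^ l) (Tpow k x)"
  by (induction k) (auto simp: T_Tcompl_pow_commute)

text \<open>Even powers are split off symmetrically. The remaining case of two odd exponents is
  $T(1-T) = T(1-T)T + (1-T)T(1-T)$.\<close>

lemma inner_Tpow_Tcompl_pow_nonneg: "0 \<le> inner (Tpow k ((Tcompl ^^ l) x)) x"
proof -
  have shift: "inner (Tpow (k + 2 * a) ((Tcompl ^^ (l + 2 * b)) x)) x
    = inner (Tpow k ((Tcompl ^^ l) (Tpow a ((Tcompl ^^ b) x)))) (Tpow a ((Tcompl ^^ b) x))" for k l a b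
  proof -
    have "Tpow (k + 2 * a) ((Tcompl ^^ (l + 2 * b)) x) = (Tcompl ^^ b) (Tpow a (Tpow k ((Tcompl ^^ l) (Tpow a ((Tcompl ^^ b) x)))))"
    proof -
      have "k + 2 * a = a + (k + a)" "l + 2 * b = b + (l + b)" by auto
      then show ?thesis by (simp only: funpow_add comp_apply Tpow_Tcompl_pow_commute[symmetric])
    qed
    then show ?thesis by (simp add: Tcompl_pow_selfadjoint Tpow_selfadjoint)
  qed
  have base: "0 \<le> inner (Tpow i ((Tcompl ^^ j) y)) y" if "i < 2" "j < 2" for i j y
  proof -
    have S0: "0 \<le> inner (Tcompl y) y" for y using inner_le[of y] by (simp add: Tcompl_def inner_diff_left)
    have "inner (T (Tcompl y)) y
      = inner (Tcompl (T y)) (T y) + inner (T (Tcompl y)) (Tcompl y)"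
      by (simp add: Tcompl_def inner_diff_left inner_diff_right blinfun.diff_right selfadjoint)
    then have "0 \<le> inner (T (Tcompl y)) y" using S0[of "T y"] inner_nonneg[of "Tcompl y"] by simp
    moreover have "i = 0 \<or> i = 1" "j = 0 \<or> j = 1" using that by auto
    ultimately show ?thesis using S0[of y] inner_nonneg[of y] by auto
  qed
  have "0 \<le> inner (Tpow (k mod 2 + 2 * (k div 2)) ((Tcompl ^^ (l mod 2 + 2 * (l div 2))) x)) x"
    unfolding shift by (rule base) auto
  then show ?thesis by simp
qed

text \<open>The Pascal recurrence is T + (1 - T) = 1 between vectors, and nonnegativity of the array
  is the preceding lemma.\<close>

lemma spectral_moments:
  obtains M where "unit_interval_measure M" "\<And>j. (\<integral>t. t ^ j \<partial>M) = inner (Tpow j x) x"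
proof (rule completely_monotone_moments[of "\<lambda>i l. inner (Tpow i ((Tcompl ^^ l) x)) x"])
  show "inner (Tpow i ((Tcompl ^^ l) x)) x = inner (Tpow (Suc i) ((Tcompl ^^ l) x)) x + inner (Tpow i ((Tcompl ^^ Suc l) x)) x" for i l
  proof -
    have "Tpow i (Tcompl v) = Tpow i v - Tpow (Suc i) v" for v
      by (simp add: Tcompl_def Tpow_diff funpow_swap1)
    then show ?thesis by (simp only: funpow.simps(2)[of l Tcompl] comp_apply) (simp add: inner_diff_left)
  qed
qed (use inner_Tpow_Tcompl_pow_nonneg that in auto)

text \<open>The choice is harmless: by \<open>moments_determine\<close> the moments fix the
  integrals of all bounded Borel functions.\<close>

definition M :: "'h \<Rightarrow> real measure" where
  "M x = (SOME M. unit_interval_measure M \<and> (\<forall>j. (\<integral>t. t ^ j \<partial>M) = inner (Tpow j x) x))"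

lemma M_unit: "unit_interval_measure (M x)" and M_moment: "(\<integral>t. t ^ j \<partial>M x) = inner (Tpow j x) x"
proof -
  have "\<exists>M. unit_interval_measure M \<and> (\<forall>j. (\<integral>t. t ^ j \<partial>M) = inner (Tpow j x) x)"
    using spectral_moments[of x] by metis
  from someI_ex[OF this] show "unit_interval_measure (M x)" "(\<integral>t. t ^ j \<partial>M x) = inner (Tpow j x) x"
    unfolding M_def[symmetric] by auto
qed

text \<open>Identities between such forms follow from their moments, which are given by powers of \<open>T\<close>.\<close>

definition form :: "(real \<Rightarrow> real) \<Rightarrow> 'h \<Rightarrow> 'h \<Rightarrow> real" where
  "form f x y = ((\<integral>t. f t \<partial>M (x + y)) - (\<integral>t. f t \<partial>M (x - y))) / 4"

lemma form_power: "form (\<lambda>t. t ^ n) x y = inner (Tpow n x) y"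
proof -
  have "inner (Tpow n y) x = inner (Tpow n x) y" by (metis Tpow_selfadjoint inner_commute)
  then show ?thesis
    by (simp add: form_def M_moment Tpow_add Tpow_diff inner_add_left inner_add_right inner_diff_left inner_diff_right)
qed

lemma form_cmult: "form (\<lambda>t. c * f t) x y = c * form f x y"
  by (simp add: form_def algebra_simps)

lemma form_add_fun: "bounded_borel f \<Longrightarrow> bounded_borel g \<Longrightarrow> form (\<lambda>t. f t + g t) x y = form f x y + form g x y"
  using M_unit by (simp add: form_def unit_interval_measure_integrable field_simps)

text \<open>Polarization makes each form a difference of two integrals with factors 1/4 and -1/4. A
  sum of weighted forms is therefore a sum of weighted integrals over
  \<open>I \<times> UNIV\<close>, to which \<open>moments_determine\<close> applies.\<close>

lemma form_sum_determined:
  assumes fin: "finite I" and g: "\<And>i. i \<in> I \<Longrightarrow> bounded_borel (g i)"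
    and moments: "\<And>n. (\<Sum>i\<in>I. form (\<lambda>t. g i t * t ^ n) (u i) (v i)) = 0"
    and f: "bounded_borel f"
  shows "(\<Sum>i\<in>I. form (\<lambda>t. g i t * f t) (u i) (v i)) = 0"
proof -
  define m where "m = (\<lambda>(i, b). M (if b then u i + v i else u i - v i))"
  define w where "w = (\<lambda>(i, b) t. (if b then 1 / 4 else - 1 / 4) * g i t)"
  have split: "(\<Sum>k\<in>I \<times> UNIV. \<integral>t. w k t * h t \<partial>m k) = (\<Sum>i\<in>I. form (\<lambda>t. g i t * h t) (u i) (v i))" for h
  proof -
    have "(\<Sum>k\<in>I \<times> UNIV. \<integral>t. w k t * h t \<partial>m k) = (\<Sum>i\<in>I. \<Sum>b\<in>UNIV. \<integral>t. w (i, b) t * h t \<partial>m (i, b))"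
      by (simp add: sum.cartesian_product case_prod_unfold)
    also have "\<dots> = (\<Sum>i\<in>I. form (\<lambda>t. g i t * h t) (u i) (v i))"
      by (intro sum.cong refl) (simp add: UNIV_bool m_def w_def form_def mult.assoc)
    finally show ?thesis .
  qed
  have "(\<Sum>k\<in>I \<times> UNIV. \<integral>t. w k t * f t \<partial>m k) = 0"
  proof (rule moments_determine[OF _ _ _ _ f])
    show "unit_interval_measure (m k)" for k by (simp add: m_def M_unit split: prod.split)
    show "bounded_borel (w k)" if "k \<in> I \<times> UNIV" for k
      using that g unfolding w_def by (auto simp only: split: prod.split intro!: bounded_borel_intros)
    show "(\<Sum>k\<in>I \<times> UNIV. \<integral>t. w k t * t ^ n \<partial>m k) = 0" for n unfolding split by (rule moments)
  qed (use fin in simp)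
  then show ?thesis by (simp add: split)
qed

lemma form_determined3:
  assumes g: "bounded_borel g1" "bounded_borel g2" "bounded_borel g3"
    and moments: "\<And>n. form (\<lambda>t. g1 t * t ^ n) u1 v1 + form (\<lambda>t. g2 t * t ^ n) u2 v2 + form (\<lambda>t. g3 t * t ^ n) u3 v3 = 0"
    and f: "bounded_borel f"
  shows "form (\<lambda>t. g1 t * f t) u1 v1 + form (\<lambda>t. g2 t * f t) u2 v2 + form (\<lambda>t. g3 t * f t) u3 v3 = 0"
proof -
  have "(\<Sum>i\<in>{0, 1, 2::nat}. form (\<lambda>t. (if i = 0 then g1 else if i = 1 then g2 else g3) t * f t)
      (if i = 0 then u1 else if i = 1 then u2 else u3) (if i = 0 then v1 else if i = 1 then v2 else v3)) = 0"
    by (rule form_sum_determined) (use g f moments in \<open>auto simp: add.assoc\<close>)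
  then show ?thesis by (simp add: add.assoc)
qed

lemma form_determined2:
  assumes g: "bounded_borel g1" "bounded_borel g2"
    and moments: "\<And>n. form (\<lambda>t. g1 t * t ^ n) u1 v1 = form (\<lambda>t. g2 t * t ^ n) u2 v2"
    and f: "bounded_borel f"
  shows "form (\<lambda>t. g1 t * f t) u1 v1 = form (\<lambda>t. g2 t * f t) u2 v2"
proof -
  have g2': "bounded_borel (\<lambda>t. -1 * g2 t)" by (intro bounded_borel_intros g)
  have neg: "form (\<lambda>t. -1 * g2 t * h t) u v = - form (\<lambda>t. g2 t * h t) u v" for h u v
    using form_cmult[of "-1" "\<lambda>t. g2 t * h t" u v] by simp
  have zero: "form (\<lambda>t. 0 * h t) u v = 0" for h u v by (simp add: form_def)
  have "form (\<lambda>t. g1 t * f t) u1 v1 + form (\<lambda>t. -1 * g2 t * f t) u2 v2 + form (\<lambda>t. 0 * f t) 0 0 = 0"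
  proof (rule form_determined3[OF g(1) g2' bounded_borel_const _ f])
    show "form (\<lambda>t. g1 t * t ^ n) u1 v1 + form (\<lambda>t. -1 * g2 t * t ^ n) u2 v2 + form (\<lambda>t. 0 * t ^ n) 0 0 = 0" for n
      using moments[of n] neg[of "\<lambda>t. t ^ n" u2 v2] zero[of "\<lambda>t. t ^ n" 0 0] by linarith
  qed
  then show ?thesis unfolding neg zero by simp
qed

lemma form_sym:
  assumes "bounded_borel f"
  shows "form f x y = form f y x"
proof -
  have "form (\<lambda>t. t ^ n) x y = form (\<lambda>t. t ^ n) y x" for n
    unfolding form_power using Tpow_selfadjoint[of n x y] inner_commute[of x "Tpow n y"] by simp
  then show ?thesis using form_determined2[of "\<lambda>_. 1" "\<lambda>_. 1" x y y x f] assms by simp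
qed

lemma form_add_left:
  assumes "bounded_borel f"
  shows "form f (x + x') y = form f x y + form f x' y"
proof -
  have neg: "form (\<lambda>t. -1 * h t) u v = - form h u v" for h u v by (simp only: form_cmult)
  have "form (\<lambda>t. 1 * f t) (x + x') y + form (\<lambda>t. -1 * f t) x y + form (\<lambda>t. -1 * f t) x' y = 0"
  proof (rule form_determined3[OF _ _ _ _ assms])
    show "form (\<lambda>t. 1 * t ^ n) (x + x') y + form (\<lambda>t. -1 * t ^ n) x y + form (\<lambda>t. -1 * t ^ n) x' y = 0" for n
      unfolding neg by (simp add: form_power Tpow_add inner_add_left)
  qed (rule bounded_borel_const)+
  then show ?thesis unfolding neg by simp
qed

lemma form_scaleR_left:
  assumes "bounded_borel f"
  shows "form f (c *\<^sub>R x) y = c * form f x y"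
proof -
  have "form (\<lambda>t. 1 * f t) (c *\<^sub>R x) y = form (\<lambda>t. c * f t) x y"
    by (rule form_determined2[OF _ _ _ assms]) (auto simp: form_cmult form_power Tpow_scaleR)
  then show ?thesis by (simp add: form_cmult)
qed

lemma M_mass: "(\<integral>t. 1 \<partial>M x) = (norm x)\<^sup>2"
  using M_moment[of x 0] by (simp add: power2_norm_eq_inner)

text \<open>The measures \<open>M (x + x)\<close> and \<open>M x\<close> are chosen independently;
  that integrals against the first are 4 times those against the second has to be read off from the
  moments.\<close>

lemma form_diag: 
  assumes f: "bounded_borel f"
  shows "form f x x = (\<integral>t. f t \<partial>M x)"
proof -
  have "(\<Sum>i\<in>{0, 1, 2::nat}. \<integral>t. (if i = 0 then 1 / 4 else if i = 1 then - 1 / 4 else - 1) * f t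
     \<partial>M (if i = 0 then x + x else if i = 1 then x - x else x)) = 0"
    by (rule moments_determine) (auto simp: M_unit f M_moment Tpow_add Tpow_diff inner_add_left inner_add_right)
  then show ?thesis by (simp add: form_def)
qed

text \<open>Polarization and the parallelogram law bound the form by \<open>C / 2\<close> times the
  sum of the squared norms. On unit vectors this is \<open>C\<close>, and bilinearity gives the
  product of the norms.\<close>

lemma form_bound:
  assumes f: "bounded_borel f" and C: "\<And>t. t \<in> {0..1} \<Longrightarrow> \<bar>f t\<bar> \<le> C"
  shows "\<bar>form f x y\<bar> \<le> C * norm x * norm y"
proof -
  have le: "\<bar>form f u v\<bar> \<le> C / 2 * ((norm u)\<^sup>2 + (norm v)\<^sup>2)" for u v
  proof -
    have "\<bar>\<integral>t. f t \<partial>M w\<bar> \<le> C * (norm w)\<^sup>2" for w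
      using unit_interval_measure_integral_bound[OF M_unit f C] unfolding M_mass .
    from this[of "u + v"] this[of "u - v"]
    have "\<bar>form f u v\<bar> \<le> (C * (norm (u + v))\<^sup>2 + C * (norm (u - v))\<^sup>2) / 4"
      unfolding form_def by (auto simp: abs_le_iff)
    also have "\<dots> = C / 2 * ((norm u)\<^sup>2 + (norm v)\<^sup>2)"
      by (simp add: power2_norm_eq_inner inner_add_left inner_add_right inner_diff_left inner_diff_right algebra_simps)
    finally show ?thesis .
  qed
  have scaleR_right: "form f u (c *\<^sub>R v) = c * form f u v" for u v c
    using form_scaleR_left[OF f] form_sym[OF f] by metis
  show ?thesis
  proof (cases "x = 0 \<or> y = 0")
    case True
    then show ?thesis
      using form_scaleR_left[OF f, of 0 x y] scaleR_right[of x 0 y] by auto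
  next
    case False
    have "form f x y = norm x * norm y * form f ((1 / norm x) *\<^sub>R x) ((1 / norm y) *\<^sub>R y)"
      using False by (simp add: form_scaleR_left[OF f] scaleR_right)
    moreover have "\<bar>form f ((1 / norm x) *\<^sub>R x) ((1 / norm y) *\<^sub>R y)\<bar> \<le> C"
      using le[of "(1 / norm x) *\<^sub>R x" "(1 / norm y) *\<^sub>R y"] False by simp
    ultimately have "\<bar>form f x y\<bar> \<le> norm x * norm y * C"
      by (simp add: abs_mult mult_left_mono)
    then show ?thesis by (simp add: mult_ac)
  qed
qed

lemma form_bounded_bilinear:
  assumes f: "bounded_borel f"
  shows "bounded_bilinear (form f)"
proof
  show "form f (a + a') b = form f a b + form f a' b" for a a' b by (rule form_add_left[OF f])
  show "form f a (b + b') = form f a b + form f a b'" for a b b'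
    using form_add_left[OF f] form_sym[OF f] by metis
  show "form f (r *\<^sub>R a) b = r *\<^sub>R form f a b" for r a b using form_scaleR_left[OF f] by simp
  show "form f a (r *\<^sub>R b) = r *\<^sub>R form f a b" for r a b
    using form_scaleR_left[OF f] form_sym[OF f] by (metis real_scaleR_def)
  obtain C where "C \<ge> 0" and C: "\<And>t. t \<in> {0..1} \<Longrightarrow> \<bar>f t\<bar> \<le> C" using bounded_borel_bound[OF f] by blast
  show "\<exists>K. \<forall>a b. norm (form f a b) \<le> norm a * norm b * K"
    using form_bound[OF f C] by (intro exI[of _ C]) (simp add: mult_ac)
qed

definition Phi :: "(real \<Rightarrow> real) \<Rightarrow> 'h \<Rightarrow>\<^sub>L 'h" where
  "Phi f = (SOME B. \<forall>x y. inner (blinfun_apply B x) y = form f x y)"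

lemma inner_Phi:
  assumes "bounded_borel f"
  shows "inner (Phi f x) y = form f x y"
proof -
  have "\<exists>B. \<forall>x y. inner (blinfun_apply B x) y = form f x y"
    by (rule bounded_bilinear_form_represented[OF form_bounded_bilinear[OF assms]]) blast
  from someI_ex[OF this] show ?thesis by (simp add: Phi_def)
qed

lemma Phi_eqI:
  assumes "bounded_borel f" "\<And>x y. inner (blinfun_apply B x) y = form f x y"
  shows "Phi f = B"
  by (rule blinfun_eqI, rule inner_eqI) (simp add: assms inner_Phi)

lemma inner_Phi_diag: "bounded_borel f \<Longrightarrow> inner (Phi f x) x = (\<integral>t. f t \<partial>M x)"
  by (simp add: inner_Phi form_diag)

lemma Phi_selfadjoint: "bounded_borel f \<Longrightarrow> inner (Phi f x) y = inner x (Phi f y)"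
  using form_sym[of f x y] inner_commute[of x "Phi f y"] by (simp add: inner_Phi)

lemma Phi_power: "Phi (\<lambda>t. t ^ n) x = Tpow n x"
  by (rule inner_eqI) (simp add: inner_Phi bounded_borel_power form_power)

lemma Phi_one: "Phi (\<lambda>_. 1) = id_blinfun"
  using Phi_power[of 0] by (intro blinfun_eqI) simp

lemma Phi_id: "Phi (\<lambda>t. t) = T"
  using Phi_power[of 1] by (intro blinfun_eqI) simp

lemma Phi_add: "bounded_borel f \<Longrightarrow> bounded_borel g \<Longrightarrow> Phi (\<lambda>t. f t + g t) = Phi f + Phi g"
  by (intro Phi_eqI bounded_borel_add) (simp_all add: blinfun.add_left inner_add_left inner_Phi form_add_fun)

lemma Phi_cmult: "bounded_borel f \<Longrightarrow> Phi (\<lambda>t. c * f t) = c *\<^sub>R Phi f"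
  by (intro Phi_eqI bounded_borel_mult) (simp_all add: blinfun.scaleR_left inner_Phi form_cmult)

lemma Phi_cong:
  assumes "bounded_borel f" "g \<in> borel_measurable borel" "\<And>x. x \<in> {0..1} \<Longrightarrow> f x = g x"
  shows "Phi f = Phi g"
proof -
  obtain C where "\<forall>x\<in>{0..1}. \<bar>f x\<bar> \<le> C" using assms(1) unfolding bounded_borel_def by blast
  then have g: "bounded_borel g"
    by (intro bounded_borelI[of _ C] assms(2)) (simp add: assms(3)[symmetric])
  show ?thesis
    unfolding Phi_def form_def
    using unit_interval_measure_integral_cong[OF M_unit assms] by simp
qed

text \<open>For powers of \<open>T\<close> the operator \<open>B\<close> moves to the second
  argument of the form as its adjoint, and moments extend this to \<open>f\<close>. \<open>B\<close>
  may be merely real-linear, so it can be multiplication by i (complex linearity of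
  \<open>Phi f\<close>), an element of the commutant, or a projection of another spectral
  measure.\<close>

lemma Phi_commute:
  assumes f: "bounded_borel f" and B: "T o\<^sub>L B = B o\<^sub>L T"
  shows "Phi f o\<^sub>L B = B o\<^sub>L Phi f"
proof -
  have TB: "T (B x) = B (T x)" for x
    using B by (metis blinfun_apply_blinfun_compose)
  have TnB: "Tpow n (B x) = B (Tpow n x)" for n x
    by (induction n) (auto simp: TB)
  obtain B' :: "'h \<Rightarrow>\<^sub>L 'h" where B': "\<And>x y. inner (B x) y = inner x (B' y)"
    using blinfun_adjoint_exists by blast
  have "form f (B x) y = form f x (B' y)" for x y
    using form_determined2[of "\<lambda>_. 1" "\<lambda>_. 1" "B x" y x "B' y" f] f
    by (simp add: form_power TnB B')
  then have "inner (Phi f (B x)) y = inner (B (Phi f x)) y" for x y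
    by (simp add: inner_Phi f B')
  then have "Phi f (B x) = B (Phi f x)" for x
    by (rule inner_eqI)
  then show ?thesis by (intro blinfun_eqI) simp
qed

lemma form_times_power: 
  assumes "bounded_borel f"
  shows "form (\<lambda>t. t ^ k * f t) x y = form f (Tpow k x) y"
proof -
  have "form (\<lambda>t. t ^ k * f t) x y = form (\<lambda>t. 1 * f t) (Tpow k x) y"
  proof (rule form_determined2[OF bounded_borel_power[OF bounded_borel_id] bounded_borel_const _ assms])
    show "form (\<lambda>t. t ^ k * t ^ n) x y = form (\<lambda>t. 1 * t ^ n) (Tpow k x) y" for n
      using form_power[of "n + k" x y] form_power[of n "Tpow k x" y]
      by (simp add: power_add funpow_add mult.commute)
  qed
  then show ?thesis by simp
qed

text \<open>Multiplicativity is extended one factor at a time. When \<open>f\<close> is a power,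
  symmetry of the form moves the power to the second argument and the preceding lemma applies to
  \<open>g\<close>; equality of moments then gives the claim for every \<open>f\<close>.\<close>

lemma form_times:
  assumes f: "bounded_borel f" and g: "bounded_borel g"
  shows "form (\<lambda>t. g t * f t) x y = form f (Phi g x) y"
proof -
  have "form (\<lambda>t. g t * f t) x y = form (\<lambda>t. 1 * f t) (Phi g x) y"
  proof (rule form_determined2[OF g bounded_borel_const _ f])
    fix n
    have tg: "bounded_borel (\<lambda>t. t ^ n * g t)" by (intro bounded_borel_intros g)
    have "form (\<lambda>t. g t * t ^ n) x y = form (\<lambda>t. t ^ n * g t) y x"
      using form_sym[OF tg] by (simp add: mult.commute)
    also have "\<dots> = form g x (Tpow n y)"
      by (simp add: form_times_power g form_sym[of g _ x])
    also have "\<dots> = form (\<lambda>t. 1 * t ^ n) (Phi g x) y"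
      by (simp add: form_power inner_Phi[OF g, symmetric] Tpow_selfadjoint)
    finally show "form (\<lambda>t. g t * t ^ n) x y = form (\<lambda>t. 1 * t ^ n) (Phi g x) y" .
  qed
  then show ?thesis by simp
qed

theorem Phi_mult:
  assumes f: "bounded_borel f" and g: "bounded_borel g"
  shows "Phi (\<lambda>t. f t * g t) = Phi f o\<^sub>L Phi g"
  using form_times[OF f g]
  by (intro Phi_eqI bounded_borel_mult f g) (simp add: inner_Phi f mult.commute)

end

section \<open>Complex structure and projection-valued measures\<close>

lemma cinner_scaleC_right: "cinner x (c *\<^sub>C y) = cnj c * cinner x (y :: 'h::complex_hilbert_space)"
  by (metis cinner_commute cinner_scaleC_left complex_cnj_mult complex_cnj_cnj)

lemma cinner_add_right: "cinner x (y + z) = cinner x y + cinner x (z :: 'h::complex_hilbert_space)"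
  by (metis cinner_commute cinner_add_left complex_cnj_add)

text \<open>The imaginary part is again a real inner product, since cinner x (i y) is -i times
  cinner x y. This carries the results on real Hilbert spaces over to complex ones.\<close>

lemma cinner_eq_Complex: "cinner x y = Complex (inner x y) (inner x (\<i> *\<^sub>C (y :: 'h::complex_hilbert_space)))"
  by (simp add: complex_eq_iff inner_eq_Re_cinner cinner_scaleC_right)

lemma scaleC_eq: "c *\<^sub>C x = Re c *\<^sub>R x + Im c *\<^sub>R (\<i> *\<^sub>C (x :: 'h::complex_hilbert_space))"
proof -
  have "c = complex_of_real (Re c) + complex_of_real (Im c) * \<i>"
    by (simp add: complex_eq_iff)
  then have "c *\<^sub>C x = (complex_of_real (Re c) + complex_of_real (Im c) * \<i>) *\<^sub>C x"
    by (rule arg_cong)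
  then show ?thesis by (simp add: scaleC_add_left scaleC_scaleC[symmetric] scaleC_of_real)
qed

lemma inner_imaginary_swap: "inner (\<i> *\<^sub>C x) y = - inner x (\<i> *\<^sub>C (y :: 'h::complex_hilbert_space))"
  by (simp add: inner_eq_Re_cinner cinner_scaleC_left cinner_scaleC_right)

lemma imaginary_imaginary: "\<i> *\<^sub>C \<i> *\<^sub>C x = - (x :: 'h::complex_hilbert_space)"
  using scaleC_of_real[of "-1" x] by (simp add: scaleC_scaleC)

text \<open>A bounded real-linear operator is complex-linear exactly when it commutes with this one,
  so complex linearity becomes an instance of commutation.\<close>

lift_definition imaginary_op :: "'h::complex_hilbert_space \<Rightarrow>\<^sub>L 'h" is "\<lambda>x. \<i> *\<^sub>C x"
proof (rule bounded_linear_intro[where K = 1])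
  show "\<i> *\<^sub>C (x + y) = \<i> *\<^sub>C x + \<i> *\<^sub>C (y :: 'h)" for x y by (rule scaleC_add_right)
  show "\<i> *\<^sub>C (r *\<^sub>R x) = r *\<^sub>R (\<i> *\<^sub>C (x :: 'h))" for r x
    by (simp add: scaleC_of_real[symmetric] scaleC_scaleC mult.commute)
  show "norm (\<i> *\<^sub>C (x :: 'h)) \<le> norm x * 1" for x
    by (simp add: norm_eq_sqrt_inner inner_imaginary_swap imaginary_imaginary)
qed

lemma bounded_ops_iff: "A \<in> bounded_ops \<longleftrightarrow> A o\<^sub>L imaginary_op = imaginary_op o\<^sub>L A"
proof
  assume "A \<in> bounded_ops"
  then show "A o\<^sub>L imaginary_op = imaginary_op o\<^sub>L A"
    by (intro blinfun_eqI) (simp add: bounded_ops_def imaginary_op.rep_eq)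
next
  assume comm: "A o\<^sub>L imaginary_op = imaginary_op o\<^sub>L A"
  have "A (\<i> *\<^sub>C x) = \<i> *\<^sub>C A x" for x
    using arg_cong[OF comm, of "\<lambda>B. blinfun_apply B x"] by (simp add: imaginary_op.rep_eq)
  then show "A \<in> bounded_ops"
    unfolding bounded_ops_def
    by (subst scaleC_eq, subst (2) scaleC_eq) (simp add: blinfun.add_right blinfun.scaleR_right)
qed

lemma bounded_ops_imaginary: "A \<in> bounded_ops \<Longrightarrow> A (\<i> *\<^sub>C x) = \<i> *\<^sub>C A x"
  by (simp add: bounded_ops_def)

lemma is_adjoint_selfI:
  assumes "A \<in> bounded_ops" "\<And>x y. inner (A x) y = inner x (A y)"
  shows "is_adjoint A A"
  using assms by (simp add: is_adjoint_def cinner_eq_Complex bounded_ops_imaginary[symmetric])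

lemma is_adjoint_inner:
  "is_adjoint A B \<Longrightarrow> inner (A x) y = inner x (B y)"
  by (simp add: is_adjoint_def inner_eq_Re_cinner)

lemma adj_eqI:
  assumes "is_adjoint A B"
  shows "adj A = B"
  unfolding adj_def
proof (rule the_equality[where P = "is_adjoint A", OF assms])
  fix C assume C: "is_adjoint A C"
  show "C = B"
  proof (rule blinfun_eqI)
    fix x
    have "inner (C x) y = inner (B x) y" for y
      using is_adjoint_inner[OF C, of y x] is_adjoint_inner[OF assms, of y x] by (simp add: inner_commute)
    then show "C x = B x" by (rule inner_eqI)
  qed
qed

lemma cinner_selfadjoint_real:
  assumes "A \<in> bounded_ops" "\<And>x y. inner (A x) y = inner x (A y)"
  shows "cinner (A x) x = complex_of_real (inner (A x) x)"
proof -
  have "inner (A x) (\<i> *\<^sub>C x) = - inner (A (\<i> *\<^sub>C x)) x"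
    using assms(1) by (simp add: bounded_ops_imaginary inner_imaginary_swap)
  also have "\<dots> = - inner (A x) (\<i> *\<^sub>C x)"
    by (simp add: assms(2) inner_commute)
  finally show ?thesis by (simp add: cinner_eq_Complex complex_eq_iff)
qed

text \<open>Polarizing inner (A u) (i u) = 0 gives a skew relation between two vectors; inserting i
  y for the second one removes the i.\<close>

lemma selfadjoint_if_cinner_real:
  assumes A: "A \<in> bounded_ops" and real: "\<And>x. Im (cinner (A x) x) = 0"
  shows "inner (A x) y = inner x (A y)"
proof -
  have diag: "inner (A u) (\<i> *\<^sub>C u) = 0" for u
    using real[of u] by (simp add: cinner_eq_Complex)
  have "inner (A u) (\<i> *\<^sub>C v) + inner (A v) (\<i> *\<^sub>C u) = 0" for u v
    using diag[of "u + v"] diag[of u] diag[of v]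
    by (simp add: blinfun.add_right scaleC_add_right inner_add_left inner_add_right)
  from this[of x "\<i> *\<^sub>C y"] show ?thesis
    using A by (simp add: imaginary_imaginary bounded_ops_imaginary inner_imaginary_swap inner_commute)
qed

lemma pos_op_selfadjoint:
  "pos_op A \<Longrightarrow> inner (A x) y = inner x (A y)"
  by (rule selfadjoint_if_cinner_real) (auto simp: pos_op_def complex_nonneg_Reals_iff)

lemma pos_op_iff:
  "pos_op A \<longleftrightarrow> A \<in> bounded_ops \<and>
     (\<forall>x y. inner (A x) y = inner x (A y)) \<and> (\<forall>x. 0 \<le> inner (A x) x)"
proof
  assume "pos_op A"
  then show "A \<in> bounded_ops \<and>
     (\<forall>x y. inner (A x) y = inner x (A y)) \<and> (\<forall>x. 0 \<le> inner (A x) x)"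
    using pos_op_selfadjoint by (auto simp: pos_op_def complex_nonneg_Reals_iff inner_eq_Re_cinner)
next
  assume "A \<in> bounded_ops \<and>
     (\<forall>x y. inner (A x) y = inner x (A y)) \<and> (\<forall>x. 0 \<le> inner (A x) x)"
  then show "pos_op A"
    unfolding pos_op_def by (auto simp: cinner_selfadjoint_real)
qed

lemma selfadjoint_eqI:
  fixes A B :: "'a::real_inner \<Rightarrow>\<^sub>L 'a"
  assumes A: "\<And>x y. inner (A x) y = inner x (A y)"
    and B: "\<And>x y. inner (B x) y = inner x (B y)"
    and diag: "\<And>x. inner (A x) x = inner (B x) x"
  shows "A = B"
proof (rule blinfun_eqI, rule inner_eqI)
  fix x y
  have "inner (A x) y + inner (A y) x
    = inner (B x) y + inner (B y) x"
    using diag[of "x + y"] diag[of x] diag[of y]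
    by (simp add: blinfun.add_right inner_add_left inner_add_right)
  then show "inner (A x) y = inner (B x) y"
    using A[of y x] B[of y x] by (simp add: inner_commute)
qed

text \<open>Complex polarization: replacing \<open>x\<close> by i x changes the relative sign of the
  two mixed terms and so separates them. This suits the uniqueness of \<open>fun_calc\<close>, where
  complex linearity and the diagonal are given.\<close>

lemma bounded_ops_eqI:
  assumes A: "A \<in> bounded_ops" "B \<in> bounded_ops"
    and diag: "\<And>x. cinner (A x) x = cinner (B x) x"
  shows "A = B"
proof (rule blinfun_eqI, rule inner_eqI)
  fix x y
  have *: "cinner (A u) v + cinner (A v) u
    = cinner (B u) v + cinner (B v) u" for u v
    using diag[of "u + v"] diag[of u] diag[of v]
    by (simp add: blinfun.add_right cinner_add_left cinner_add_right add.commute)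
  from *[of x y] *[of "\<i> *\<^sub>C x" y]
  have "cinner (A x) y = cinner (B x) y"
    using assms(1,2) by (simp add: bounded_ops_imaginary cinner_scaleC_left cinner_scaleC_right right_diff_distrib[symmetric] complex_eq_iff)
  then show "inner (A x) y = inner (B x) y"
    by (simp add: inner_eq_Re_cinner)
qed

lemma projection_inner:
  assumes "is_projection P"
  shows "inner (P x) y = inner x (P y)"
    and "P (P x) = P x"
    and "inner (P x) x = (norm (P x))\<^sup>2"
proof -
  show 1: "inner (P x) y = inner x (P y)" for x y
    using assms by (simp add: is_projection_def is_adjoint_inner)
  show 2: "P (P x) = P x" for x
    using assms by (metis is_projection_def blinfun_apply_blinfun_compose)
  show "inner (P x) x = (norm (P x))\<^sup>2"
    using 1[of "P x" x] by (simp add: 2 power2_norm_eq_inner)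
qed

section \<open>Projection-valued measures and the scalar measures of vectors\<close>

locale pvm =
  fixes E :: "real set \<Rightarrow> ('h::complex_hilbert_space \<Rightarrow>\<^sub>L 'h)"
  assumes is_pvm: "is_pvm E"
begin

lemma projection: "S \<in> sets borel \<Longrightarrow> is_projection (E S)"
  and E_UNIV: "E UNIV = id_blinfun"
  and E_Int: "S \<in> sets borel \<Longrightarrow> S' \<in> sets borel \<Longrightarrow> E (S \<inter> S') = E S o\<^sub>L E S'"
  and E_sums: "range F \<subseteq> sets borel \<Longrightarrow> disjoint_family F \<Longrightarrow>
    (\<lambda>n. E (F n) x) sums E (\<Union>n. F n) x"
  using is_pvm unfolding is_pvm_def by blast+

lemma sets_scalar_measure [measurable_cong]: "sets (scalar_measure E x) = sets borel"
  using sets.sigma_sets_eq[of "borel :: real measure"] by (simp add: scalar_measure_def)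

lemma space_scalar_measure [simp]: "space (scalar_measure E x) = UNIV"
  by (simp add: scalar_measure_def)

lemma emeasure_scalar_measure:
  assumes "S \<in> sets borel"
  shows "emeasure (scalar_measure E x) S = ennreal ((norm (E S x))\<^sup>2)"
proof -
  have eq: "Re (cinner (E S x) x) = (norm (E S x))\<^sup>2" if "S \<in> sets borel" for S
    using projection_inner(3)[OF projection[OF that]] by (simp add: inner_eq_Re_cinner)
  have "countably_additive (sets borel) (\<lambda>S. ennreal (Re (cinner (E S x) x)))"
  proof (rule countably_additiveI)
    fix F :: "nat \<Rightarrow> real set" assume F: "range F \<subseteq> sets borel" "disjoint_family F"
    have "(\<lambda>n. inner (E (F n) x) x) sums inner (E (\<Union>n. F n) x) x"
      by (rule bounded_linear.sums[OF bounded_linear_inner_left E_sums[OF F]])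
    then show "(\<Sum>n. ennreal (Re (cinner (E (F n) x) x)))
      = ennreal (Re (cinner (E (\<Union>n. F n) x) x))"
      using F(1) eq by (intro suminf_ennreal_eq) (auto simp: inner_eq_Re_cinner)
  qed
  moreover have "E {} = 0"
  proof (rule blinfun_eqI)
    fix x
    have "(\<lambda>n::nat. E {} x) sums E {} x"
      using E_sums[of "\<lambda>_. {}" x] by (simp add: disjoint_family_on_def)
    then have "E {} x = 0"
      using sums_summable summable_const_iff by blast
    then show "E {} x = blinfun_apply 0 x" by simp
  qed
  ultimately have "emeasure (scalar_measure E x) S = ennreal (Re (cinner (E S x) x))"
    using assms sets.sigma_sets_eq[of "borel :: real measure"]
    by (intro emeasure_measure_of[OF scalar_measure_def[of E x]])
      (auto simp: positive_def cinner_eq_Complex sets_scalar_measure)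
  then show ?thesis using eq[OF assms] by simp
qed

lemma finite_scalar_measure: "finite_measure (scalar_measure E x)"
  by (rule finite_measureI) (simp add: emeasure_scalar_measure)

lemma measure_scalar_measure:
  "S \<in> sets borel \<Longrightarrow> measure (scalar_measure E x) S = (norm (E S x))\<^sup>2"
  by (simp add: measure_def emeasure_scalar_measure)

text \<open>Projecting the vector restricts its measure, because E A (E S x) = E (A \<inter> S)
  x.\<close>

lemma scalar_measure_range:
  assumes S: "S \<in> sets borel"
  shows "scalar_measure E (E S x) = density (scalar_measure E x) (indicator S)"
proof (rule measure_eqI)
  show "emeasure (scalar_measure E (E S x)) A = emeasure (density (scalar_measure E x) (indicator S)) A"
    if "A \<in> sets (scalar_measure E (E S x))" for A
  proof -
    have A: "A \<in> sets borel" using that sets_scalar_measure by blast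
    have "emeasure (density (scalar_measure E x) (indicator S)) A = emeasure (scalar_measure E x) (A \<inter> S)"
      using A S by (subst emeasure_density)
        (auto simp: nn_integral_indicator[symmetric] sets_scalar_measure indicator_inter_arith mult.commute simp del: nn_integral_indicator intro!: measurable_If)
    then show ?thesis
      using A S by (simp add: emeasure_scalar_measure E_Int)
  qed
qed (simp add: sets_scalar_measure)

lemma integral_scalar_measure_range:
  fixes f :: "real \<Rightarrow> real"
  assumes S: "S \<in> sets borel" and f: "f \<in> borel_measurable borel"
  shows "(\<integral>t. f t \<partial>scalar_measure E (E S x)) = (\<integral>t. indicator S t * f t \<partial>scalar_measure E x)"
proof -
  have [measurable]: "f \<in> borel_measurable (scalar_measure E x)" "S \<in> sets (scalar_measure E x)"
    using f S by (auto simp: measurable_cong_sets[OF sets_scalar_measure refl] sets_scalar_measure)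
  have d: "density (scalar_measure E x) (indicator S) = density (scalar_measure E x) (\<lambda>t. ennreal (indicator S t))"
    by (simp add: ennreal_indicator)
  show ?thesis
    unfolding scalar_measure_range[OF S] d
    using integral_density[of f "scalar_measure E x" "indicator S"] by simp
qed

end

text \<open>The vectors E S x and E (- S) x are orthogonal, and their squared norms add up to that
  of x because the scalar measure is additive; hence x minus both has norm zero.\<close>

lemma projection_complement:
  assumes "is_pvm E" "S \<in> sets borel"
  shows "E (- S) = id_blinfun - E S"
proof -
  interpret pvm E by unfold_locales fact
  have "x - E S x - E (- S) x = 0" for x
  proof -
    interpret finite_measure "scalar_measure E x" by (rule finite_scalar_measure)
    have S: "S \<in> sets borel" "- S \<in> sets borel" using assms(2) by auto
    define p where "p = E S x"
    define q where "q = E (- S) x"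
    have "E {} x = 0"
      using emeasure_scalar_measure[of "{}" x] by simp
    then have "inner p q = 0"
      using projection_inner(1)[OF projection[OF S(1)], of x q] E_Int[OF S] by (simp add: p_def q_def)
    have "(norm x)\<^sup>2 = (norm p)\<^sup>2 + (norm q)\<^sup>2"
      using finite_measure_compl[of S] measure_scalar_measure[of UNIV x] measure_scalar_measure[OF S(1), of x]
        measure_scalar_measure[OF S(2), of x] S
      by (simp add: E_UNIV Compl_eq_Diff_UNIV sets_scalar_measure p_def q_def)
    moreover have "inner x p = (norm p)\<^sup>2" "inner x q = (norm q)\<^sup>2"
      using projection_inner(3)[OF projection[OF S(1)], of x] projection_inner(3)[OF projection[OF S(2)], of x]
      by (simp_all add: p_def q_def inner_commute)
    ultimately have "(norm (x - p - q))\<^sup>2 = 0"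
      using \<open>inner p q = 0\<close> unfolding power2_norm_eq_inner
      by (simp add: inner_diff_left inner_diff_right inner_commute)
    then show ?thesis by (simp add: p_def q_def)
  qed
  then have "x - E S x = E (- S) x" for x
    by (simp only: right_minus_eq)
  then show ?thesis
    by (intro blinfun_eqI) (simp add: blinfun.diff_left)
qed

section \<open>Uniqueness of the projection-valued measure of an operator\<close>

lemma spectral_integral_range:
  assumes "is_pvm E" "is_spectral_integral E (\<lambda>t. t) T" "S \<in> sets borel"
  shows "inner (T (E S x)) (E S x)
    = (\<integral>t. indicator S t * t \<partial>scalar_measure E x)"
proof -
  interpret pvm E by unfold_locales fact
  show ?thesis
    using assms(2,3) integral_scalar_measure_range[of S "\<lambda>t. t" x]
    by (simp add: is_spectral_integral_def inner_eq_Re_cinner)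
qed

text \<open>\<open>T\<close> has no off-diagonal part with respect to \<open>E S\<close>, since its quadratic form is the sum of its
  restrictions to the ranges of \<open>E S\<close> and \<open>E (- S)\<close>.\<close>

lemma pvm_commutes_with_integral:
  assumes E: "is_pvm E" and T: "is_spectral_integral E (\<lambda>t. t) T" and S: "S \<in> sets borel"
    and sa: "\<And>x y. inner (T x) y = inner x (T y)"
  shows "T o\<^sub>L E S = E S o\<^sub>L T"
proof -
  interpret pvm E by unfold_locales fact
  define P where "P = E S"
  define Q where "Q = E (- S)"
  have Q: "Q x = x - P x" for x
    using projection_complement[OF E S] by (simp add: P_def Q_def blinfun.diff_left)
  note P = projection_inner[OF projection[OF S], folded P_def]
  have PQ: "P (Q x) = 0" for x by (simp add: Q blinfun.diff_right P(2))
  have QQ: "Q (Q x) = Q x" 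
    and QP: "Q (P x) = 0" for x by (simp_all add: Q blinfun.diff_right P(2))
  have diag: "inner (T (P x)) (Q x) = 0" for x
  proof -
    have intT: "integrable (scalar_measure E x) (\<lambda>t. t)" and
      Tx: "inner (T x) x = (\<integral>t. t \<partial>scalar_measure E x)"
      using T by (auto simp: is_spectral_integral_def inner_eq_Re_cinner)
    have int: "integrable (scalar_measure E x) (\<lambda>t. indicator A t * t)" if "A \<in> sets borel" for A :: "real set"
      using integrable_mult_indicator[OF _ intT, of A] that by (simp add: sets_scalar_measure)
    have "(\<integral>t. t \<partial>scalar_measure E x)
      = (\<integral>t. indicator S t * t + indicator (- S) t * t \<partial>scalar_measure E x)"
      by (rule Bochner_Integration.integral_cong) (auto simp: indicator_def)
    also have "\<dots> = (\<integral>t. indicator S t * t \<partial>scalar_measure E x) + (\<integral>t. indicator (- S) t * t \<partial>scalar_measure E x)"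
      using S by (intro Bochner_Integration.integral_add int) auto
    finally have "inner (T x) x = inner (T (P x)) (P x)
      + inner (T (Q x)) (Q x)"
      using spectral_integral_range[OF E T, of _ x] S by (simp add: Tx P_def Q_def)
    moreover have "inner (T x) x
      = inner (T (P x + Q x)) (P x + Q x)"
      by (simp add: Q)
    ultimately have "inner (T (P x)) (Q x)
      + inner (T (Q x)) (P x) = 0"
      by (simp add: blinfun.add_right inner_add_left inner_add_right)
    then show ?thesis
      using sa[of "Q x" "P x"] by (simp add: inner_commute)
  qed
  have off: "inner (T (P x)) (Q y) = 0" for x y
    using diag[of "P x + Q y"]
    by (simp add: blinfun.add_right P(2) PQ QP QQ)
  have TP: "T (P x) = P (T (P x))" for x
  proof (rule inner_eqI)
    show "inner (T (P x)) y = inner (P (T (P x))) y" for y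
      using off[of x y] by (simp add: Q inner_diff_right P(1))
  qed
  have "T (P x) = P (T x)" for x
  proof (rule inner_eqI)
    fix y
    have "inner (P (T x)) y = inner x (T (P y))"
      by (simp add: P(1) sa)
    also have "\<dots> = inner x (P (T (P y)))" by (simp only: TP[symmetric])
    also have "\<dots> = inner (P (T (P x))) y" by (simp add: P(1) sa)
    finally show "inner (T (P x)) y = inner (P (T x)) y"
      by (simp only: TP[symmetric])
  qed
  then show ?thesis unfolding P_def[symmetric] by (intro blinfun_eqI) simp
qed

text \<open>On the range of \<open>E {..a}\<close> the quadratic form of \<open>T\<close> is at most
  a |v|^2, on the range of \<open>E' {b<..}\<close> it is at least b |v|^2.\<close>

lemma pvm_below_above_zero:
  assumes E: "is_pvm E" "is_spectral_integral E (\<lambda>t. t) T"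
    and E': "is_pvm E'" "is_spectral_integral E' (\<lambda>t. t) T"
    and v: "E {..a} v = v" "E' {b<..} v = v" and "a < b"
  shows "v = 0"
proof -
  interpret E: pvm E by unfold_locales fact
  interpret E': pvm E' by unfold_locales fact
  have "inner (T v) v = (\<integral>t. indicator {..a} t * t \<partial>scalar_measure E v)"
    using spectral_integral_range[OF E, of "{..a}" v] v by simp
  also have "\<dots> \<le> (\<integral>t. indicator {..a} t * a \<partial>scalar_measure E v)"
  proof (rule integral_mono)
    interpret finite_measure "scalar_measure E v" by (rule E.finite_scalar_measure)
    show "integrable (scalar_measure E v) (\<lambda>t. indicator {..a} t * t)"
      using E(2) integrable_mult_indicator[of "{..a}" "scalar_measure E v" "\<lambda>t. t"]
      by (simp add: is_spectral_integral_def E.sets_scalar_measure)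
    show "integrable (scalar_measure E v) (\<lambda>t. indicator {..a} t * a)"
      by (intro integrable_mult_left integrable_real_indicator) (auto simp: E.sets_scalar_measure emeasure_eq_measure)
  qed (auto simp: indicator_def)
  also have "\<dots> = a * (norm v)\<^sup>2"
    by (simp add: E.measure_scalar_measure v)
  finally have 1: "inner (T v) v \<le> a * (norm v)\<^sup>2" .
  have "b * (norm v)\<^sup>2 = (\<integral>t. indicator {b<..} t * b \<partial>scalar_measure E' v)"
    by (simp add: E'.measure_scalar_measure v)
  also have "\<dots> \<le> (\<integral>t. indicator {b<..} t * t \<partial>scalar_measure E' v)"
  proof (rule integral_mono)
    interpret finite_measure "scalar_measure E' v" by (rule E'.finite_scalar_measure)
    show "integrable (scalar_measure E' v) (\<lambda>t. indicator {b<..} t * t)"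
      using E'(2) integrable_mult_indicator[of "{b<..}" "scalar_measure E' v" "\<lambda>t. t"]
      by (simp add: is_spectral_integral_def E'.sets_scalar_measure)
    show "integrable (scalar_measure E' v) (\<lambda>t. indicator {b<..} t * b)"
      by (intro integrable_mult_left integrable_real_indicator) (auto simp: E'.sets_scalar_measure emeasure_eq_measure)
  qed (auto simp: indicator_def)
  also have "\<dots> = inner (T v) v"
    using spectral_integral_range[OF E', of "{b<..}" v] v by simp
  finally have "b * (norm v)\<^sup>2 \<le> a * (norm v)\<^sup>2" using 1 by simp
  then have "(b - a) * (norm v)\<^sup>2 \<le> 0" by (simp add: algebra_simps)
  then show ?thesis using \<open>a < b\<close> by (simp add: mult_le_0_iff)
qed

text \<open>The part of \<open>E' {a<..}\<close> that lies in the range of \<open>E {..a}\<close>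
  must vanish. The preceding comparison needs a gap, so it is applied to \<open>{b<..}\<close> with
  \<open>a < b\<close>, and a sequence of these half-lines exhausts \<open>{a<..}\<close>.\<close>

lemma pvm_atMost_compose:
  assumes E: "is_pvm E" "is_spectral_integral E (\<lambda>t. t) T"
    and E': "is_pvm E'" "is_spectral_integral E' (\<lambda>t. t) T"
    and comm: "\<And>S S'. S \<in> sets borel \<Longrightarrow> S' \<in> sets borel \<Longrightarrow> E S o\<^sub>L E' S' = E' S' o\<^sub>L E S"
  shows "E {..a} = E {..a} o\<^sub>L E' {..a}"
proof (rule blinfun_eqI)
  fix x
  interpret E: pvm E by unfold_locales fact
  interpret E': pvm E' by unfold_locales fact
  have comm': "E S (E' S' y) = E' S' (E S y)"
    if "S \<in> sets borel" "S' \<in> sets borel" for S S' y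
    using comm[OF that] by (metis blinfun_apply_blinfun_compose)
  define v where "v = E {..a} (E' {a<..} x)"
  have Ev: "E {..a} v = v"
    by (simp add: v_def projection_inner(2)[OF E.projection])
  have E'v: "E' {a<..} v = v"
    by (simp add: v_def comm' projection_inner(2)[OF E'.projection])
  have "E' {b<..} v = 0" if "a < b" for b
  proof (rule pvm_below_above_zero[OF E E' _ _ that])
    show "E {..a} (E' {b<..} v) = E' {b<..} v"
      by (simp add: comm' Ev)
    show "E' {b<..} (E' {b<..} v) = E' {b<..} v"
      by (simp add: projection_inner(2)[OF E'.projection])
  qed
  then have null: "{a + 1 / real (Suc n)<..} \<in> null_sets (scalar_measure E' v)" for n
    by (auto simp: null_sets_def E'.sets_scalar_measure E'.emeasure_scalar_measure)
  have "{a<..} = (\<Union>n. {a + 1 / real (Suc n)<..})"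
  proof (intro equalityI subsetI)
    fix y assume "y \<in> {a<..}"
    then obtain n where "1 / real (Suc n) < y - a" using nat_approx_posE[of "y - a"] by auto
    then show "y \<in> (\<Union>n. {a + 1 / real (Suc n)<..})" by (auto intro!: exI[of _ n])
  qed (auto intro: less_trans[of a "a + 1 / real (Suc n)" for n])
  then have "{a<..} \<in> null_sets (scalar_measure E' v)" using null by (metis null_sets_UN)
  then have "v = 0"
    using E'.emeasure_scalar_measure[of "{a<..}" v] E'v by (auto simp: null_sets_def)
  moreover have "- {..a} = {a<..}" by auto
  ultimately show "E {..a} x = (E {..a} o\<^sub>L E' {..a}) x"
    using projection_complement[OF E'(1), of "{..a}"]
    by (simp add: v_def blinfun.diff_left blinfun.diff_right)
qed

text \<open>On half-lines, inclusion of the projections in both directions gives equality. So all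
  scalar measures have the same distribution functions, and the two projections have equal
  diagonals. Commutation is supplied by \<open>Phi_commute\<close> where this is applied.\<close>

theorem pvm_unique:
  assumes E: "is_pvm E" "is_spectral_integral E (\<lambda>t. t) T"
    and E': "is_pvm E'" "is_spectral_integral E' (\<lambda>t. t) T"
    and comm: "\<And>S S'. S \<in> sets borel \<Longrightarrow> S' \<in> sets borel \<Longrightarrow> E S o\<^sub>L E' S' = E' S' o\<^sub>L E S"
    and S: "S \<in> sets borel"
  shows "E S = E' S"
proof -
  interpret E: pvm E by unfold_locales fact
  interpret E': pvm E' by unfold_locales fact
  have comm': "E' S o\<^sub>L E S' = E S' o\<^sub>L E' S" if "S \<in> sets borel" "S' \<in> sets borel" for S S'
    using comm[OF that(2,1)] by simp
  have atMost: "E {..a} = E' {..a}" for a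
  proof -
    have "E {..a} = E {..a} o\<^sub>L E' {..a}" by (rule pvm_atMost_compose[OF E E' comm])
    also have "\<dots> = E' {..a} o\<^sub>L E {..a}" by (rule comm) auto
    also have "\<dots> = E' {..a}" by (rule pvm_atMost_compose[OF E' E comm', symmetric])
    finally show ?thesis .
  qed
  have "scalar_measure E x = scalar_measure E' x" for x
  proof (rule cdf_unique')
    show "finite_borel_measure (scalar_measure E x)" "finite_borel_measure (scalar_measure E' x)"
      by (auto simp: finite_borel_measure_def finite_borel_measure_axioms_def E.sets_scalar_measure E'.sets_scalar_measure
          E.finite_scalar_measure E'.finite_scalar_measure)
    show "cdf (scalar_measure E x) = cdf (scalar_measure E' x)"
      by (simp add: fun_eq_iff cdf_def2 E.measure_scalar_measure E'.measure_scalar_measure atMost)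
  qed
  then have "(norm (E S x))\<^sup>2 = (norm (E' S x))\<^sup>2" for x
    using E.measure_scalar_measure[OF S, of x] E'.measure_scalar_measure[OF S, of x] by simp
  then show ?thesis
    using projection_inner[OF E.projection[OF S]] projection_inner[OF E'.projection[OF S]]
    by (intro selfadjoint_eqI) auto
qed

section \<open>The spectral measure of a positive contraction on a complex Hilbert space\<close>

locale positive_contraction_op =
  fixes T :: "'h::complex_hilbert_space \<Rightarrow>\<^sub>L 'h"
  assumes pos: "pos_op T" and norm_le: "norm T \<le> 1"

sublocale positive_contraction_op \<subseteq> positive_contraction T
proof
  show "inner (T x) y = inner x (T y)" for x y
    using pos unfolding pos_op_iff by blast
  show "0 \<le> inner (T x) x" for x using pos unfolding pos_op_iff by blast
  show "inner (T x) x \<le> inner x x" for x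
  proof -
    have "inner (T x) x \<le> norm (T x) * norm x" by (rule norm_cauchy_schwarz)
    also have "\<dots> \<le> norm x * norm x"
      using norm_blinfun[of T x] mult_right_mono[OF norm_le, of "norm x"] by (intro mult_right_mono) auto
    finally show ?thesis by (simp add: power2_norm_eq_inner[symmetric] power2_eq_square)
  qed
qed

context positive_contraction_op
begin

lemma Phi_bounded_ops: "bounded_borel f \<Longrightarrow> Phi f \<in> bounded_ops"
  using pos by (auto simp: pos_op_def bounded_ops_iff intro!: Phi_commute)

lemma cinner_Phi: "bounded_borel f \<Longrightarrow> cinner (Phi f x) x = complex_of_real (\<integral>t. f t \<partial>M x)"
  using cinner_selfadjoint_real[OF Phi_bounded_ops Phi_selfadjoint] by (simp add: inner_Phi_diag)

text \<open>The value 0 off the Borel sets matches the normalization in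
  \<open>spectral_measure\<close>, so that the two can be equal as total functions.\<close>

definition E :: "real set \<Rightarrow> 'h \<Rightarrow>\<^sub>L 'h" where
  "E S = (if S \<in> sets borel then Phi (indicator S) else 0)"

lemma sets_M [measurable_cong]: "sets (M x) = sets borel"
  using M_unit[of x] by (simp add: unit_interval_measure_def)

lemma space_M [simp]: "space (M x) = UNIV"
  using sets_eq_imp_space_eq[OF sets_M] by simp

lemma finite_M: "finite_measure (M x)"
  using M_unit[of x] by (simp add: unit_interval_measure_def)

lemma E_projection:
  assumes "S \<in> sets borel"
  shows "is_projection (E S)"
proof -
  have "E S o\<^sub>L E S = E S"
  proof -
    have "(\<lambda>t. indicator S t * indicator S t :: real) = indicator S" by (auto simp: indicator_def)
    then show ?thesis using Phi_mult[of "indicator S" "indicator S"] assms by (simp add: E_def)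
  qed
  then show ?thesis
    using assms by (simp add: is_projection_def E_def Phi_bounded_ops is_adjoint_selfI Phi_selfadjoint)
qed

lemma norm_E: "S \<in> sets borel \<Longrightarrow> (norm (E S x))\<^sup>2 = measure (M x) S"
  using projection_inner(3)[OF E_projection, of S x]
  by (simp add: E_def inner_Phi_diag)

lemma E_disjoint_Un:
  assumes "A \<in> sets borel" "B \<in> sets borel" "A \<inter> B = {}"
  shows "E (A \<union> B) = E A + E B"
proof -
  have "(indicator (A \<union> B) :: real \<Rightarrow> real) = (\<lambda>t. indicator A t + indicator B t)"
    using assms(3) by (auto simp: indicator_def fun_eq_iff)
  then show ?thesis using assms Phi_add[of "indicator A" "indicator B"] by (simp add: E_def)
qed

theorem E_pvm: "is_pvm E"
  unfolding is_pvm_def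
proof (intro conjI ballI allI impI)
  have "(indicator UNIV :: real \<Rightarrow> real) = (\<lambda>_. 1)" by auto
  then show "E UNIV = id_blinfun" by (simp add: E_def Phi_one)
  show "E (S \<inter> S') = E S o\<^sub>L E S'" if "S \<in> sets borel" "S' \<in> sets borel" for S S'
  proof -
    have "(indicator (S \<inter> S') :: real \<Rightarrow> real) = (\<lambda>t. indicator S t * indicator S' t)"
      by (auto simp: indicator_def)
    then show ?thesis using that Phi_mult[of "indicator S" "indicator S'"] by (simp add: E_def)
  qed
  fix F :: "nat \<Rightarrow> real set" and x
  assume F: "range F \<subseteq> sets borel \<and> disjoint_family F"
  then have [measurable]: "F n \<in> sets borel" for n by auto
  \<comment> \<open>\<open>R n\<close> is the tail of the union. Since |E (R n) x|^2 = M x (R n),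
    continuity from above of a finite measure gives convergence of the series at each
    vector.\<close>
  define R where "R n = (\<Union>k. F k) - (\<Union>k<n. F k)" for n
  have [measurable]: "R n \<in> sets borel" for n unfolding R_def by measurable
  have E_part: "E (\<Union>k. F k) = (\<Sum>k<n. E (F k)) + E (R n)" for n
  proof -
    have "E (\<Union>k<n. F k) = (\<Sum>k<n. E (F k))"
    proof (induction n)
      case 0
      have "(indicator {} :: real \<Rightarrow> real) = (\<lambda>t. 0 * 0)" by auto
      then show ?case using Phi_cmult[of "\<lambda>_. 0" 0] by (simp add: E_def)
    next
      case (Suc n)
      have "F k \<inter> F n = {}" if "k < n" for k
        using F that disjoint_family_onD[of F UNIV k n] by simp
      then have "(\<Union>k<n. F k) \<inter> F n = {}" by auto
      then have "E ((\<Union>k<n. F k) \<union> F n) = E (\<Union>k<n. F k) + E (F n)"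
        by (intro E_disjoint_Un) auto
      moreover have "(\<Union>k<Suc n. F k) = (\<Union>k<n. F k) \<union> F n" by (auto simp: less_Suc_eq)
      ultimately show ?case using Suc by simp
    qed
    moreover have "E ((\<Union>k<n. F k) \<union> R n) = E (\<Union>k<n. F k) + E (R n)"
      by (rule E_disjoint_Un) (auto simp: R_def)
    moreover have U: "(\<Union>k. F k) = (\<Union>k<n. F k) \<union> R n" by (auto simp: R_def)
    ultimately show ?thesis using arg_cong[OF U, of E] by simp
  qed
  interpret Mx: finite_measure "M x" by (rule finite_M)
  have "(\<lambda>n. measure (M x) (R n)) \<longlonglongrightarrow> measure (M x) (\<Inter>n. R n)"
    by (rule Mx.finite_Lim_measure_decseq) (auto simp: sets_M R_def decseq_def)
  moreover have "(\<Inter>n. R n) = {}" by (auto simp: R_def)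
  ultimately have "(\<lambda>n. (norm (E (R n) x))\<^sup>2) \<longlonglongrightarrow> 0" by (simp add: norm_E)
  then have "(\<lambda>n. sqrt ((norm (E (R n) x))\<^sup>2)) \<longlonglongrightarrow> sqrt 0" by (rule tendsto_real_sqrt)
  then have "(\<lambda>n. E (R n) x) \<longlonglongrightarrow> 0" by (simp add: tendsto_norm_zero_iff)
  then have "(\<lambda>n. E (\<Union>k. F k) x - E (R n) x) \<longlonglongrightarrow> E (\<Union>k. F k) x - 0"
    by (intro tendsto_intros)
  moreover have "E (\<Union>k. F k) x - E (R n) x = (\<Sum>k<n. E (F k) x)" for n
    by (subst E_part[of n]) (simp add: blinfun.add_left blinfun.sum_left)
  ultimately show "(\<lambda>n. E (F n) x) sums E (\<Union>k. F k) x"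
    by (simp add: sums_def)
qed (rule E_projection)

sublocale E: pvm E by unfold_locales (rule E_pvm)

lemma scalar_measure_E: "scalar_measure E x = M x"
proof (rule measure_eqI)
  interpret Mx: finite_measure "M x" by (rule finite_M)
  show "emeasure (scalar_measure E x) A = emeasure (M x) A" if "A \<in> sets (scalar_measure E x)" for A
    using that by (simp add: E.sets_scalar_measure E.emeasure_scalar_measure norm_E Mx.emeasure_eq_measure)
qed (simp add: E.sets_scalar_measure sets_M)

lemma spectral_integral_Phi: "bounded_borel f \<Longrightarrow> is_spectral_integral E f (Phi f)"
  using unit_interval_measure_integrable[OF M_unit]
  by (simp add: is_spectral_integral_def Phi_bounded_ops scalar_measure_E cinner_Phi)

text \<open>A competitor \<open>E'\<close> commutes with its integral \<open>T\<close>, hence with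
  every \<open>Phi f\<close> and in particular with \<open>E\<close>; this is the commutation that
  \<open>pvm_unique\<close> asks for. The competitor is not assumed to be carried by the unit
  interval.\<close>

theorem spectral_measure_eq: "spectral_measure T = E"
  unfolding spectral_measure_def
proof (rule the_equality)
  show "is_pvm E \<and> (\<forall>S. S \<notin> sets borel \<longrightarrow> E S = 0) \<and> is_spectral_integral E (\<lambda>x. x) T"
    using E_pvm spectral_integral_Phi[OF bounded_borel_id] by (simp add: E_def Phi_id)
  fix E' assume E': "is_pvm E' \<and> (\<forall>S. S \<notin> sets borel \<longrightarrow> E' S = 0) \<and> is_spectral_integral E' (\<lambda>x. x) T"
  show "E' = E"
  proof
    fix S show "E' S = E S"
    proof (cases "S \<in> sets borel")
      case True
      have "E A o\<^sub>L E' A' = E' A' o\<^sub>L E A" if "A \<in> sets borel" "A' \<in> sets borel" for A A'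
        using that Phi_commute[of "indicator A" "E' A'"] pvm_commutes_with_integral[of E' T A'] E' selfadjoint
        by (simp add: E_def)
      then show ?thesis
        using pvm_unique[of E T E' S] E' E_pvm spectral_integral_Phi[OF bounded_borel_id] True by (simp add: Phi_id)
    qed (use E' in \<open>simp add: E_def\<close>)
  qed
qed

theorem fun_calc_eq:
  assumes "bounded_borel f"
  shows "fun_calc f T = Phi f"
  unfolding fun_calc_def spectral_measure_eq
proof (rule the_equality)
  show "is_spectral_integral E f (Phi f)" by (rule spectral_integral_Phi[OF assms])
  show "C = Phi f" if "is_spectral_integral E f C" for C
    using that Phi_bounded_ops[OF assms]
    by (intro bounded_ops_eqI) (auto simp: is_spectral_integral_def scalar_measure_E cinner_Phi[OF assms])
qed

end

section \<open>Positive square roots and the trace of the functional calculus\<close>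

text \<open>The quadratic form is minimal at \<open>y\<close>, so its first variation there vanishes
  in every direction \<open>z\<close>.\<close>

lemma psd_kernel:
  fixes A :: "'a::real_inner \<Rightarrow>\<^sub>L 'a"
  assumes sa: "\<And>x y. inner (A x) y = inner x (A y)"
    and pos: "\<And>x. 0 \<le> inner (A x) x" and zero: "inner (A y) y = 0"
  shows "A y = 0"
proof (rule inner_eqI)
  fix z
  have "0 \<le> t * (2 * inner (A y) z) + t\<^sup>2 * inner (A z) z" for t
    using pos[of "y + t *\<^sub>R z"] zero sa[of z y]
    by (simp add: blinfun.add_right blinfun.scaleR_right inner_add_left inner_add_right inner_commute
        power2_eq_square algebra_simps)
  from linear_coeff_zero_if_quadratic_nonneg[OF this]
  show "inner (A y) z = inner 0 z" by simp
qed

text \<open>With y = (A - B) x, commutation gives (A + B) y = 0. So the nonnegative numbers <A y, y>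
  and <B y, y> vanish, and \<open>psd_kernel\<close> gives A y = B y = 0. Then |y|^2 = <x, (A - B)
  y> = 0.\<close>

lemma commuting_psd_sqrt_unique:
  fixes A B :: "'a::real_inner \<Rightarrow>\<^sub>L 'a"
  assumes A: "\<And>x y. inner (A x) y = inner x (A y)" "\<And>x. 0 \<le> inner (A x) x"
    and B: "\<And>x y. inner (B x) y = inner x (B y)" "\<And>x. 0 \<le> inner (B x) x"
    and comm: "A o\<^sub>L B = B o\<^sub>L A" and sq: "A o\<^sub>L A = B o\<^sub>L B"
  shows "A = B"
proof (rule blinfun_eqI)
  fix x
  have AB: "A (B z) = B (A z)"
    and AA: "A (A z) = B (B z)" for z
    using comm sq by (metis blinfun_apply_blinfun_compose)+
  define y where "y = A x - B x"
  have "A y + B y = 0"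
    by (simp add: y_def blinfun.diff_right AA AB)
  then have "inner (A y) y + inner (B y) y = 0"
    by (simp add: inner_add_left[symmetric])
  then have "inner (A y) y = 0" "inner (B y) y = 0"
    using A(2)[of y] B(2)[of y] by linarith+
  then have "A y = 0" "B y = 0"
    using psd_kernel[OF A] psd_kernel[OF B] by auto
  moreover have "inner y y = inner (A x) y - inner (B x) y"
    by (simp add: inner_diff_left[symmetric] y_def[symmetric])
  ultimately have "inner y y = 0" by (simp add: A(1) B(1))
  then show "A x = B x" by (simp add: y_def)
qed

lemma bounded_ops_commute:
  "A \<in> bounded_ops \<Longrightarrow> A (imaginary_op x) = imaginary_op (A x)"
  by (simp add: imaginary_op.rep_eq bounded_ops_imaginary)

lemma blinfun_compose_assoc: "(A o\<^sub>L B) o\<^sub>L C = A o\<^sub>L (B o\<^sub>L C)"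
  by (rule blinfun_eqI) simp

context positive_contraction_op
begin

lemma T_bounded_ops: "T \<in> bounded_ops"
  using pos by (simp add: pos_op_def)

text \<open>\<open>T\<close> is itself a positive root of T^2. For uniqueness every root
  \<open>B\<close> is compared with \<open>R\<close>, the root given by the functional calculus of
  T^2: \<open>B\<close> commutes with B^2 = T^2 and therefore with \<open>R\<close>, whereas two
  arbitrary roots are not known to commute beforehand.\<close>

theorem abs_op_eq: "abs_op T = T"
proof -
  have adj: "adj T = T"
    by (rule adj_eqI[OF is_adjoint_selfI[OF T_bounded_ops selfadjoint]])
  have "positive_contraction_op (T o\<^sub>L T)"
  proof
    have "T o\<^sub>L T \<in> bounded_ops" using T_bounded_ops by (simp add: bounded_ops_def)
    moreover have "inner (T (T x)) y = inner x (T (T y))" for x y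
      by (simp add: selfadjoint)
    moreover have "0 \<le> inner (T (T x)) x" for x
      using selfadjoint[of "T x" x] by simp
    ultimately show "pos_op (T o\<^sub>L T)" unfolding pos_op_iff by simp
    show "norm (T o\<^sub>L T) \<le> 1"
      using norm_blinfun_compose[of T T] mult_mono[OF norm_le norm_le] by simp
  qed
  then interpret sq: positive_contraction_op "T o\<^sub>L T" .
  define R where "R = sq.Phi (\<lambda>t. sqrt t)"
  have b: "bounded_borel (\<lambda>t. sqrt t)" by (rule bounded_borelI[of _ 1]) auto
  have R_sa: "inner (R x) y = inner x (R y)" for x y
    unfolding R_def by (rule sq.Phi_selfadjoint[OF b])
  have R_pos: "0 \<le> inner (R x) x" for x
  proof -
    have "AE t in sq.M x. 0 \<le> sqrt t" by (rule unit_interval_measure_AE[OF sq.M_unit]) simp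
    then show ?thesis unfolding R_def sq.inner_Phi_diag[OF b] by (rule integral_nonneg_AE)
  qed
  have R_sq: "R o\<^sub>L R = T o\<^sub>L T"
  proof -
    have "R o\<^sub>L R = sq.Phi (\<lambda>t. sqrt t * sqrt t)" unfolding R_def by (rule sq.Phi_mult[OF b b, symmetric])
    also have "\<dots> = sq.Phi (\<lambda>t. t)" by (rule sq.Phi_cong[OF bounded_borel_mult[OF b b]]) auto
    finally show ?thesis by (simp add: sq.Phi_id)
  qed
  have eq_R: "B = R" if B: "pos_op B" "B o\<^sub>L B = T o\<^sub>L T" for B
  proof (rule commuting_psd_sqrt_unique)
    have "(T o\<^sub>L T) o\<^sub>L B = B o\<^sub>L (T o\<^sub>L T)" 
      unfolding B(2)[symmetric] by (rule blinfun_compose_assoc)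
    then show "B o\<^sub>L R = R o\<^sub>L B" unfolding R_def by (rule sq.Phi_commute[OF b, symmetric])
    show "B o\<^sub>L B = R o\<^sub>L R" by (simp add: B R_sq)
    show "inner (B x) y = inner x (B y)" "0 \<le> inner (B x) x" for x y
      using B(1) unfolding pos_op_iff by blast+
  qed (rule R_sa R_pos)+
  show ?thesis
    unfolding abs_op_def adj
  proof (rule the_equality)
    show "pos_op T \<and> T o\<^sub>L T = T o\<^sub>L T" using pos by simp
    show "B = T" if "pos_op B \<and> B o\<^sub>L B = T o\<^sub>L T" for B
      using that eq_R[of B] eq_R[of T] pos by simp
  qed
qed

lemma Phi_diff: 
  assumes "bounded_borel f" "bounded_borel g"
  shows "Phi (\<lambda>t. f t - g t) = Phi f - Phi g"
proof -
  have "Phi (\<lambda>t. f t + -1 * g t) = Phi f + Phi (\<lambda>t. -1 * g t)"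
    by (intro Phi_add bounded_borel_intros assms)
  also have "Phi (\<lambda>t. -1 * g t) = -1 *\<^sub>R Phi g" by (rule Phi_cmult[OF assms(2)])
  finally show ?thesis by simp
qed

lemma Phi_pos:
  assumes f: "bounded_borel f" and nonneg: "\<And>t. t \<in> {0..1} \<Longrightarrow> 0 \<le> f t"
  shows "pos_op (Phi f)"
  unfolding pos_op_iff
proof (intro conjI allI)
  have "AE t in M x. 0 \<le> f t" for x by (rule unit_interval_measure_AE[OF M_unit nonneg])
  then show "0 \<le> inner (Phi f x) x" for x
    unfolding inner_Phi_diag[OF f] by (rule integral_nonneg_AE)
qed (rule Phi_bounded_ops[OF f] Phi_selfadjoint[OF f])+

lemma Phi_mono: 
  assumes "bounded_borel f" "bounded_borel g" "\<And>t. t \<in> {0..1} \<Longrightarrow> f t \<le> g t"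
  shows "op_le (Phi f) (Phi g)"
  unfolding op_le_def Phi_diff[OF assms(2,1), symmetric]
  by (rule Phi_pos) (use assms in auto)

text \<open>This makes \<open>Phi u\<close> the least upper bound of an increasing sequence
  \<open>Phi (U n)\<close>, as normality demands. The order is tested on diagonals, where dominated
  convergence applies.\<close>

lemma op_le_Phi_limit:
  assumes U: "\<And>n. bounded_borel (U n)" and u: "bounded_borel u"
    and bd: "\<And>n t. t \<in> {0..1} \<Longrightarrow> \<bar>U n t\<bar> \<le> C" and lim: "\<And>t. t \<in> {0..1} \<Longrightarrow> (\<lambda>n. U n t) \<longlonglongrightarrow> u t"
    and A: "pos_op A" "\<And>n. op_le (Phi (U n)) A"
  shows "op_le (Phi u) A"
  unfolding op_le_def pos_op_iff
proof (intro conjI allI)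
  have bo: "A \<in> bounded_ops" and sa: "\<And>x y. inner (A x) y = inner x (A y)"
    using A(1) unfolding pos_op_iff by blast+
  show "A - Phi u \<in> bounded_ops"
    unfolding bounded_ops_iff using bo Phi_bounded_ops[OF u]
    by (intro blinfun_eqI) (simp add: imaginary_op.rep_eq[symmetric] bounded_ops_commute blinfun.diff_left blinfun.diff_right)
  show "inner ((A - Phi u) x) y = inner x ((A - Phi u) y)" for x y
    by (simp add: blinfun.diff_left inner_diff_left inner_diff_right sa Phi_selfadjoint[OF u])
  show "0 \<le> inner ((A - Phi u) x) x" for x
  proof -
    have "(\<lambda>n. \<integral>t. 1 * U n t \<partial>M x) \<longlonglongrightarrow> (\<integral>t. 1 * u t \<partial>M x)"
      by (rule unit_interval_measure_dominated[OF M_unit bounded_borel_const U u bd lim])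
    then have "(\<lambda>n. inner (Phi (U n) x) x) \<longlonglongrightarrow> inner (Phi u x) x"
      by (simp add: inner_Phi_diag U u)
    moreover have "inner (Phi (U n) x) x \<le> inner (A x) x" for n
      using A(2)[of n] unfolding op_le_def pos_op_iff by (simp add: blinfun.diff_left inner_diff_left)
    ultimately have "inner (Phi u x) x \<le> inner (A x) x"
      by (intro LIMSEQ_le_const2) auto
    then show ?thesis by (simp add: blinfun.diff_left inner_diff_left)
  qed
qed

end

lemma normal_onD:
  assumes "normal_on N \<tau>" "D \<subseteq> pos_part N" "A \<in> pos_part N" "D \<noteq> {}"
    and "\<And>B B'. B \<in> D \<Longrightarrow> B' \<in> D \<Longrightarrow> \<exists>C\<in>D. op_le B C \<and> op_le B' C"
    and "\<And>B. B \<in> D \<Longrightarrow> op_le B A"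
    and "\<And>C. C \<in> pos_part N \<Longrightarrow> (\<And>B. B \<in> D \<Longrightarrow> op_le B C) \<Longrightarrow> op_le A C"
  shows "\<tau> A = (SUP B\<in>D. \<tau> B)"
proof -
  have "\<forall>B\<in>D. \<forall>B'\<in>D. \<exists>C\<in>D. op_le B C \<and> op_le B' C" "\<forall>B\<in>D. op_le B A"
    "\<forall>C\<in>pos_part N. (\<forall>B\<in>D. op_le B C) \<longrightarrow> op_le A C"
    using assms(5-7) by auto
  then show ?thesis using assms(1-4) unfolding normal_on_def by simp
qed

section \<open>The trace as a measure on the spectrum\<close>

locale traced_positive_contraction = positive_contraction_op T
  for T :: "'h::complex_hilbert_space \<Rightarrow>\<^sub>L 'h" +
  fixes N :: "('h \<Rightarrow>\<^sub>L 'h) set" and \<tau> :: "('h \<Rightarrow>\<^sub>L 'h) \<Rightarrow> ennreal"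
  assumes vn: "von_neumann_algebra N" and trace: "trace_on N \<tau>" and normal: "normal_on N \<tau>"
    and T_in: "T \<in> N"
begin

text \<open>The bicommutant does it: what commutes with \<open>N\<close> commutes with
  \<open>T\<close> and hence with \<open>Phi f\<close>.\<close>

lemma Phi_in:
  assumes f: "bounded_borel f"
  shows "Phi f \<in> N"
proof -
  have "Phi f \<in> commutant (commutant N)"
    unfolding commutant_def[of "commutant N"]
  proof (intro CollectI conjI ballI Phi_bounded_ops[OF f])
    fix B assume "B \<in> commutant N"
    then have "T o\<^sub>L B = B o\<^sub>L T" using T_in by (simp add: commutant_def)
    then show "B o\<^sub>L Phi f = Phi f o\<^sub>L B" by (rule Phi_commute[OF f, symmetric])
  qed
  then show ?thesis using vn by (simp add: von_neumann_algebra_def)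
qed

lemma Phi_pos_part:
  "bounded_borel f \<Longrightarrow> (\<And>t. t \<in> {0..1} \<Longrightarrow> 0 \<le> f t) \<Longrightarrow> Phi f \<in> pos_part N"
  unfolding pos_part_def by (auto intro: Phi_in Phi_pos)

lemma trace_Phi_add:
  assumes "bounded_borel f" "\<And>t. t \<in> {0..1} \<Longrightarrow> 0 \<le> f t" "bounded_borel g" "\<And>t. t \<in> {0..1} \<Longrightarrow> 0 \<le> g t"
  shows "\<tau> (Phi (\<lambda>t. f t + g t)) = \<tau> (Phi f) + \<tau> (Phi g)"
  using trace Phi_pos_part[OF assms(1,2)] Phi_pos_part[OF assms(3,4)]
  unfolding Phi_add[OF assms(1,3)] trace_on_def by blast

lemma trace_Phi_cmult:
  assumes "bounded_borel f" "\<And>t. t \<in> {0..1} \<Longrightarrow> 0 \<le> f t" "0 \<le> c"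
  shows "\<tau> (Phi (\<lambda>t. c * f t)) = ennreal c * \<tau> (Phi f)"
  using trace Phi_pos_part[OF assms(1,2)] assms(3)
  unfolding Phi_cmult[OF assms(1)] trace_on_def by blast

text \<open>The members of the increasing sequence form a directed set with least upper bound
  \<open>Phi u\<close>, so normality acts as monotone convergence.\<close>

lemma trace_Phi_SUP:
  assumes U: "\<And>n. bounded_borel (U n)" and u: "bounded_borel u"
    and nonneg: "\<And>n t. 0 \<le> U n t" and inc: "incseq U"
    and lim: "\<And>t. (\<lambda>n. U n t) \<longlonglongrightarrow> u t"
  shows "\<tau> (Phi u) = (SUP n. \<tau> (Phi (U n)))"
proof -
  have U_le: "U n t \<le> u t" for n t
    using inc lim[of t] by (intro incseq_le[of "\<lambda>i. U i t"]) (auto simp: incseq_def le_fun_def)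
  obtain C where C: "\<And>t. t \<in> {0..1} \<Longrightarrow> \<bar>u t\<bar> \<le> C" using bounded_borel_bound[OF u] by blast
  have bd: "\<bar>U n t\<bar> \<le> C" if "t \<in> {0..1}" for n t
    using U_le[of n t] C[OF that] nonneg[of n t] by linarith
  have "\<tau> (Phi u) = (SUP B \<in> range (\<lambda>n. Phi (U n)). \<tau> B)"
  proof (rule normal_onD[OF normal])
    show "range (\<lambda>n. Phi (U n)) \<subseteq> pos_part N" using U nonneg by (auto intro: Phi_pos_part)
    show "Phi u \<in> pos_part N" using u U_le nonneg by (intro Phi_pos_part) (auto intro: order_trans[OF nonneg[of 0] U_le])
    show "\<exists>C\<in>range (\<lambda>n. Phi (U n)). op_le B C \<and> op_le B' C"
      if BB': "B \<in> range (\<lambda>n. Phi (U n))" "B' \<in> range (\<lambda>n. Phi (U n))" for B B'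
    proof -
      obtain m n where "B = Phi (U m)" "B' = Phi (U n)" using BB' by auto
      moreover have "op_le (Phi (U m)) (Phi (U (max m n)))" "op_le (Phi (U n)) (Phi (U (max m n)))"
        using inc U by (auto intro!: Phi_mono simp: incseq_def le_fun_def)
      ultimately show ?thesis by blast
    qed
    show "op_le B (Phi u)" if "B \<in> range (\<lambda>n. Phi (U n))" for B
      using that U u U_le by (auto intro: Phi_mono)
    show "op_le (Phi u) A" if "A \<in> pos_part N" "\<And>B. B \<in> range (\<lambda>n. Phi (U n)) \<Longrightarrow> op_le B A" for A
      using that by (intro op_le_Phi_limit[OF U u bd lim]) (auto simp: pos_part_def)
  qed simp
  then show ?thesis by (simp add: image_image)
qed

definition nu :: "real measure" where
  "nu = measure_of UNIV (sets borel) (\<lambda>S. \<tau> (E S))"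

lemma sets_nu [measurable_cong]: "sets nu = sets borel"
  using sets.sigma_sets_eq[of "borel :: real measure"] by (simp add: nu_def)

lemma space_nu [simp]: "space nu = UNIV"
  by (simp add: nu_def)

lemma trace_E_empty: "\<tau> (E {}) = 0"
proof -
  have "(indicator {} :: real \<Rightarrow> real) = (\<lambda>t. 0 * 1)" by auto
  then show ?thesis using trace_Phi_cmult[of "\<lambda>_. 1" 0] by (simp add: E_def)
qed

text \<open>The prescribed values survive \<open>measure_of\<close> because they are countably
  additive: finite additivity is that of the trace, the passage to the limit is normality.\<close>

lemma emeasure_nu:
  assumes "S \<in> sets borel"
  shows "emeasure nu S = \<tau> (E S)"
proof -
  have "countably_additive (sets borel) (\<lambda>S. \<tau> (E S))"
  proof (rule countably_additiveI)
    fix F :: "nat \<Rightarrow> real set" assume F: "range F \<subseteq> sets borel" "disjoint_family F"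
    then have [measurable]: "F n \<in> sets borel" for n by auto
    have fin: "\<tau> (E (\<Union>k<n. F k)) = (\<Sum>k<n. \<tau> (E (F k)))" for n
    proof (induction n)
      case 0 show ?case by (simp add: trace_E_empty)
    next
      case (Suc n)
      have "F k \<inter> F n = {}" if "k < n" for k
        using F that disjoint_family_onD[of F UNIV k n] by simp
      then have "(indicator (\<Union>k<Suc n. F k) :: real \<Rightarrow> real) = (\<lambda>t. indicator (\<Union>k<n. F k) t + indicator (F n) t)"
        by (auto simp: indicator_def fun_eq_iff less_Suc_eq)
      then show ?case
        using trace_Phi_add[of "indicator (\<Union>k<n. F k)" "indicator (F n)"] Suc by (simp add: E_def)
    qed
    have "\<tau> (E (\<Union>k. F k)) = (SUP n. \<tau> (Phi (indicator (\<Union>k<n. F k))))"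
    proof -
      have "\<tau> (Phi (indicator (\<Union>k. F k))) = (SUP n. \<tau> (Phi (indicator (\<Union>k<n. F k))))"
      proof (rule trace_Phi_SUP)
        show "(\<lambda>n. indicator (\<Union>k<n. F k) t :: real) \<longlonglongrightarrow> indicator (\<Union>k. F k) t" for t
          by (rule LIMSEQ_indicator_UN)
        show "incseq (\<lambda>n. indicator (\<Union>k<n. F k) :: real \<Rightarrow> real)"
          by (auto simp: incseq_def le_fun_def indicator_def)
      qed auto
      then show ?thesis by (simp add: E_def)
    qed
    also have "\<dots> = (SUP n. \<Sum>k<n. \<tau> (E (F k)))" 
    proof -
      have "\<tau> (Phi (indicator (\<Union>k<n. F k))) = (\<Sum>k<n. \<tau> (E (F k)))" for n
        using fin[of n] by (simp add: E_def)
      then show ?thesis by presburger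
    qed
    finally show "(\<Sum>n. \<tau> (E (F n))) = \<tau> (E (\<Union>k. F k))"
      by (simp add: suminf_eq_SUP)
  qed
  then show ?thesis
    using assms sets.sigma_sets_eq[of "borel :: real measure"]
    by (intro emeasure_measure_of[OF nu_def]) (auto simp: positive_def trace_E_empty sets_nu)
qed

theorem trace_Phi:
  assumes f: "bounded_borel f" and nonneg: "\<And>t. 0 \<le> f t"
  shows "\<tau> (Phi f) = (\<integral>\<^sup>+t. ennreal (f t) \<partial>nu)"
proof -
  have "f \<in> borel_measurable borel" using f by (simp add: bounded_borel_def)
  \<comment> \<open>An implication, as in \<open>moments_determine\<close>: the induction passes
    through functions that are not known to be bounded.\<close>
  then have "bounded_borel f \<longrightarrow> \<tau> (Phi f) = (\<integral>\<^sup>+t. ennreal (f t) \<partial>nu)"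
    using nonneg
  proof (induction rule: borel_measurable_induct_real)
    case (set A)
    then show ?case using emeasure_nu[of A] by (simp add: E_def ennreal_indicator sets_nu)
  next
    case (mult u c)
    show ?case
    proof (cases "c = 0")
      case True
      then show ?thesis using trace_Phi_cmult[of "\<lambda>_. 1" 0] by simp
    next
      case False
      show ?thesis
      proof
        assume "bounded_borel (\<lambda>t. c * u t)"
        from bounded_borel_mult[OF bounded_borel_const[of "1 / c"] this]
        have "bounded_borel u" using False by simp
        then show "\<tau> (Phi (\<lambda>t. c * u t)) = (\<integral>\<^sup>+t. ennreal (c * u t) \<partial>nu)"
          using mult by (simp add: trace_Phi_cmult ennreal_mult nn_integral_cmult)
      qed
    qed
  next
    case (add u v)
    show ?case
    proof
      assume b: "bounded_borel (\<lambda>x. v x + u x)"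
      have "bounded_borel u" "bounded_borel v"
        by (rule bounded_borel_mono[OF b]; use add in simp)+
      then show "\<tau> (Phi (\<lambda>x. v x + u x)) = (\<integral>\<^sup>+x. ennreal (v x + u x) \<partial>nu)"
        using add by (simp add: trace_Phi_add nn_integral_add)
    qed
  next
    case (seq U)
    show ?case
    proof
      assume b: "bounded_borel f"
      have U_le: "U i x \<le> f x" for i x
        using seq by (intro incseq_le[of "\<lambda>i. U i x"]) (auto simp: incseq_def le_fun_def)
      have bU: "bounded_borel (U i)" for i
        by (rule bounded_borel_mono[OF b]) (use seq U_le in simp_all)
      have "\<tau> (Phi f) = (SUP n. \<tau> (Phi (U n)))"
        using seq by (intro trace_Phi_SUP bU b) auto
      also have "\<dots> = (SUP n. \<integral>\<^sup>+x. ennreal (U n x) \<partial>nu)" using seq bU by simp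
      also have "\<dots> = (\<integral>\<^sup>+x. (SUP n. ennreal (U n x)) \<partial>nu)"
        using seq by (intro nn_integral_monotone_convergence_SUP[symmetric])
          (auto simp: incseq_def le_fun_def intro!: ennreal_leI)
      also have "\<dots> = (\<integral>\<^sup>+x. ennreal (f x) \<partial>nu)"
      proof (rule nn_integral_cong)
        fix x
        have "incseq (\<lambda>n. ennreal (U n x))" using seq by (auto simp: incseq_def le_fun_def intro!: ennreal_leI)
        moreover have "(\<lambda>n. ennreal (U n x)) \<longlonglongrightarrow> ennreal (f x)" using seq by (intro tendsto_ennrealI) auto
        ultimately show "(SUP n. ennreal (U n x)) = ennreal (f x)"
          using LIMSEQ_SUP LIMSEQ_unique by blast
      qed
      finally show "\<tau> (Phi f) = (\<integral>\<^sup>+x. ennreal (f x) \<partial>nu)" .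
    qed
  qed
  then show ?thesis using f by simp
qed

lemma nu_outside: "emeasure nu (- {0..1}) = 0"
proof -
  have "Phi (indicator {}) = Phi (indicator (- {0..1}))"
    by (rule Phi_cong) (auto simp: indicator_def)
  then show ?thesis using trace_E_empty by (simp add: emeasure_nu E_def)
qed

lemma sing_val_eq: "sing_val \<tau> T t = Inf {s. 0 \<le> s \<and> emeasure nu {s<..} \<le> ennreal t}"
  by (simp add: sing_val_def abs_op_eq spectral_measure_eq emeasure_nu)

lemma trace_op_powr:
  assumes "p \<ge> 0"
  shows "\<tau> (op_powr T p) = (\<integral>\<^sup>+t. ennreal (t powr p) \<partial>nu)"
proof -
  have b: "bounded_borel (\<lambda>t. t powr p)"
    by (rule bounded_borelI[of _ 1]) (use assms in \<open>auto intro!: powr_le1\<close>)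
  show ?thesis unfolding op_powr_def fun_calc_eq[OF b] by (rule trace_Phi[OF b]) simp
qed

end

section \<open>Decreasing rearrangements\<close>

locale unit_spectral_distribution =
  fixes \<nu> :: "real measure"
  assumes sets_nu [measurable_cong]: "sets \<nu> = sets borel"
    and outside: "emeasure \<nu> (- {0..1}) = 0"
begin

lemma space_nu [simp]: "space \<nu> = UNIV"
  using sets_eq_imp_space_eq[OF sets_nu] by simp

lemma AE_unit: "AE x in \<nu>. x \<in> {0..1}"
  by (rule AE_I[of _ _ "- {0..1}"]) (auto simp: outside sets_nu)

text \<open>The values are extended, since infinitely much mass may accumulate at 0.\<close>

definition D :: "real \<Rightarrow> ennreal" where "D x = emeasure \<nu> {x<..}"

lemma D_antimono: "x \<le> y \<Longrightarrow> D y \<le> D x"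
  unfolding D_def by (intro emeasure_mono) (auto simp: sets_nu)

lemma D_one: "D 1 = 0"
proof -
  have "emeasure \<nu> {1<..} \<le> emeasure \<nu> (- {0..1})" by (intro emeasure_mono) (auto simp: sets_nu)
  then show ?thesis by (simp add: outside D_def)
qed

text \<open>Right continuity of the distribution function, a consequence of continuity of measures
  from below, in the form in which it is used: a strict inequality persists a little to the
  right.\<close>

lemma D_right_cont:
  assumes "y < D x"
  obtains z where "x < z" "y < D z"
proof -
  have "{x<..} = (\<Union>n. {x + 1 / real (Suc n)<..})"
  proof (intro equalityI subsetI)
    fix z assume "z \<in> {x<..}"
    then obtain n where "1 / real (Suc n) < z - x" using nat_approx_posE[of "z - x"] by auto
    then show "z \<in> (\<Union>n. {x + 1 / real (Suc n)<..})" by (auto intro!: exI[of _ n])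
  qed (auto intro: less_trans[of x "x + 1 / real (Suc n)" for n])
  moreover have "incseq (\<lambda>n. {x + 1 / real (Suc n)<..})"
  proof (rule incseq_SucI)
    fix n
    have "1 / real (Suc (Suc n)) \<le> 1 / real (Suc n)" by (intro divide_left_mono) auto
    then show "{x + 1 / real (Suc n)<..} \<subseteq> {x + 1 / real (Suc (Suc n))<..}" by auto
  qed
  ultimately have "D x = (SUP n. D (x + 1 / real (Suc n)))"
    unfolding D_def by (subst SUP_emeasure_incseq) (auto simp: sets_nu)
  then obtain n where "y < D (x + 1 / real (Suc n))" using assms by (auto simp: less_SUP_iff)
  then show ?thesis using that[of "x + 1 / real (Suc n)"] by simp
qed

definition mu :: "real \<Rightarrow> real" where "mu t = Inf {s. 0 \<le> s \<and> D s \<le> ennreal t}"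

lemma mu_bdd: "bdd_below {s. 0 \<le> s \<and> D s \<le> ennreal t}"
  by (rule bdd_belowI[of _ 0]) auto

lemma mu_mem_one: "1 \<in> {s. 0 \<le> s \<and> D s \<le> ennreal t}"
  by (simp add: D_one)

lemma mu_nonempty: "{s. 0 \<le> s \<and> D s \<le> ennreal t} \<noteq> {}"
  using mu_mem_one by blast

lemma mu_nonneg: "0 \<le> mu t"
  unfolding mu_def by (rule cInf_greatest[OF mu_nonempty]) simp

lemma mu_le_one: "mu t \<le> 1"
  unfolding mu_def by (rule cInf_lower[OF mu_mem_one mu_bdd])

lemma mu_antimono: "s \<le> t \<Longrightarrow> mu t \<le> mu s"
  unfolding mu_def
  by (rule cInf_superset_mono[OF mu_nonempty mu_bdd]) (auto intro: order_trans ennreal_leI)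

text \<open>\<open>mu\<close> and \<open>D\<close> are generalized inverses of each other; right
  continuity of \<open>D\<close> is what makes the inequality for \<open>mu\<close> strict.\<close>

lemma mu_greater_iff:
  assumes "0 \<le> x"
  shows "x < mu t \<longleftrightarrow> ennreal t < D x"
proof
  assume "x < mu t"
  show "ennreal t < D x"
  proof (rule ccontr)
    assume "\<not> ennreal t < D x"
    then have "mu t \<le> x" unfolding mu_def using assms by (intro cInf_lower mu_bdd) auto
    then show False using \<open>x < mu t\<close> by simp
  qed
next
  assume "ennreal t < D x"
  then obtain y where y: "x < y" "ennreal t < D y" by (rule D_right_cont)
  have "y \<le> mu t"
    unfolding mu_def
  proof (rule cInf_greatest)
    show "{s. 0 \<le> s \<and> D s \<le> ennreal t} \<noteq> {}" by (rule mu_nonempty)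
    fix s assume "s \<in> {s. 0 \<le> s \<and> D s \<le> ennreal t}"
    then have "D s < D y" using y by auto
    then show "y \<le> s" using D_antimono[of s y] by (meson leD linear)
  qed
  then show "x < mu t" using y by simp
qed

lemma mu_measurable [measurable]: "mu \<in> borel_measurable borel"
proof -
  have "mono (\<lambda>t. - mu t)" using mu_antimono by (auto simp: mono_def)
  then have "(\<lambda>t. - mu t) \<in> borel_measurable borel" by (rule borel_measurable_mono)
  then have "(\<lambda>t. - (- mu t)) \<in> borel_measurable borel" by measurable
  then show ?thesis by simp
qed

lemma D_measurable [measurable]: "D \<in> borel_measurable borel"
proof (rule borel_measurableI_greater)
  fix y
  have "{x. y < D x} = (\<Union>z\<in>{z. y < D z}. {..<z})"
  proof (intro equalityI subsetI)
    fix x assume "x \<in> {x. y < D x}"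
    then obtain z where "x < z" "y < D z" using D_right_cont[of y x] by auto
    then show "x \<in> (\<Union>z\<in>{z. y < D z}. {..<z})" by blast
  next
    fix x assume "x \<in> (\<Union>z\<in>{z. y < D z}. {..<z})"
    then obtain z where "x < z" "y < D z" by blast
    then show "x \<in> {x. y < D x}" using D_antimono[of x z] by simp
  qed
  moreover have "open (\<Union>z\<in>{z. y < D z}. {..<z})" by (intro open_UN ballI open_lessThan)
  ultimately have "open {x. y < D x}" by metis
  then show "{x \<in> space borel. y < D x} \<in> sets borel" by simp
qed

definition Mt :: "real \<Rightarrow> real" where "Mt t = integral {0..t} mu"

lemma Mt_nn_integral: "ennreal (Mt t) = (\<integral>\<^sup>+s. ennreal (indicator {0..t} s * mu s) \<partial>lborel)"
proof -
  have int: "set_integrable lborel {0..t} mu"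
    unfolding set_integrable_def
  proof (rule integrableI_bounded_set[where A = "{0..t}" and B = 1])
    show "emeasure lborel {0..t} < \<infinity>" by (simp add: emeasure_lborel_Icc_eq)
    show "AE x\<in>{0..t} in lborel. norm (indicat_real {0..t} x *\<^sub>R mu x) \<le> 1"
      using mu_nonneg mu_le_one by (auto simp: indicator_def)
  qed auto
  have "(\<integral>\<^sup>+s. ennreal (indicator {0..t} s * mu s) \<partial>lborel) = ennreal (\<integral>s. indicator {0..t} s * mu s \<partial>lborel)"
    using int mu_nonneg by (intro nn_integral_eq_integral) (auto simp: set_integrable_def)
  also have "(\<integral>s. indicator {0..t} s * mu s \<partial>lborel) = Mt t"
    using set_borel_integral_eq_integral(2)[OF int] by (simp add: set_lebesgue_integral_def Mt_def)
  finally show ?thesis ..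
qed


lemma mu_integrable_on: "mu integrable_on {a..b}"
proof -
  have "(\<lambda>t. - mu t) integrable_on {a..b}"
    by (rule integrable_on_mono_on) (auto simp: mono_on_def mu_antimono)
  then show ?thesis using integrable_neg by fastforce
qed

lemma Mt_nonneg: "0 \<le> Mt t"
  unfolding Mt_def by (rule integral_nonneg[OF mu_integrable_on mu_nonneg])

lemma Mt_mono: "mono Mt"
proof
  fix s t :: real assume "s \<le> t"
  then show "Mt s \<le> Mt t"
    unfolding Mt_def by (intro integral_subset_le mu_integrable_on) (auto simp: mu_nonneg)
qed

lemma emeasure_ennreal_less:
  assumes "0 \<le> t"
  shows "emeasure lborel {s. 0 \<le> s \<and> s \<le> t \<and> ennreal s < d} = min (ennreal t) d"
proof (cases d)
  case top
  then have "{s. 0 \<le> s \<and> s \<le> t \<and> ennreal s < d} = {0..t}" by auto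
  then show ?thesis using assms top by simp
next
  case (real r)
  show ?thesis
  proof (cases "r \<le> t")
    case True
    then have "{s. 0 \<le> s \<and> s \<le> t \<and> ennreal s < d} = {0..<r}"
      using real by (auto simp: ennreal_less_iff)
    then show ?thesis using True real by (simp add: min_def ennreal_le_iff2)
  next
    case False
    then have "{s. 0 \<le> s \<and> s \<le> t \<and> ennreal s < d} = {0..t}"
      using real by (auto simp: ennreal_less_iff)
    then show ?thesis using False real assms by (simp add: min_def ennreal_le_iff)
  qed
qed

text \<open>Write \<open>mu s\<close> as the length of [0, mu s) and exchange the integrals. For
  fixed x the condition x < mu s means s < D x, so the inner integral becomes the length of [0,t]
  cut at D x.\<close>

theorem Mt_layer_cake:
  assumes "0 \<le> t"
  shows "ennreal (Mt t) = (\<integral>\<^sup>+x. indicator {0..} x * min (ennreal t) (D x) \<partial>lborel)"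
proof -
  have len: "(\<integral>\<^sup>+x. indicator {x. 0 \<le> x \<and> x < m} x \<partial>lborel) = ennreal m" if "0 \<le> m" for m :: real
  proof -
    have "{x. 0 \<le> x \<and> x < m} = {0..<m}" by auto
    then show ?thesis using that by simp
  qed
  have "ennreal (Mt t) = (\<integral>\<^sup>+s. indicator {0..t} s * (\<integral>\<^sup>+x. indicator {x. 0 \<le> x \<and> x < mu s} x \<partial>lborel) \<partial>lborel)"
    unfolding Mt_nn_integral
    by (intro nn_integral_cong) (simp only: len[OF mu_nonneg], auto simp: indicator_def)
  also have "\<dots> = (\<integral>\<^sup>+s. (\<integral>\<^sup>+x. indicator {0..t} s * (indicator {0..} x * indicator {z. fst z < mu (snd z)} (x, s)) \<partial>lborel) \<partial>lborel)"
    by (subst nn_integral_cmult[symmetric]) (auto simp: indicator_def intro!: nn_integral_cong)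
  also have "\<dots> = (\<integral>\<^sup>+x. (\<integral>\<^sup>+s. indicator {0..t} s * (indicator {0..} x * indicator {z. fst z < mu (snd z)} (x, s)) \<partial>lborel) \<partial>lborel)"
    by (rule lborel_pair.Fubini') measurable
  also have "\<dots> = (\<integral>\<^sup>+x. indicator {0..} x * min (ennreal t) (D x) \<partial>lborel)"
  proof (rule nn_integral_cong)
    fix x :: real
    show "(\<integral>\<^sup>+s. indicator {0..t} s * (indicator {0..} x * indicator {z. fst z < mu (snd z)} (x, s)) \<partial>lborel)
      = indicator {0..} x * min (ennreal t) (D x)"
    proof (cases "0 \<le> x")
      case True
      have "(\<integral>\<^sup>+s. indicator {0..t} s * (indicator {0..} x * indicator {z. fst z < mu (snd z)} (x, s)) \<partial>lborel)
        = (\<integral>\<^sup>+s. indicator {s. 0 \<le> s \<and> s \<le> t \<and> ennreal s < D x} s \<partial>lborel)"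
        using True by (intro nn_integral_cong) (auto simp: indicator_def mu_greater_iff)
      also have "\<dots> = min (ennreal t) (D x)"
        by (subst nn_integral_indicator) (auto simp: emeasure_ennreal_less[OF assms])
      finally show ?thesis using True by simp
    qed simp
  qed
  finally show ?thesis .
qed

text \<open>With \<open>c = 1 / t\<close> this is the function A(t) introduced at the
  beginning.\<close>

definition At :: "real \<Rightarrow> ennreal" where
  "At c = (\<integral>\<^sup>+l. ennreal l * indicator {c<..} l \<partial>\<nu>)"

lemma At_antimono: "c \<le> c' \<Longrightarrow> At c' \<le> At c"
  unfolding At_def by (intro nn_integral_mono) (auto simp: indicator_def)

text \<open>The same exchange of integrals, now against the measure itself. Tonelli's theorem wants
  a sigma-finite measure; restricted to \<open>{c<..}\<close> it is finite, while the whole measure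
  may be infinite near 0.\<close>

theorem At_layer_cake:
  assumes "0 \<le> c" "D c < \<infinity>"
  shows "At c = (\<integral>\<^sup>+x. indicator {0..} x * D (max c x) \<partial>lborel)"
proof -
  define \<nu>' where "\<nu>' = density \<nu> (indicator {c<..})"
  have sets'[measurable_cong]: "sets \<nu>' = sets borel" by (simp add: \<nu>'_def sets_nu)
  have em: "emeasure \<nu>' S = emeasure \<nu> (S \<inter> {c<..})" if "S \<in> sets borel" for S
  proof -
    have "emeasure \<nu>' S = (\<integral>\<^sup>+l. indicator {c<..} l * indicator S l \<partial>\<nu>)"
      unfolding \<nu>'_def using that by (subst emeasure_density) (auto simp: sets_nu)
    also have "\<dots> = (\<integral>\<^sup>+l. indicator (S \<inter> {c<..}) l \<partial>\<nu>)"
      by (intro nn_integral_cong) (auto simp: indicator_def)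
    also have "\<dots> = emeasure \<nu> (S \<inter> {c<..})"
      using that by (subst nn_integral_indicator) (auto simp: sets_nu)
    finally show ?thesis .
  qed
  have "finite_measure \<nu>'"
    using em[of UNIV] assms sets_eq_imp_space_eq[OF sets'] by (intro finite_measureI) (auto simp: D_def)
  then interpret \<nu>': finite_measure \<nu>' .
  interpret pair_sigma_finite \<nu>' lborel ..
  have len: "(\<integral>\<^sup>+x. indicator {x. 0 \<le> x \<and> x < m} x \<partial>lborel) = ennreal m" for m :: real
  proof (cases "0 \<le> m")
    case True
    have "{x. 0 \<le> x \<and> x < m} = {0..<m}" by auto
    then show ?thesis using True by simp
  next
    case False
    then have "{x. 0 \<le> x \<and> x < m} = {}" by auto
    then show ?thesis using False by (simp add: ennreal_neg)
  qed
  have "At c = (\<integral>\<^sup>+l. ennreal l \<partial>\<nu>')"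
    unfolding At_def \<nu>'_def by (subst nn_integral_density) (auto simp: mult.commute)
  also have "\<dots> = (\<integral>\<^sup>+l. (\<integral>\<^sup>+x. indicator {0..} x * indicator {z. snd z < fst z} (l, x) \<partial>lborel) \<partial>\<nu>')"
    unfolding len[symmetric] by (intro nn_integral_cong) (auto simp: indicator_def)
  also have "\<dots> = (\<integral>\<^sup>+x. (\<integral>\<^sup>+l. indicator {0..} x * indicator {z. snd z < fst z} (l, x) \<partial>\<nu>') \<partial>lborel)"
    by (rule Fubini'[symmetric]) measurable
  also have "\<dots> = (\<integral>\<^sup>+x. indicator {0..} x * D (max c x) \<partial>lborel)"
  proof (rule nn_integral_cong)
    fix x :: real
    have "(\<integral>\<^sup>+l. indicator {0..} x * indicator {z. snd z < fst z} (l, x) \<partial>\<nu>')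
      = indicator {0..} x * (\<integral>\<^sup>+l. indicator {x<..} l \<partial>\<nu>')"
      by (subst nn_integral_cmult[symmetric]) (auto simp: indicator_def intro!: nn_integral_cong)
    also have "(\<integral>\<^sup>+l. indicator {x<..} l \<partial>\<nu>') = emeasure \<nu> ({x<..} \<inter> {c<..})"
      by (simp add: em sets')
    also have "{x<..} \<inter> {c<..} = {max c x<..}" by auto
    finally show "(\<integral>\<^sup>+l. indicator {0..} x * indicator {z. snd z < fst z} (l, x) \<partial>\<nu>')
      = indicator {0..} x * D (max c x)" by (simp add: D_def)
  qed
  finally show ?thesis .
qed

text \<open>The layer min(t, D x) is at most t for x below c and at most D x from c on. For c = 1/t
  the first contribution is 1.\<close>

lemma Mt_le_At:
  assumes "0 \<le> t" "0 \<le> c" "D c < \<infinity>"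
  shows "ennreal (Mt t) \<le> ennreal (t * c) + At c"
proof -
  have "ennreal (Mt t) \<le> (\<integral>\<^sup>+x. ennreal t * indicator {0..<c} x + indicator {0..} x * D (max c x) \<partial>lborel)"
    unfolding Mt_layer_cake[OF assms(1)]
    by (intro nn_integral_mono) (auto simp: indicator_def max_def min.coboundedI2 intro: min.coboundedI1)
  also have "\<dots> = ennreal (t * c) + At c"
    unfolding At_layer_cake[OF assms(2,3)] using assms
    by (subst nn_integral_add) (auto simp: nn_integral_cmult ennreal_mult)
  finally show ?thesis .
qed

text \<open>When D c is at most s, each layer D (max c x) is at most both s and D x.\<close>

lemma At_le_Mt:
  assumes "0 \<le> s" "0 \<le> c" "D c \<le> ennreal s"
  shows "At c \<le> ennreal (Mt s)"
proof -
  have fin: "D c < \<infinity>" using assms(3) by (auto simp: less_top[symmetric] top_unique)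
  show ?thesis
    unfolding Mt_layer_cake[OF assms(1)] At_layer_cake[OF assms(2) fin]
    by (intro nn_integral_mono mult_left_mono min.boundedI)
      (auto intro: order_trans[OF D_antimono assms(3)] D_antimono)
qed

text \<open>A Chebyshev estimate: each layer with x < c has D x at least n.\<close>

lemma Mt_ge_of_D:
  assumes "0 \<le> c" "0 \<le> n" "ennreal n \<le> D c"
  shows "n * c \<le> Mt n"
proof -
  have "ennreal (n * c) = (\<integral>\<^sup>+x. ennreal n * indicator {0..<c} x \<partial>lborel)"
    using assms by (simp add: nn_integral_cmult ennreal_mult)
  also have "\<dots> \<le> ennreal (Mt n)"
    unfolding Mt_layer_cake[OF assms(2)]
    using assms(3) D_antimono[of _ c]
    by (intro nn_integral_mono) (auto simp: indicator_def intro: order_trans less_imp_le)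
  finally show ?thesis by (simp add: Mt_nonneg)
qed

end

section \<open>Growth bounds\<close>

lemma ln_one_plus_le_two_sqrt:
  assumes "0 \<le> (n::real)"
  shows "ln (1 + n) \<le> 2 * sqrt n"
proof -
  have "1 + n \<le> (1 + sqrt n)\<^sup>2" using assms by (simp add: power2_sum)
  then have "ln (1 + n) \<le> ln ((1 + sqrt n)\<^sup>2)" using assms by (subst ln_le_cancel_iff) auto
  also have "\<dots> = 2 * ln (1 + sqrt n)" using assms by (simp add: ln_realpow add_pos_nonneg)
  also have "\<dots> \<le> 2 * sqrt n" using assms by (simp add: ln_add_one_self_le_self)
  finally show ?thesis .
qed

locale dixmier_distribution = unit_spectral_distribution +
  fixes C :: real
  assumes C_pos: "0 < C" and Mt_psi: "\<And>t. 0 < t \<Longrightarrow> Mt t \<le> C * psi1 t"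
begin

lemma Mt_le_ln: "1 \<le> t \<Longrightarrow> Mt t \<le> C * ln (1 + t)"
  using Mt_psi[of t] by (cases "t = 1") (auto simp: psi1_def)

text \<open>A crude first bound, which also yields finiteness. A number n below D c satisfies n c <=
  C ln (1 + n) <= 2 C sqrt n, hence n <= 4 C^2 / c^2. The summand 1 makes n at least 1 and
  contradicts this inequality.\<close>

lemma D_bound:
  assumes "0 < c"
  shows "D c \<le> ennreal (1 + 4 * C\<^sup>2 / c\<^sup>2)"
proof (rule ccontr)
  define n where "n = 1 + 4 * C\<^sup>2 / c\<^sup>2"
  have n1: "1 \<le> n" by (simp add: n_def)
  assume "\<not> D c \<le> ennreal (1 + 4 * C\<^sup>2 / c\<^sup>2)"
  then have "ennreal n \<le> D c" by (simp add: n_def)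
  then have "n * c \<le> Mt n" using assms n1 by (intro Mt_ge_of_D) auto
  also have "\<dots> \<le> C * ln (1 + n)" by (rule Mt_le_ln[OF n1])
  also have "\<dots> \<le> C * (2 * sqrt n)"
    using C_pos n1 by (intro mult_left_mono ln_one_plus_le_two_sqrt) auto
  finally have "sqrt n * (sqrt n * c) \<le> sqrt n * (2 * C)"
    using n1 by (simp add: mult.assoc[symmetric])  (simp add: mult_ac)
  then have "sqrt n * c \<le> 2 * C" using n1 by simp
  then have "(sqrt n * c)\<^sup>2 \<le> (2 * C)\<^sup>2" using assms n1 by (intro power_mono) auto
  then have "n * c\<^sup>2 \<le> 4 * C\<^sup>2" using n1 by (simp add: power_mult_distrib)
  then have "n \<le> 4 * C\<^sup>2 / c\<^sup>2" using assms by (simp add: field_simps)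
  then show False by (simp add: n_def)
qed

lemma D_finite: "0 < c \<Longrightarrow> D c < \<infinity>"
  using D_bound[of c] by (auto simp: less_top[symmetric] top_unique)

text \<open>Bootstrapping: the crude bound is inserted only inside the logarithm, so D c is O((1/c)
  log (1/c)) for small c.\<close>

lemma D_sharp:
  assumes c: "0 < c"
  shows "D c \<le> ennreal (max 1 (C / c * ln (2 + 4 * C\<^sup>2 / c\<^sup>2)))"
proof -
  define n where "n = enn2real (D c)"
  have Dn: "D c = ennreal n" using D_finite[OF c] by (simp add: n_def)
  have "n \<le> max 1 (C / c * ln (2 + 4 * C\<^sup>2 / c\<^sup>2))"
  proof (cases "1 \<le> n")
    case True
    have n_le: "n \<le> 1 + 4 * C\<^sup>2 / c\<^sup>2" using D_bound[OF c] unfolding Dn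
      by (subst (asm) ennreal_le_iff) (auto intro: add_nonneg_nonneg)
    have "n * c \<le> Mt n" using c True by (intro Mt_ge_of_D) (auto simp: Dn)
    also have "\<dots> \<le> C * ln (1 + n)" by (rule Mt_le_ln[OF True])
    also have "\<dots> \<le> C * ln (2 + 4 * C\<^sup>2 / c\<^sup>2)"
      using C_pos True n_le by (intro mult_left_mono) (subst ln_le_cancel_iff, auto intro: add_pos_nonneg)
    finally have "n \<le> C / c * ln (2 + 4 * C\<^sup>2 / c\<^sup>2)" using c by (simp add: field_simps)
    then show ?thesis by simp
  qed simp
  then show ?thesis by (simp add: Dn ennreal_leI)
qed

lemma D_eventually_le_powr:
  assumes "\<alpha> > 1"
  shows "\<forall>\<^sub>F u in at_top. D (1 / u) \<le> ennreal (u powr \<alpha>)"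
proof -
  have "\<forall>\<^sub>F u in at_top. C * u * ln (2 + 4 * C\<^sup>2 * u\<^sup>2) \<le> u powr \<alpha>"
    using C_pos assms by real_asymp
  moreover have "\<forall>\<^sub>F u in at_top. 1 \<le> u powr \<alpha>" using assms by real_asymp
  moreover have "\<forall>\<^sub>F u::real in at_top. 0 < u" by (rule eventually_gt_at_top)
  ultimately show ?thesis
  proof eventually_elim
    case (elim u)
    then have "max 1 (C / (1 / u) * ln (2 + 4 * C\<^sup>2 / (1 / u)\<^sup>2)) \<le> u powr \<alpha>"
      by (simp add: power_divide)
    then show ?case using D_sharp[of "1 / u"] elim by (meson ennreal_leI order_trans zero_less_divide_1_iff)
  qed
qed

text \<open>Collects the constants of the next bound: At (e^-r) <= Mt s for s = 1 + 4 C^2 e^(2r),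
  and ln (1 + s) <= ln (2 + 4 C^2) + 2 r. The crude bound on \<open>D\<close> suffices there, since
  s enters through its logarithm.\<close>

definition At_const :: real where "At_const = C * (ln (2 + 4 * C\<^sup>2) + 2)"

lemma At_const_pos: "0 < At_const"
  unfolding At_const_def using C_pos by (intro mult_pos_pos add_nonneg_pos ln_ge_zero) auto

lemma At_bound:
  assumes "0 \<le> r"
  shows "At (exp (- r)) \<le> ennreal (At_const * (1 + r))"
proof -
  define s where "s = 1 + 4 * C\<^sup>2 / (exp (- r))\<^sup>2"
  have s1: "1 \<le> s" by (simp add: s_def)
  have "At (exp (- r)) \<le> ennreal (Mt s)"
    using s1 D_bound[of "exp (- r)"] unfolding s_def by (intro At_le_Mt) auto
  also have "\<dots> \<le> ennreal (At_const * (1 + r))"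
  proof (rule ennreal_leI)
    have e: "1 / (exp (- r))\<^sup>2 = exp (2 * r)"
      unfolding exp_double exp_minus by (simp add: power_inverse divide_inverse)
    have "1 + s = 2 + 4 * C\<^sup>2 * exp (2 * r)"
      unfolding s_def e[symmetric] by simp
    also have "\<dots> \<le> (2 + 4 * C\<^sup>2) * exp (2 * r)"
      using assms by (simp add: distrib_right)
    finally have le: "1 + s \<le> (2 + 4 * C\<^sup>2) * exp (2 * r)" .
    have pos2: "0 < 2 + 4 * C\<^sup>2" by (simp add: add_pos_nonneg)
    have "ln (1 + s) \<le> ln ((2 + 4 * C\<^sup>2) * exp (2 * r))"
      using le s1 pos2 by (subst ln_le_cancel_iff) auto
    also have "\<dots> = ln (2 + 4 * C\<^sup>2) + 2 * r"
      using pos2 by (subst ln_mult) auto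
    also have "\<dots> \<le> (ln (2 + 4 * C\<^sup>2) + 2) * (1 + r)"
    proof -
      have "0 \<le> ln (2 + 4 * C\<^sup>2)" by (intro ln_ge_zero) auto
      then show ?thesis using assms by (simp add: algebra_simps)
    qed
    finally have "ln (1 + s) \<le> (ln (2 + 4 * C\<^sup>2) + 2) * (1 + r)" .
    then have "C * ln (1 + s) \<le> At_const * (1 + r)"
      unfolding At_const_def mult.assoc using C_pos by (intro mult_left_mono) auto
    then show "Mt s \<le> At_const * (1 + r)" using Mt_le_ln[OF s1] by simp
  qed
  finally show ?thesis .
qed

definition Zt :: "real \<Rightarrow> ennreal" where
  "Zt q = (\<integral>\<^sup>+l. ennreal (l powr (1 + q)) \<partial>\<nu>)"

text \<open>The summand with \<open>k = \<lfloor>- q * ln l\<rfloor>\<close> alone suffices.\<close>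

lemma powr_le_layers:
  assumes "0 < q" "0 < l" "l \<le> 1"
  shows "ennreal (l powr (1 + q)) \<le> (\<Sum>k. ennreal (exp (- real k)) * (ennreal l * indicator {exp (- ((real k + 1) / q))<..} l))"
proof -
  define u where "u = - ln l"
  have u: "0 \<le> u" using assms by (simp add: u_def)
  define k where "k = nat \<lfloor>u * q\<rfloor>"
  have k: "real k \<le> u * q" "u * q < real k + 1"
    using u assms unfolding k_def by (auto simp: of_nat_nat)
  have "u < (real k + 1) / q" using k(2) assms by (simp add: field_simps)
  then have "exp (- ((real k + 1) / q)) < exp (- u)" by simp
  then have l_gt: "exp (- ((real k + 1) / q)) < l" using assms by (simp add: u_def)
  have "l powr (1 + q) = l * exp (- (u * q))"
    using assms by (simp add: powr_add u_def) (simp add: powr_def mult.commute)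
  also have "\<dots> \<le> exp (- real k) * l"
    using k(1) assms by (simp add: mult.commute)
  finally have "ennreal (l powr (1 + q)) \<le> ennreal (exp (- real k)) * (ennreal l * indicator {exp (- ((real k + 1) / q))<..} l)"
    using l_gt assms by (simp add: ennreal_mult'[symmetric] ennreal_leI)
  also have "\<dots> \<le> (\<Sum>k. ennreal (exp (- real k)) * (ennreal l * indicator {exp (- ((real k + 1) / q))<..} l))"
    using sum_le_suminf[of "\<lambda>k. ennreal (exp (- real k)) * (ennreal l * indicator {exp (- ((real k + 1) / q))<..} l)" "{k}"]
    by simp
  finally show ?thesis .
qed

text \<open>From a geometric series: layer k contributes at most e^-k At_const (1 + (k+1)/q), which
  is at most (4 At_const / q) e^(-k/2).\<close>

definition Zt_const :: real where "Zt_const = 4 * At_const / (1 - exp (- 1 / 2))"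

lemma Zt_const_pos: "0 < Zt_const"
  unfolding Zt_const_def using At_const_pos by (intro divide_pos_pos) auto

theorem Zt_bound:
  assumes q: "0 < q" "q \<le> 1"
  shows "Zt q \<le> ennreal (Zt_const / q)"
proof -
  have "Zt q \<le> (\<integral>\<^sup>+l. (\<Sum>k. ennreal (exp (- real k)) * (ennreal l * indicator {exp (- ((real k + 1) / q))<..} l)) \<partial>\<nu>)"
    unfolding Zt_def
  proof (rule nn_integral_mono_AE)
    show "AE l in \<nu>. ennreal (l powr (1 + q)) \<le> (\<Sum>k. ennreal (exp (- real k)) * (ennreal l * indicator {exp (- ((real k + 1) / q))<..} l))"
      using AE_unit
    proof eventually_elim
      case (elim l)
      then show ?case using powr_le_layers[OF q(1), of l] by (cases "l = 0") auto
    qed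
  qed
  also have "\<dots> = (\<Sum>k. ennreal (exp (- real k)) * At (exp (- ((real k + 1) / q))))"
    unfolding At_def by (simp add: nn_integral_suminf nn_integral_cmult)
  also have "\<dots> \<le> (\<Sum>k. ennreal (4 * At_const / q * exp (- 1 / 2) ^ k))"
  proof (intro suminf_le)
    fix k :: nat
    have "ennreal (exp (- real k)) * At (exp (- ((real k + 1) / q)))
      \<le> ennreal (exp (- real k)) * ennreal (At_const * (1 + (real k + 1) / q))"
      using q by (intro mult_left_mono At_bound) auto
    also have "\<dots> = ennreal (exp (- real k) * (At_const * (1 + (real k + 1) / q)))"
      by (simp add: ennreal_mult')
    also have "\<dots> \<le> ennreal (4 * At_const / q * exp (- 1 / 2) ^ k)"
    proof (rule ennreal_leI)
      \<comment> \<open>Here \<open>q \<le> 1\<close> lets 1 be absorbed into 1/q; half of the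
        exponential decay then pays for the linear factor.\<close>
      have "1 + (real k + 1) / q \<le> (real k + 2) / q" using q by (simp add: field_simps)
      also have "\<dots> \<le> 4 * exp (real k / 2) / q"
      proof -
        have "real k + 2 \<le> 4 * (1 + real k / 2)" by simp
        also have "\<dots> \<le> 4 * exp (real k / 2)" by (intro mult_left_mono exp_ge_add_one_self) simp
        finally show ?thesis using q by (intro divide_right_mono) auto
      qed
      finally have "exp (- real k) * (At_const * (1 + (real k + 1) / q)) \<le> exp (- real k) * (At_const * (4 * exp (real k / 2) / q))"
        using At_const_pos by (intro mult_left_mono) auto
      also have "\<dots> = 4 * At_const / q * (exp (- real k) * exp (real k / 2))" by simp
      also have "exp (- real k) * exp (real k / 2) = exp (- 1 / 2) ^ k"
        by (simp add: exp_add[symmetric] exp_of_nat_mult[symmetric])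
      finally show "exp (- real k) * (At_const * (1 + (real k + 1) / q)) \<le> 4 * At_const / q * exp (- 1 / 2) ^ k" .
    qed
    finally show "ennreal (exp (- real k)) * At (exp (- ((real k + 1) / q))) \<le> ennreal (4 * At_const / q * exp (- 1 / 2) ^ k)" .
  qed auto
  also have "\<dots> = ennreal (Zt_const / q)"
  proof (rule suminf_ennreal_eq)
    have "(\<lambda>k. exp (- 1 / 2 :: real) ^ k) sums (1 / (1 - exp (- 1 / 2)))" by (rule geometric_sums) simp
    from sums_mult[OF this, of "4 * At_const / q"]
    show "(\<lambda>k. 4 * At_const / q * exp (- 1 / 2) ^ k) sums (Zt_const / q)" by (simp add: Zt_const_def field_simps)
  qed (use At_const_pos q in simp)
  finally show ?thesis .
qed

lemma Zt_antimono: "q \<le> q' \<Longrightarrow> Zt q' \<le> Zt q"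
  unfolding Zt_def
proof (rule nn_integral_mono_AE)
  assume "q \<le> q'"
  show "AE l in \<nu>. ennreal (l powr (1 + q')) \<le> ennreal (l powr (1 + q))"
    using AE_unit
  proof eventually_elim
    case (elim l)
    then show ?case using \<open>q \<le> q'\<close> powr_mono'[of "1 + q" "1 + q'" l] by (intro ennreal_leI) auto
  qed
qed

lemma Zt_finite: 
  assumes "0 < q"
  shows "Zt q < \<infinity>"
proof -
  have "Zt q \<le> Zt (min q 1)" by (rule Zt_antimono) simp
  also have "\<dots> \<le> ennreal (Zt_const / min q 1)" using assms by (intro Zt_bound) auto
  finally show ?thesis by (auto simp: less_top[symmetric] top_unique)
qed

lemma integrable_powr: "0 < q \<Longrightarrow> integrable \<nu> (\<lambda>l. l powr (1 + q))"
  using Zt_finite[of q] by (intro integrableI_nonneg) (auto simp: Zt_def)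

lemma integral_powr: "0 < q \<Longrightarrow> enn2real (Zt q) = (\<integral>l. l powr (1 + q) \<partial>\<nu>)"
  unfolding Zt_def by (subst nn_integral_eq_integral[OF integrable_powr]) (auto simp: integral_nonneg_AE)

end

section \<open>Karamata's theorem for generalized limits\<close>

lemma integral_polynomial_unit:
  fixes a :: "nat \<Rightarrow> real"
  shows "((\<lambda>x. \<Sum>i\<le>n. a i * x ^ i) has_integral (\<Sum>i\<le>n. a i / real (Suc i))) {0..1}"
proof (rule has_integral_sum)
  fix i assume "i \<in> {..n}"
  have "((\<lambda>x. a i * x ^ i) has_integral (a i / real (Suc i) * 1 ^ Suc i - a i / real (Suc i) * 0 ^ Suc i)) {0..1}"
  proof (rule fundamental_theorem_of_calculus)
    fix x :: real
    have "((\<lambda>x. a i / real (Suc i) * x ^ Suc i) has_real_derivative a i / real (Suc i) * (real (Suc i) * x ^ i)) (at x within {0..1})"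
      by (intro derivative_eq_intros) (auto simp del: of_nat_Suc)
    then show "((\<lambda>x. a i / real (Suc i) * x ^ Suc i) has_vector_derivative a i * x ^ i) (at x within {0..1})"
      by (simp add: has_real_derivative_iff_has_vector_derivative del: of_nat_Suc power_Suc)
  qed simp
  then show "((\<lambda>x. a i * x ^ i) has_integral (a i / real (Suc i))) {0..1}" by simp
qed simp

text \<open>The polynomial approximates \<open>f\<close> raised by \<epsilon>/2 up to an error of
  \<epsilon>/2, so it lies between f and f + \<epsilon>.\<close>

lemma polynomial_above_continuous:
  fixes f :: "real \<Rightarrow> real"
  assumes f: "continuous_on {0..1} f" and "0 < \<epsilon>"
  obtains a n where "\<And>x. x \<in> {0..1} \<Longrightarrow> f x \<le> (\<Sum>i\<le>n. a i * x ^ i)"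
    "(\<Sum>i\<le>n. a i / real (Suc i)) \<le> integral {0..1} f + \<epsilon>"
proof -
  have cont: "continuous_on {0..1} (\<lambda>x. f x + \<epsilon> / 2)" using f by (intro continuous_intros)
  obtain g where g: "real_polynomial_function g" "\<And>x. x \<in> {0..1} \<Longrightarrow> \<bar>f x + \<epsilon> / 2 - g x\<bar> < \<epsilon> / 2"
    using Stone_Weierstrass_real_polynomial_function[OF _ cont, of "\<epsilon> / 2"] \<open>0 < \<epsilon>\<close> by auto
  obtain a n where p: "g = (\<lambda>x. \<Sum>i\<le>n. a i * x ^ i)"
    using g(1) unfolding real_polynomial_function_iff_sum by blast
  have le: "f x \<le> g x" "g x \<le> f x + \<epsilon>" if "x \<in> {0..1}" for x
    using g(2)[OF that] by linarith+
  have "(\<Sum>i\<le>n. a i / real (Suc i)) = integral {0..1} g"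
    unfolding p by (rule integral_unique[OF integral_polynomial_unit, symmetric])
  also have "\<dots> \<le> integral {0..1} (\<lambda>x. f x + \<epsilon>)"
  proof (rule integral_le)
    show "g integrable_on {0..1}" unfolding p using integral_polynomial_unit by blast
    show "(\<lambda>x. f x + \<epsilon>) integrable_on {0..1}"
      using f by (intro integrable_continuous_real continuous_intros)
  qed (rule le)
  also have "\<dots> = integral {0..1} f + \<epsilon>"
    using integral_add[OF integrable_continuous_real[OF f] integrable_const_ivl[of \<epsilon> 0 1]] by simp
  finally show ?thesis using that[of a n] le(1) unfolding p by blast
qed

text \<open>At x = l^(1/r), multiplying by l^(1+1/r) yields l times the indicator of l > e^-r, whose
  integral is \<open>At (exp (- r))\<close>. The cut at 1/e makes the integral over the unit
  interval equal to 1.\<close>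

definition karamata_kernel :: "real \<Rightarrow> real" where
  "karamata_kernel x = (if exp (- 1) < x then 1 / x else 0)"

lemma integral_inverse_from:
  assumes "0 < a" "a \<le> 1"
  shows "((\<lambda>x. 1 / x) has_integral - ln a) {a..1::real}"
proof -
  have "((\<lambda>x. 1 / x) has_integral (ln 1 - ln a)) {a..1}"
  proof (rule fundamental_theorem_of_calculus)
    fix x assume "x \<in> {a..1}"
    then have "(ln has_real_derivative 1 / x) (at x within {a..1})"
      using assms by (intro DERIV_subset[OF DERIV_ln_divide]) auto
    then show "(ln has_vector_derivative 1 / x) (at x within {a..1})"
      by (simp add: has_real_derivative_iff_has_vector_derivative)
  qed (use assms in simp)
  then show ?thesis by simp
qed

text \<open>The jump at b = 1/e is replaced by a ramp over [b - d, b]. The excess area is at most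
  d/b, and \<open>d\<close> is chosen to keep it within \<epsilon>/2; the other half of \<epsilon>
  is left for the polynomial approximation.\<close>

lemma karamata_upper:
  assumes "0 < \<epsilon>"
  obtains a n where "\<And>x. x \<in> {0..1} \<Longrightarrow> karamata_kernel x \<le> (\<Sum>i\<le>n. a i * x ^ i)"
    "(\<Sum>i\<le>n. a i / real (Suc i)) \<le> 1 + \<epsilon>"
proof -
  define b :: real where "b = exp (- 1)"
  have b: "0 < b" "b < 1" by (auto simp: b_def)
  define d where "d = min (b / 2) (b * \<epsilon> / 2)"
  have d: "0 < d" "d < b" "d / b \<le> \<epsilon> / 2" using b assms by (auto simp: d_def min_def field_simps)
  \<comment> \<open>The maximum with \<open>b\<close> removes the pole at 0 and does not affect the
    factor from \<open>b\<close> on.\<close>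
  define f where "f x = 1 / max x b * min 1 (max 0 ((x - (b - d)) / d))" for x
  have cont: "continuous_on S f" for S
    unfolding f_def using b d by (intro continuous_intros) (auto simp: max_def)
  have int: "f integrable_on {u..v}" for u v by (rule integrable_continuous_real[OF cont])
  have "integral {0..b - d} f = 0"
  proof -
    have "integral {0..b - d} f = integral {0..b - d} (\<lambda>x. 0)"
    proof (rule integral_cong)
      fix x assume "x \<in> {0..b - d}"
      then have "max 0 ((x - (b - d)) / d) = 0" using d by (intro max_absorb1) (simp add: divide_le_0_iff)
      then show "f x = 0" by (simp add: f_def)
    qed
    then show ?thesis by simp
  qed
  moreover have "integral {b - d..b} f \<le> \<epsilon> / 2"
  proof -
    have "integral {b - d..b} f \<le> integral {b - d..b} (\<lambda>x. 1 / b)"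
    proof (rule integral_le[OF int])
      show "f x \<le> 1 / b" if "x \<in> {b - d..b}" for x
      proof -
        have "max x b = b" using that by simp
        moreover have "min 1 (max 0 ((x - (b - d)) / d)) \<le> 1" by simp
        ultimately show ?thesis
          unfolding f_def using mult_left_mono[of "min 1 (max 0 ((x - (b - d)) / d))" 1 "1 / b"] b by simp
      qed
    qed (rule integrable_const_ivl)
    also have "\<dots> = d / b" using d by simp
    finally show ?thesis using d by linarith
  qed
  moreover have "integral {b..1} f = 1"
  proof -
    have "integral {b..1} f = integral {b..1} (\<lambda>x. 1 / x)"
      using d by (intro integral_cong) (auto simp: f_def max_def min_def field_simps)
    also have "\<dots> = - ln b" using b by (intro integral_unique integral_inverse_from) auto
    finally show ?thesis by (simp add: b_def)
  qed
  moreover have "integral {0..b - d} f + integral {b - d..1} f = integral {0..1} f"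
    using b d by (intro Henstock_Kurzweil_Integration.integral_combine int) auto
  moreover have "integral {b - d..b} f + integral {b..1} f = integral {b - d..1} f"
    using b d by (intro Henstock_Kurzweil_Integration.integral_combine int) auto
  ultimately have int_le: "integral {0..1} f \<le> 1 + \<epsilon> / 2" by simp
  have ker: "karamata_kernel x \<le> f x" if "x \<in> {0..1}" for x
  proof (cases "b < x")
    case True
    then have "(x - (b - d)) / d \<ge> 1" using d by (simp add: field_simps)
    then show ?thesis using True b by (simp add: karamata_kernel_def f_def max_def min_def b_def[symmetric])
  next
    case False
    then show ?thesis using b by (simp add: karamata_kernel_def f_def b_def[symmetric])
  qed
  obtain a n where "\<And>x. x \<in> {0..1} \<Longrightarrow> f x \<le> (\<Sum>i\<le>n. a i * x ^ i)"
    "(\<Sum>i\<le>n. a i / real (Suc i)) \<le> integral {0..1} f + \<epsilon> / 2"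
    using polynomial_above_continuous[OF cont half_gt_zero[OF assms]] by blast
  then show ?thesis using that[of a n] int_le order_trans[OF ker] by fastforce
qed

text \<open>The ramp now lies in [b, b + d], and the area lost is at most ln (1 + d/b), which is at
  most d/b. The polynomial below f is the negative of one above -f.\<close>

lemma karamata_lower:
  assumes "0 < \<epsilon>"
  obtains a n where "\<And>x. x \<in> {0..1} \<Longrightarrow> (\<Sum>i\<le>n. a i * x ^ i) \<le> karamata_kernel x"
    "1 - \<epsilon> \<le> (\<Sum>i\<le>n. a i / real (Suc i))"
proof -
  define b :: real where "b = exp (- 1)"
  have b: "0 < b" "b < 1" by (auto simp: b_def)
  define d where "d = min (1 - b) (b * \<epsilon> / 2)"
  have d: "0 < d" "b + d \<le> 1" "d / b \<le> \<epsilon> / 2" using b assms by (auto simp: d_def min_def field_simps)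
  define f where "f x = 1 / max x b * min 1 (max 0 ((x - b) / d))" for x
  have cont: "continuous_on S f" for S
    unfolding f_def using b d by (intro continuous_intros) (auto simp: max_def)
  have int: "f integrable_on {u..v}" for u v by (rule integrable_continuous_real[OF cont])
  have f_nonneg: "0 \<le> f x" for x using b by (simp add: f_def)
  have "1 - \<epsilon> / 2 \<le> - ln (b + d)"
  proof -
    have pos: "0 < 1 + d / b" using b d by (intro add_pos_pos) auto
    have "ln (b + d) = ln (b * (1 + d / b))" using b by (simp add: distrib_left)
    also have "\<dots> = - 1 + ln (1 + d / b)"
      using b pos by (subst ln_mult) (auto simp: b_def)
    also have "\<dots> \<le> - 1 + d / b" using b d by (simp add: ln_add_one_self_le_self)
    finally show ?thesis using d by linarith
  qed
  also have "- ln (b + d) = integral {b + d..1} (\<lambda>x. 1 / x)"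
    using b d by (intro integral_unique[symmetric] integral_inverse_from) auto
  also have "\<dots> = integral {b + d..1} f"
    using d by (intro integral_cong) (auto simp: f_def max_def min_def field_simps)
  also have "\<dots> \<le> integral {0..1} f"
    using b d by (intro integral_subset_le int) (auto simp: f_nonneg)
  finally have int_ge: "1 - \<epsilon> / 2 \<le> integral {0..1} f" .
  have ker: "f x \<le> karamata_kernel x" if "x \<in> {0..1}" for x
  proof (cases "b < x")
    case True
    have "1 / x * min 1 (max 0 ((x - b) / d)) \<le> 1 / x * 1" using True b by (intro mult_left_mono) auto
    then show ?thesis using True b by (simp add: karamata_kernel_def f_def max_def b_def[symmetric])
  next
    case False
    then have "max 0 ((x - b) / d) = 0" using d by (intro max_absorb1) (simp add: divide_le_0_iff)
    then show ?thesis using False by (simp add: karamata_kernel_def f_def b_def[symmetric])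
  qed
  have cont': "continuous_on {0..1} (\<lambda>x. - f x)" by (intro continuous_intros cont)
  obtain a n where p: "\<And>x. x \<in> {0..1} \<Longrightarrow> - f x \<le> (\<Sum>i\<le>n. a i * x ^ i)"
    "(\<Sum>i\<le>n. a i / real (Suc i)) \<le> integral {0..1} (\<lambda>x. - f x) + \<epsilon> / 2"
    using polynomial_above_continuous[OF cont' half_gt_zero[OF assms]] by blast
  show ?thesis
  proof (rule that[of "\<lambda>i. - a i" n])
    show "(\<Sum>i\<le>n. - a i * x ^ i) \<le> karamata_kernel x" if "x \<in> {0..1}" for x
      using p(1)[OF that] ker[OF that] by (simp add: sum_negf)
    show "1 - \<epsilon> \<le> (\<Sum>i\<le>n. - a i / real (Suc i))"
      using p(2) int_ge by (simp add: sum_negf)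
  qed
qed

section \<open>Generalized limits at infinity as functionals on bounded functions\<close>

definition bounded_measurable :: "(real \<Rightarrow> real) \<Rightarrow> bool" where
  "bounded_measurable f \<longleftrightarrow> f \<in> borel_measurable borel \<and> (\<exists>B. \<forall>x. \<bar>f x\<bar> \<le> B)"

lemma bounded_measurableI:
  "f \<in> borel_measurable borel \<Longrightarrow> (\<And>x. \<bar>f x\<bar> \<le> B) \<Longrightarrow> bounded_measurable f"
  unfolding bounded_measurable_def by auto

lemma bounded_measurable_const [simp]: "bounded_measurable (\<lambda>_. c)"
  by (rule bounded_measurableI[of _ "\<bar>c\<bar>"]) auto

lemma bounded_measurable_add:
  assumes "bounded_measurable f" "bounded_measurable g"
  shows "bounded_measurable (\<lambda>x. f x + g x)"
proof -
  obtain B B' where B: "\<And>x. \<bar>f x\<bar> \<le> B" "\<And>x. \<bar>g x\<bar> \<le> B'"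
    using assms unfolding bounded_measurable_def by blast
  have "\<bar>f x + g x\<bar> \<le> B + B'" for x using B(1)[of x] B(2)[of x] by linarith
  then show ?thesis using assms unfolding bounded_measurable_def by auto
qed

lemma bounded_measurable_cmult:
  assumes "bounded_measurable f"
  shows "bounded_measurable (\<lambda>x. c * f x)"
proof -
  obtain B where B: "\<And>x. \<bar>f x\<bar> \<le> B"
    using assms unfolding bounded_measurable_def by blast
  have "\<bar>c * f x\<bar> \<le> \<bar>c\<bar> * B" for x using B[of x] by (simp add: abs_mult mult_left_mono)
  then show ?thesis using assms unfolding bounded_measurable_def by auto
qed

lemma bounded_measurable_sum:
  "(\<And>i. i \<in> I \<Longrightarrow> bounded_measurable (f i)) \<Longrightarrow> bounded_measurable (\<lambda>x. \<Sum>i\<in>I. f i x)"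
  by (induction I rule: infinite_finite_induct) (auto intro: bounded_measurable_add)

lemma bounded_measurable_compose:
  assumes "bounded_measurable f" "g \<in> borel_measurable borel"
  shows "bounded_measurable (\<lambda>x. f (g x))"
proof -
  have [measurable]: "f \<in> borel_measurable borel" "g \<in> borel_measurable borel"
    using assms by (auto simp: bounded_measurable_def)
  obtain B where "\<And>x. \<bar>f x\<bar> \<le> B" using assms unfolding bounded_measurable_def by blast
  then show ?thesis by (intro bounded_measurableI[of _ B]) auto
qed

text \<open>The properties of a state that Karamata's argument uses. Monotonicity for inequalities
  valid at large arguments contains the independence of small ones, and the class is closed under
  power substitutions.\<close>

locale mean_at_infinity =
  fixes \<Lambda> :: "(real \<Rightarrow> real) \<Rightarrow> real"
  assumes mean_add: "bounded_measurable f \<Longrightarrow> bounded_measurable g \<Longrightarrow> \<Lambda> (\<lambda>x. f x + g x) = \<Lambda> f + \<Lambda> g"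
    and mean_cmult: "bounded_measurable f \<Longrightarrow> \<Lambda> (\<lambda>x. c * f x) = c * \<Lambda> f"
    and mean_mono: "bounded_measurable f \<Longrightarrow> bounded_measurable g \<Longrightarrow> \<forall>\<^sub>F x in at_top. f x \<le> g x \<Longrightarrow> \<Lambda> f \<le> \<Lambda> g"
    and mean_one: "\<Lambda> (\<lambda>_. 1) = 1"
begin

lemma mean_const: "\<Lambda> (\<lambda>_. c) = c"
  using mean_cmult[of "\<lambda>_. 1" c] by (simp add: mean_one)

lemma mean_sum:
  "finite I \<Longrightarrow> (\<And>i. i \<in> I \<Longrightarrow> bounded_measurable (f i)) \<Longrightarrow> \<Lambda> (\<lambda>x. \<Sum>i\<in>I. f i x) = (\<Sum>i\<in>I. \<Lambda> (f i))"
proof (induction I rule: finite_induct)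
  case (insert i I)
  then show ?case using mean_add[of "f i" "\<lambda>x. \<Sum>i\<in>I. f i x"] by (simp add: bounded_measurable_sum)
qed (simp add: mean_const)

lemma mean_eventually_cong:
  assumes "bounded_measurable f" "bounded_measurable g" "\<forall>\<^sub>F x in at_top. f x = g x"
  shows "\<Lambda> f = \<Lambda> g"
  using assms by (intro antisym mean_mono) (auto elim: eventually_mono)

lemma mean_tendsto:
  assumes f: "bounded_measurable f" and lim: "(f \<longlongrightarrow> l) at_top"
  shows "\<Lambda> f = l"
proof (rule antisym)
  show "\<Lambda> f \<le> l"
  proof (rule field_le_epsilon)
    fix e :: real assume "0 < e"
    then have "\<forall>\<^sub>F x in at_top. f x < l + e" using lim by (intro order_tendstoD(2)[OF lim]) auto
    then have "\<forall>\<^sub>F x in at_top. f x \<le> l + e" by eventually_elim simp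
    from mean_mono[OF f bounded_measurable_const this] show "\<Lambda> f \<le> l + e" by (simp add: mean_const)
  qed
  show "l \<le> \<Lambda> f"
  proof (rule field_le_epsilon)
    fix e :: real assume "0 < e"
    then have "\<forall>\<^sub>F x in at_top. l - e < f x" using lim by (intro order_tendstoD(1)[OF lim]) auto
    then have "\<forall>\<^sub>F x in at_top. l - e \<le> f x" by eventually_elim simp
    from mean_mono[OF bounded_measurable_const f this] show "l \<le> \<Lambda> f + e" by (simp add: mean_const)
  qed
qed

end

lemma eventually_at_top_powr:
  assumes "\<forall>\<^sub>F x::real in at_top. P x" "0 < c"
  shows "\<forall>\<^sub>F x in at_top. P (x powr c)"
proof -
  have "filterlim (\<lambda>x::real. x powr c) at_top at_top" using assms(2) by real_asymp
  then show ?thesis using assms(1) by (rule eventually_compose_filterlim[rotated])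
qed

lemma mean_powr_substitution:
  assumes "mean_at_infinity \<Lambda>" "0 < c"
  shows "mean_at_infinity (\<lambda>f. \<Lambda> (\<lambda>t. f (t powr c)))"
proof -
  interpret mean_at_infinity \<Lambda> by fact
  have b: "bounded_measurable (\<lambda>t. f (t powr c))" if "bounded_measurable f" for f
    by (rule bounded_measurable_compose[OF that]) simp
  show ?thesis
    by unfold_locales (auto simp: mean_one intro!: mean_add mean_cmult mean_mono b eventually_at_top_powr assms(2))
qed

section \<open>Karamata's theorem for spectral distributions of logarithmic growth\<close>

context dixmier_distribution
begin

definition Z :: "real \<Rightarrow> real" where "Z r = 1 / r * enn2real (Zt (1 / r))"

text \<open>In the following functions of \<open>t = exp r\<close> the values for small \<open>t\<close> are cut off to make them
  bounded.\<close>

definition hZ :: "real \<Rightarrow> real" where "hZ t = (if exp 1 < t then Z (ln t) else 0)"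

definition mean_At :: "real \<Rightarrow> real" where
  "mean_At t = (if exp 1 < t then enn2real (At (exp (- ln t))) / ln t else 0)"

definition mean_Mt :: "real \<Rightarrow> real" where
  "mean_Mt t = (if exp 1 < t then Mt t / ln (1 + t) else 0)"

lemma Z_nonneg: "0 < r \<Longrightarrow> 0 \<le> Z r"
  by (simp add: Z_def)

lemma Z_le: 
  assumes "1 \<le> r"
  shows "Z r \<le> Zt_const"
proof -
  have "Zt (1 / r) \<le> ennreal (Zt_const * r)" using Zt_bound[of "1 / r"] assms by simp
  then have "enn2real (Zt (1 / r)) \<le> Zt_const * r" using Zt_const_pos assms by (intro enn2real_leI) auto
  then show ?thesis using assms by (simp add: Z_def field_simps)
qed

text \<open>The cut-off at exp 1 makes r = ln t exceed 1, so that q = 1/r lies in the range of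
  \<open>Zt_bound\<close>.\<close>

lemma ln_gt_one: "exp 1 < t \<Longrightarrow> 1 < ln t" for t :: real
  using ln_less_cancel_iff[of "exp 1" t] less_trans[OF exp_gt_zero, of 1 t] by simp

lemma bounded_measurable_hZ: "bounded_measurable hZ"
proof (rule bounded_measurableI[of _ Zt_const])
  \<comment> \<open>Measurability comes from monotonicity in r, after extension by 0 to r \<le>
    0.\<close>
  have "mono (\<lambda>r. if 0 < r then enn2real (Zt (1 / r)) else 0)"
  proof
    fix r s :: real assume "r \<le> s"
    then show "(if 0 < r then enn2real (Zt (1 / r)) else 0) \<le> (if 0 < s then enn2real (Zt (1 / s)) else 0)"
      using Zt_finite[of "1 / s"] by (auto intro!: enn2real_mono Zt_antimono frac_le)
  qed
  from borel_measurable_mono[OF this]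
  have [measurable]: "(\<lambda>r. if 0 < r then enn2real (Zt (1 / r)) else 0) \<in> borel_measurable borel" .
  have "hZ = (\<lambda>t. if exp 1 < t then 1 / ln t * (\<lambda>r. if 0 < r then enn2real (Zt (1 / r)) else 0) (ln t) else 0)"
    using ln_gt_one by (fastforce simp: hZ_def Z_def fun_eq_iff)
  also have "\<dots> \<in> borel_measurable borel" by measurable
  finally show "hZ \<in> borel_measurable borel" .
  show "\<bar>hZ t\<bar> \<le> Zt_const" for t
    using ln_gt_one[of t] Z_le[of "ln t"] Z_nonneg[of "ln t"] Zt_const_pos by (auto simp: hZ_def)
qed

lemma At_finite: 
  assumes "0 \<le> r"
  shows "At (exp (- r)) < \<infinity>"
  using At_bound[OF assms] by (auto simp: less_top[symmetric] top_unique)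

lemma bounded_measurable_mean_At: "bounded_measurable mean_At"
proof (rule bounded_measurableI[of _ "2 * At_const"])
  have "mono (\<lambda>r. if 0 < r then enn2real (At (exp (- r))) else 0)"
  proof
    fix r s :: real assume "r \<le> s"
    then show "(if 0 < r then enn2real (At (exp (- r))) else 0) \<le> (if 0 < s then enn2real (At (exp (- s))) else 0)"
      using At_finite[of s] by (auto intro!: enn2real_mono At_antimono)
  qed
  from borel_measurable_mono[OF this]
  have [measurable]: "(\<lambda>r. if 0 < r then enn2real (At (exp (- r))) else 0) \<in> borel_measurable borel" .
  have "mean_At = (\<lambda>t. if exp 1 < t then (\<lambda>r. if 0 < r then enn2real (At (exp (- r))) else 0) (ln t) / ln t else 0)"
    using ln_gt_one by (fastforce simp: mean_At_def fun_eq_iff)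
  also have "\<dots> \<in> borel_measurable borel" by measurable
  finally show "mean_At \<in> borel_measurable borel" .
  show "\<bar>mean_At t\<bar> \<le> 2 * At_const" for t
  proof (cases "exp 1 < t")
    case True
    then have l: "1 < ln t" by (rule ln_gt_one)
    have "enn2real (At (exp (- ln t))) \<le> At_const * (1 + ln t)"
      using At_bound[of "ln t"] At_const_pos l by (intro enn2real_leI) auto
    also have "\<dots> \<le> At_const * (2 * ln t)" using At_const_pos l by (intro mult_left_mono) auto
    finally show ?thesis using True l by (simp add: mean_At_def field_simps)
  qed (use At_const_pos in \<open>simp add: mean_At_def\<close>)
qed

lemma bounded_measurable_mean_Mt: "bounded_measurable mean_Mt"
proof (rule bounded_measurableI[of _ C])
  have [measurable]: "Mt \<in> borel_measurable borel" by (rule borel_measurable_mono[OF Mt_mono])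
  show "mean_Mt \<in> borel_measurable borel" unfolding mean_Mt_def by measurable
  show "\<bar>mean_Mt t\<bar> \<le> C" for t
  proof (cases "exp 1 < t")
    case True
    then have "1 < t" using less_trans[of 1 "exp 1" t] by simp
    then have "0 < ln (1 + t)" by simp
    then show ?thesis using True Mt_le_ln[of t] Mt_nonneg[of t] \<open>1 < t\<close>
      by (simp add: mean_Mt_def divide_le_eq)
  qed (use C_pos in \<open>simp add: mean_Mt_def\<close>)
qed

text \<open>Since l^(1+1/r) (l^(1/r))^i = l^(1+(i+1)/r), a monomial produces the zeta mean
  \<open>Z\<close> at r/(i+1). The factor 1/(i+1) that appears is also the integral of x^i over the
  unit interval.\<close>

lemma integral_polynomial_kernel:
  assumes r: "0 < r"
  shows "integrable \<nu> (\<lambda>l. l powr (1 + 1 / r) * (\<Sum>i\<le>n. a i * (l powr (1 / r)) ^ i))"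
    and "1 / r * (\<integral>l. l powr (1 + 1 / r) * (\<Sum>i\<le>n. a i * (l powr (1 / r)) ^ i) \<partial>\<nu>)
      = (\<Sum>i\<le>n. a i / real (Suc i) * Z (r / real (Suc i)))"
proof -
  have eq: "AE l in \<nu>. l powr (1 + 1 / r) * (\<Sum>i\<le>n. a i * (l powr (1 / r)) ^ i)
    = (\<Sum>i\<le>n. a i * l powr (1 + real (Suc i) / r))"
    using AE_unit
  proof eventually_elim
    case (elim l)
    have "l powr (1 + 1 / r) * (a i * (l powr (1 / r)) ^ i) = a i * l powr (1 + real (Suc i) / r)" for i
    proof (cases "l = 0")
      case False
      then have "(l powr (1 / r)) ^ i = l powr (real i / r)"
        using elim by (simp add: powr_realpow[symmetric] powr_powr)
      then show ?thesis
        using False elim by (simp add: powr_add[symmetric] add_divide_distrib add.assoc)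
    qed simp
    then show ?case by (simp only: sum_distrib_left)
  qed
  have int: "integrable \<nu> (\<lambda>l. \<Sum>i\<le>n. a i * l powr (1 + real (Suc i) / r))"
    using r by (intro Bochner_Integration.integrable_sum integrable_mult_right integrable_powr) simp
  show "integrable \<nu> (\<lambda>l. l powr (1 + 1 / r) * (\<Sum>i\<le>n. a i * (l powr (1 / r)) ^ i))"
    using int by (rule integrable_cong_AE_imp) (use eq in \<open>auto elim: eventually_mono\<close>)
  have "(\<integral>l. l powr (1 + 1 / r) * (\<Sum>i\<le>n. a i * (l powr (1 / r)) ^ i) \<partial>\<nu>)
    = (\<integral>l. (\<Sum>i\<le>n. a i * l powr (1 + real (Suc i) / r)) \<partial>\<nu>)"
    by (rule integral_cong_AE[OF _ _ eq]) auto
  also have "\<dots> = (\<Sum>i\<le>n. a i * (\<integral>l. l powr (1 + real (Suc i) / r) \<partial>\<nu>))"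
    using r by (subst Bochner_Integration.integral_sum) (auto intro!: integrable_powr integrable_mult_right)
  also have "\<dots> = (\<Sum>i\<le>n. a i * enn2real (Zt (real (Suc i) / r)))"
    using r by (simp add: integral_powr)
  finally show "1 / r * (\<integral>l. l powr (1 + 1 / r) * (\<Sum>i\<le>n. a i * (l powr (1 / r)) ^ i) \<partial>\<nu>)
      = (\<Sum>i\<le>n. a i / real (Suc i) * Z (r / real (Suc i)))"
    using r by (simp add: Z_def sum_distrib_left mult_ac)
qed

lemma integral_kernel:
  assumes r: "0 < r"
  shows "integrable \<nu> (\<lambda>l. l powr (1 + 1 / r) * karamata_kernel (l powr (1 / r)))"
    and "(\<integral>l. l powr (1 + 1 / r) * karamata_kernel (l powr (1 / r)) \<partial>\<nu>) = enn2real (At (exp (- r)))"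
proof -
  have eq: "AE l in \<nu>. l powr (1 + 1 / r) * karamata_kernel (l powr (1 / r)) = l * indicator {exp (- r)<..} l"
    using AE_unit
  proof eventually_elim
    case (elim l)
    show ?case
    proof (cases "l = 0")
      case False
      then have l: "0 < l" using elim by simp
      have "exp (- 1) < l powr (1 / r) \<longleftrightarrow> ln (exp (- 1)) < ln (l powr (1 / r))"
        using l by (subst ln_less_cancel_iff) auto
      also have "\<dots> \<longleftrightarrow> - r < ln l" using l r by (simp add: ln_powr field_simps)
      also have "\<dots> \<longleftrightarrow> exp (- r) < l" using l by (metis exp_less_cancel_iff exp_ln)
      finally show ?thesis using l by (simp add: karamata_kernel_def powr_add indicator_def)
    qed simp
  qed
  have nn: "At (exp (- r)) = (\<integral>\<^sup>+l. ennreal (l * indicator {exp (- r)<..} l) \<partial>\<nu>)"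
    unfolding At_def by (intro nn_integral_cong) (auto simp: indicator_def)
  have pos: "0 \<le> l * indicator {exp (- r)<..} l" for l :: real
    using exp_gt_zero[of "- r"] by (auto simp: indicator_def simp del: exp_gt_zero intro: less_imp_le less_trans)
  have int: "integrable \<nu> (\<lambda>l. l * indicator {exp (- r)<..} l)"
    using At_finite[of r] r pos by (intro integrableI_nonneg) (auto simp: nn)
  then show "integrable \<nu> (\<lambda>l. l powr (1 + 1 / r) * karamata_kernel (l powr (1 / r)))"
    by (rule integrable_cong_AE_imp) (use eq in \<open>auto simp: karamata_kernel_def[abs_def] elim: eventually_mono\<close>)
  have "(\<integral>l. l powr (1 + 1 / r) * karamata_kernel (l powr (1 / r)) \<partial>\<nu>) = (\<integral>l. l * indicator {exp (- r)<..} l \<partial>\<nu>)"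
    by (rule integral_cong_AE[OF _ _ eq]) (auto simp: karamata_kernel_def[abs_def])
  also have "\<dots> = enn2real (At (exp (- r)))"
    unfolding nn using int pos by (subst nn_integral_eq_integral) (auto simp: integral_nonneg_AE)
  finally show "(\<integral>l. l powr (1 + 1 / r) * karamata_kernel (l powr (1 / r)) \<partial>\<nu>) = enn2real (At (exp (- r)))" .
qed

lemma hZ_powr_eventually:
  "\<forall>\<^sub>F t in at_top. hZ (t powr (1 / real (Suc i))) = Z (ln t / real (Suc i))"
proof -
  have "\<forall>\<^sub>F t::real in at_top. exp 1 < t powr (1 / real (Suc i))"
    by (rule eventually_at_top_powr[OF eventually_gt_at_top]) simp
  moreover have "\<forall>\<^sub>F t::real in at_top. 0 < t" by (rule eventually_gt_at_top)
  ultimately show ?thesis by eventually_elim (simp add: hZ_def ln_powr)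
qed

text \<open>On a polynomial combination the functional takes the value l times the integral of the
  polynomial over [0,1], since the hypothesis assigns l to each power substitution that occurs. The
  polynomials of \<open>karamata_upper\<close> and \<open>karamata_lower\<close> then enclose
  \<open>mean_At\<close> for large t.\<close>

theorem karamata_mean:
  assumes "mean_at_infinity \<Lambda>"
    and hyp: "\<And>i. \<Lambda> (\<lambda>t. hZ (t powr (1 / real (Suc i)))) = l"
  shows "\<Lambda> mean_At = l"
proof -
  interpret mean_at_infinity \<Lambda> by fact
  define g where "g a n t = (\<Sum>i\<le>n. a i / real (Suc i) * hZ (t powr (1 / real (Suc i))))" for a :: "nat \<Rightarrow> real" and n t
  have b: "bounded_measurable (\<lambda>t. hZ (t powr (1 / real (Suc i))))" for i
    by (rule bounded_measurable_compose[OF bounded_measurable_hZ]) simp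
  have bg: "bounded_measurable (g a n)" for a n
    unfolding g_def by (intro bounded_measurable_sum bounded_measurable_cmult b)
  have \<Lambda>g: "\<Lambda> (g a n) = l * (\<Sum>i\<le>n. a i / real (Suc i))" for a n
  proof -
    have "\<Lambda> (g a n) = (\<Sum>i\<le>n. \<Lambda> (\<lambda>t. a i / real (Suc i) * hZ (t powr (1 / real (Suc i)))))"
      unfolding g_def by (rule mean_sum[OF finite_atMost bounded_measurable_cmult[OF b]])
    also have "\<dots> = (\<Sum>i\<le>n. l * (a i / real (Suc i)))"
      by (intro sum.cong refl) (simp only: mean_cmult[OF b] hyp mult.commute)
    finally show ?thesis by (simp only: sum_distrib_left)
  qed
  have g_ev: "\<forall>\<^sub>F t in at_top. g a n t = 1 / ln t * (\<integral>x. x powr (1 + 1 / ln t) * (\<Sum>i\<le>n. a i * (x powr (1 / ln t)) ^ i) \<partial>\<nu>)" for a n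
  proof -
    have "\<forall>\<^sub>F t in at_top. \<forall>i\<in>{..n}. hZ (t powr (1 / real (Suc i))) = Z (ln t / real (Suc i))"
      by (intro eventually_ball_finite ballI hZ_powr_eventually) simp
    moreover have "\<forall>\<^sub>F t::real in at_top. 1 < t" by (rule eventually_gt_at_top)
    ultimately show ?thesis
      by eventually_elim (subst integral_polynomial_kernel(2), auto simp: g_def)
  qed
  have At_ev: "\<forall>\<^sub>F t in at_top. mean_At t = 1 / ln t * (\<integral>x. x powr (1 + 1 / ln t) * karamata_kernel (x powr (1 / ln t)) \<partial>\<nu>)"
    using eventually_gt_at_top[of "exp 1"]
  proof eventually_elim
    case (elim t)
    then show ?case using ln_gt_one[of t] by (simp add: mean_At_def integral_kernel(2))
  qed
  \<comment> \<open>The sign of \<open>l\<close> is needed for multiplying the bounds on the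
    integrals of the polynomials by \<open>l\<close>.\<close>
  have l0: "0 \<le> l"
  proof -
    have "\<Lambda> (\<lambda>_. 0) \<le> \<Lambda> (\<lambda>t. hZ (t powr (1 / real (Suc 0))))"
      using ln_gt_one Z_nonneg by (intro mean_mono b) (auto simp: hZ_def intro!: always_eventually less_imp_le Z_nonneg order_less_trans[OF zero_less_one])
    then show ?thesis using hyp[of 0] by (simp add: mean_const)
  qed
  have unit: "AE x in \<nu>. 0 \<le> x powr (1 + 1 / s) \<and> x powr (1 / s) \<in> {0..1}" if "0 < s" for s
    using AE_unit by eventually_elim (use that in \<open>auto intro!: powr_le1\<close>)
  have upper: "\<Lambda> mean_At \<le> l * (1 + e)" if e: "0 < e" for e
  proof -
    obtain a n where p: "\<And>x. x \<in> {0..1} \<Longrightarrow> karamata_kernel x \<le> (\<Sum>i\<le>n. a i * x ^ i)"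
      "(\<Sum>i\<le>n. a i / real (Suc i)) \<le> 1 + e" using karamata_upper[OF e] by blast
    have "\<forall>\<^sub>F t in at_top. mean_At t \<le> g a n t"
      using g_ev[of a n] At_ev eventually_gt_at_top[of 1]
    proof eventually_elim
      case (elim t)
      have s: "0 < ln t" using elim by simp
      show ?case
        unfolding elim(1,2)
        by (intro mult_left_mono integral_mono_AE integral_kernel(1) integral_polynomial_kernel(1) s)
          (use unit[OF s] s in \<open>auto intro!: mult_left_mono p(1) elim!: eventually_mono\<close>)
    qed
    then have "\<Lambda> mean_At \<le> l * (\<Sum>i\<le>n. a i / real (Suc i))"
      unfolding \<Lambda>g[symmetric] by (rule mean_mono[OF bounded_measurable_mean_At bg])
    also have "\<dots> \<le> l * (1 + e)" using p(2) l0 by (rule mult_left_mono)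
    finally show ?thesis .
  qed
  have lower: "l * (1 - e) \<le> \<Lambda> mean_At" if e: "0 < e" for e
  proof -
    obtain a n where p: "\<And>x. x \<in> {0..1} \<Longrightarrow> (\<Sum>i\<le>n. a i * x ^ i) \<le> karamata_kernel x"
      "1 - e \<le> (\<Sum>i\<le>n. a i / real (Suc i))" using karamata_lower[OF e] by blast
    have "\<forall>\<^sub>F t in at_top. g a n t \<le> mean_At t"
      using g_ev[of a n] At_ev eventually_gt_at_top[of 1]
    proof eventually_elim
      case (elim t)
      have s: "0 < ln t" using elim by simp
      show ?case
        unfolding elim(1,2)
        by (intro mult_left_mono integral_mono_AE integral_kernel(1) integral_polynomial_kernel(1) s)
          (use unit[OF s] s in \<open>auto intro!: mult_left_mono p(1) elim!: eventually_mono\<close>)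
    qed
    then have "l * (\<Sum>i\<le>n. a i / real (Suc i)) \<le> \<Lambda> mean_At"
      unfolding \<Lambda>g[symmetric] by (rule mean_mono[OF bg bounded_measurable_mean_At])
    moreover have "l * (1 - e) \<le> l * (\<Sum>i\<le>n. a i / real (Suc i))" using p(2) l0 by (rule mult_left_mono)
    ultimately show ?thesis by simp
  qed
  show ?thesis
  proof (rule antisym; rule field_le_epsilon)
    fix e :: real assume e: "0 < e"
    \<comment> \<open>The denominator \<open>l + 1\<close> covers the case
      \<open>l = 0\<close>.\<close>
    have d: "0 < e / (l + 1)" and le: "l * (e / (l + 1)) \<le> e"
      using e l0 by (auto simp: field_simps)
    show "\<Lambda> mean_At \<le> l + e" using upper[OF d] le by (simp add: distrib_left)
    show "l \<le> \<Lambda> mean_At + e" using lower[OF d] le by (simp add: right_diff_distrib)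
  qed
qed

end

section \<open>Comparison of truncated first moments with averaged singular values\<close>

context dixmier_distribution
begin

lemma Mt_le_one_plus_At:
  assumes "1 < t"
  shows "Mt t \<le> 1 + enn2real (At (exp (- ln t)))"
proof -
  have e: "exp (- ln t) = 1 / t" using assms by (simp add: exp_minus divide_inverse)
  have fin: "At (1 / t) < \<infinity>" using At_finite[of "ln t"] assms by (simp add: e)
  have "ennreal (Mt t) \<le> ennreal (t * (1 / t)) + At (1 / t)"
    using assms by (intro Mt_le_At D_finite) auto
  also have "At (1 / t) = ennreal (enn2real (At (1 / t)))" using fin by simp
  also have "ennreal (t * (1 / t)) + ennreal (enn2real (At (1 / t))) = ennreal (1 + enn2real (At (1 / t)))"
    using assms by (subst ennreal_plus[symmetric]) auto
  finally show ?thesis by (subst (asm) ennreal_le_iff) (auto simp: e)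
qed

text \<open>The upper estimate divides Mt t <= 1 + A(t) by the logarithm. For the lower one, c =
  1/(1+d) makes D (t^-c) at most (t^c)^(1+d) = t for large t, so A(t^c) <= Mt t. One factor 1 + d
  comes from ln (t^c) = c ln t, the other from replacing ln t by ln (1 + t).\<close>

theorem mean_Mt_eq:
  assumes "mean_at_infinity \<Lambda>"
    and hyp: "\<And>c. 0 < c \<Longrightarrow> c \<le> 1 \<Longrightarrow> \<Lambda> (\<lambda>t. hZ (t powr c)) = l"
  shows "\<Lambda> mean_Mt = l"
proof -
  interpret mean_at_infinity \<Lambda> by fact
  \<comment> \<open>Karamata's theorem is applied to the functional precomposed with t^c; its
    hypothesis then involves the exponents c/(i+1), which stay in (0,1].\<close>
  have At: "\<Lambda> (\<lambda>t. mean_At (t powr c)) = l" if c: "0 < c" "c \<le> 1" for c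
  proof (rule karamata_mean[OF mean_powr_substitution[OF assms(1) c(1)]])
    fix i
    have "c / real (Suc i) \<le> 1" using c by (simp add: divide_le_eq)
    then show "\<Lambda> (\<lambda>t. hZ ((t powr c) powr (1 / real (Suc i)))) = l"
      using hyp[of "c / real (Suc i)"] c by (simp add: powr_powr del: of_nat_Suc)
  qed
  have bAt: "bounded_measurable (\<lambda>t. mean_At (t powr c))" for c
    by (rule bounded_measurable_compose[OF bounded_measurable_mean_At]) simp
  show ?thesis
  proof (rule antisym)
    show "\<Lambda> mean_Mt \<le> l"
    proof (rule field_le_epsilon)
      fix e :: real assume e: "0 < e"
      have "\<forall>\<^sub>F t in at_top. 1 / ln t \<le> e" using e by real_asymp
      then have "\<forall>\<^sub>F t in at_top. mean_Mt t \<le> mean_At (t powr 1) + e"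
        using eventually_gt_at_top[of "exp 1"]
      proof eventually_elim
        case (elim t)
        have ln1: "1 < ln t" by (rule ln_gt_one[OF elim(2)])
        have t1: "1 < t" using elim(2) less_trans[of 1 "exp 1" t] by simp
        have "Mt t / ln (1 + t) \<le> (1 + enn2real (At (exp (- ln t)))) / ln t"
          using Mt_le_one_plus_At[OF t1] ln1 t1 by (intro frac_le) auto
        also have "\<dots> \<le> mean_At t + e"
          using elim by (simp add: mean_At_def add_divide_distrib)
        finally show ?case using elim t1 by (simp add: mean_Mt_def)
      qed
      then have "\<Lambda> mean_Mt \<le> \<Lambda> (\<lambda>t. mean_At (t powr 1) + e)"
        by (intro mean_mono bounded_measurable_mean_Mt bounded_measurable_add bAt bounded_measurable_const)
      also have "\<dots> = l + e"
        using At[of 1] by (subst mean_add) (auto simp: mean_const bAt simp del: powr_one')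
      finally show "\<Lambda> mean_Mt \<le> l + e" .
    qed
    have lower: "l \<le> (1 + d)\<^sup>2 * \<Lambda> mean_Mt" if d: "0 < d" for d
    proof -
      define c where "c = 1 / (1 + d)"
      have c: "0 < c" "c \<le> 1" "c * (1 + d) = 1" using d by (auto simp: c_def)
      have "\<forall>\<^sub>F u in at_top. D (1 / u) \<le> ennreal (u powr (1 + d))"
        using d by (intro D_eventually_le_powr) simp
      from eventually_at_top_powr[OF this c(1)]
      have 1: "\<forall>\<^sub>F t in at_top. D (1 / t powr c) \<le> ennreal ((t powr c) powr (1 + d))" .
      have 2: "\<forall>\<^sub>F t in at_top. ln (1 + t) \<le> (1 + d) * ln t" using d by real_asymp
      have 3: "\<forall>\<^sub>F t::real in at_top. exp 1 < t powr c"
        by (rule eventually_at_top_powr[OF eventually_gt_at_top c(1)])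
      from 1 2 3 eventually_gt_at_top[of "exp 1"]
      have "\<forall>\<^sub>F t in at_top. mean_At (t powr c) \<le> (1 + d)\<^sup>2 * mean_Mt t"
      proof eventually_elim
        case (elim t)
        have ln1: "1 < ln t" by (rule ln_gt_one[OF elim(4)])
        have t1: "1 < t" using elim(4) less_trans[of 1 "exp 1" t] by simp
        have lnc: "ln (t powr c) = c * ln t" using t1 by (simp add: ln_powr)
        have ex: "exp (- ln (t powr c)) = 1 / t powr c"
          using t1 by (simp add: exp_minus divide_inverse del: ln_powr)
        have "(t powr c) powr (1 + d) = t" using t1 c by (simp add: powr_powr)
        then have "At (exp (- ln (t powr c))) \<le> ennreal (Mt t)"
          unfolding ex using elim(1) t1 by (intro At_le_Mt) auto
        then have "enn2real (At (exp (- ln (t powr c)))) \<le> Mt t" by (intro enn2real_leI Mt_nonneg)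
        then have "mean_At (t powr c) \<le> Mt t / (c * ln t)"
          using elim(3) ln1 c by (simp add: mean_At_def lnc divide_right_mono)
        also have "\<dots> = (1 + d) * (Mt t / ln t)" using c d by (simp add: c_def)
        also have "\<dots> \<le> (1 + d) * ((1 + d) * (Mt t / ln (1 + t)))"
        proof (rule mult_left_mono)
          have "Mt t / ln t \<le> Mt t / (ln (1 + t) / (1 + d))"
            using elim(2) ln1 t1 d Mt_nonneg[of t]
            by (intro divide_left_mono) (auto simp: field_simps intro!: mult_pos_pos)
          then show "Mt t / ln t \<le> (1 + d) * (Mt t / ln (1 + t))" by (simp add: mult.commute)
        qed (use d in simp)
        finally show ?case using elim(4) by (simp add: mean_Mt_def power2_eq_square mult.assoc)
      qed
      then have "\<Lambda> (\<lambda>t. mean_At (t powr c)) \<le> \<Lambda> (\<lambda>t. (1 + d)\<^sup>2 * mean_Mt t)"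
        by (intro mean_mono bAt bounded_measurable_cmult bounded_measurable_mean_Mt)
      then show ?thesis by (simp add: At[OF c(1,2)] mean_cmult bounded_measurable_mean_Mt)
    qed
    have "((\<lambda>d. (1 + d)\<^sup>2 * \<Lambda> mean_Mt) \<longlongrightarrow> (1 + 0)\<^sup>2 * \<Lambda> mean_Mt) (at_right 0)"
      by (intro tendsto_intros)
    moreover have "\<forall>\<^sub>F d in at_right 0. l \<le> (1 + d)\<^sup>2 * \<Lambda> mean_Mt"
      using lower by (auto simp: eventually_at_right_field intro: exI[of _ 1])
    ultimately have "l \<le> (1 + 0)\<^sup>2 * \<Lambda> mean_Mt"
      by (rule tendsto_lowerbound) simp
    then show "l \<le> \<Lambda> mean_Mt" by simp
  qed
qed

end

section \<open>States as generalized limits\<close>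

lemma Linf_ofreal_bounded_measurable:
  assumes "bounded_measurable f"
  shows "(\<lambda>t. complex_of_real (f t)) \<in> Linf S"
proof -
  obtain B where B: "\<And>x. \<bar>f x\<bar> \<le> B" using assms unfolding bounded_measurable_def by blast
  have "f \<in> borel_measurable borel" using assms by (simp add: bounded_measurable_def)
  then have "(\<lambda>t. complex_of_real (f t)) \<in> borel_measurable borel" by measurable
  then have "(\<lambda>t. complex_of_real (f t)) \<in> borel_measurable (lebesgue_on S)"
    by (intro measurable_restrict_space1 measurable_completion) simp
  then show ?thesis using B unfolding Linf_def by auto
qed

lemma Linf_add: "f \<in> Linf S \<Longrightarrow> g \<in> Linf S \<Longrightarrow> (\<lambda>x. f x + g x) \<in> Linf S"
proof -
  assume "f \<in> Linf S" "g \<in> Linf S"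
  then obtain C C' where [measurable]: "f \<in> borel_measurable (lebesgue_on S)" "g \<in> borel_measurable (lebesgue_on S)"
    and "AE x in lebesgue_on S. norm (f x) \<le> C" "AE x in lebesgue_on S. norm (g x) \<le> C'"
    by (auto simp: Linf_def)
  from this(3,4) have "AE x in lebesgue_on S. norm (f x + g x) \<le> C + C'"
    by eventually_elim (rule norm_triangle_mono)
  then show ?thesis unfolding Linf_def by auto
qed

lemma Linf_cmult: "f \<in> Linf S \<Longrightarrow> (\<lambda>x. c * f x) \<in> Linf S"
proof -
  assume "f \<in> Linf S"
  then obtain C where [measurable]: "f \<in> borel_measurable (lebesgue_on S)"
    and "AE x in lebesgue_on S. norm (f x) \<le> C"
    by (auto simp: Linf_def)
  from this(2) have "AE x in lebesgue_on S. norm (c * f x) \<le> norm c * C"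
    by eventually_elim (simp add: norm_mult mult_left_mono)
  then show ?thesis unfolding Linf_def by auto
qed

lemma Linf_Re_Im: 
  assumes "f \<in> Linf S"
  shows "(\<lambda>x. complex_of_real (Re (f x))) \<in> Linf S" "(\<lambda>x. complex_of_real (Im (f x))) \<in> Linf S"
proof -
  obtain C where [measurable]: "f \<in> borel_measurable (lebesgue_on S)"
    and C: "AE x in lebesgue_on S. norm (f x) \<le> C"
    using assms by (auto simp: Linf_def)
  have "AE x in lebesgue_on S. norm (complex_of_real (Re (f x))) \<le> C"
    using C by eventually_elim (use abs_Re_le_cmod order_trans in auto)
  moreover have "AE x in lebesgue_on S. norm (complex_of_real (Im (f x))) \<le> C"
    using C by eventually_elim (use abs_Im_le_cmod order_trans in auto)
  ultimately show "(\<lambda>x. complex_of_real (Re (f x))) \<in> Linf S" "(\<lambda>x. complex_of_real (Im (f x))) \<in> Linf S"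
    unfolding Linf_def by auto
qed

locale admissible =
  fixes \<omega> :: "(real \<Rightarrow> complex) \<Rightarrow> complex"
  assumes admissible: "admissible_state \<omega>"
begin

lemma state: "state_on {0<..} \<omega>"
  using admissible by (simp add: admissible_state_def)

lemma state_add: "f \<in> Linf {0<..} \<Longrightarrow> g \<in> Linf {0<..} \<Longrightarrow> \<omega> (\<lambda>x. f x + g x) = \<omega> f + \<omega> g"
  and state_cmult: "f \<in> Linf {0<..} \<Longrightarrow> \<omega> (\<lambda>x. c * f x) = c * \<omega> f"
  and state_nonneg: "f \<in> Linf {0<..} \<Longrightarrow> AE x in lebesgue_on {0<..}. f x \<in> \<real>\<^sub>\<ge>\<^sub>0 \<Longrightarrow> \<omega> f \<in> \<real>\<^sub>\<ge>\<^sub>0"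
  and state_one: "\<omega> (\<lambda>_. 1) = 1"
  using state unfolding state_on_def by blast+

lemma one_Linf: "(\<lambda>_. c) \<in> Linf S"
  unfolding Linf_def by auto

lemma state_const: "\<omega> (\<lambda>_. c) = c"
  using state_cmult[OF one_Linf[of 1], of c] by (simp add: state_one)

lemma state_real:
  assumes f: "(\<lambda>x. complex_of_real (f x)) \<in> Linf {0<..}"
  shows "Im (\<omega> (\<lambda>x. complex_of_real (f x))) = 0"
proof -
  obtain C where "AE x in lebesgue_on {0<..}. norm (complex_of_real (f x)) \<le> C"
    using f by (auto simp: Linf_def)
  then have "AE x in lebesgue_on {0<..}. complex_of_real (f x) + complex_of_real C \<in> \<real>\<^sub>\<ge>\<^sub>0"
    by eventually_elim (auto simp: complex_nonneg_Reals_iff)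
  from state_nonneg[OF Linf_add[OF f one_Linf] this]
  have "\<omega> (\<lambda>x. complex_of_real (f x)) + complex_of_real C \<in> \<real>\<^sub>\<ge>\<^sub>0"
    by (simp add: state_add[OF f one_Linf] state_const)
  then show ?thesis by (simp add: complex_nonneg_Reals_iff)
qed

text \<open>The essential lower limit bounds the state from below and sees only large
  arguments.\<close>

lemma state_eventually_nonneg:
  assumes f: "(\<lambda>x. complex_of_real (f x)) \<in> Linf {0<..}" and ev: "\<forall>\<^sub>F x in at_top. 0 \<le> f x"
  shows "0 \<le> Re (\<omega> (\<lambda>x. complex_of_real (f x)))"
proof -
  obtain a where a: "\<And>x. a \<le> x \<Longrightarrow> 0 \<le> f x" using ev by (auto simp: eventually_at_top_linorder)
  \<comment> \<open>Made positive, because the infimum in \<open>ess_limsup\<close> runs over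
    positive numbers.\<close>
  define b where "b = max a 1"
  have "f \<in> borel_measurable (lebesgue_on {0<..})"
  proof -
    have "(\<lambda>x. Re (complex_of_real (f x))) \<in> borel_measurable (lebesgue_on {0<..})"
      by (rule measurable_compose[OF _ borel_measurable_Re]) (use f in \<open>simp add: Linf_def\<close>)
    then show ?thesis by simp
  qed
  then have "f \<in> borel_measurable (lebesgue_on {b<..})"
    by (rule measurable_restrict_mono) (auto simp: b_def)
  then have "esssup (lebesgue_on {b<..}) (\<lambda>t. ereal (- f t)) \<le> 0"
    by (intro esssup_I AE_I2) (auto simp: space_restrict_space b_def intro!: a)
  then have "ess_limsup (\<lambda>t. - f t) \<le> 0"
    unfolding ess_limsup_def by (rule INF_lower2[rotated]) (simp add: b_def)
  then have "0 \<le> ess_liminf f" by (simp add: ess_liminf_def ereal_0_le_uminus_iff)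
  also have "ess_liminf f \<le> ereal (Re (\<omega> (\<lambda>t. complex_of_real (f t))))"
    using admissible f by (simp add: admissible_state_def)
  finally show ?thesis by simp
qed

text \<open>The preceding positivity is applied to g and -g, for the real and the imaginary part
  separately. Functions that are nonzero near 0 are covered as well.\<close>

lemma state_eventually_zero:
  assumes f: "f \<in> Linf {0<..}" and ev: "\<forall>\<^sub>F x in at_top. f x = 0"
  shows "\<omega> f = 0"
proof -
  have zero: "\<omega> (\<lambda>x. complex_of_real (g x)) = 0"
    if g: "(\<lambda>x. complex_of_real (g x)) \<in> Linf {0<..}" and gev: "\<forall>\<^sub>F x in at_top. g x = 0" for g
  proof -
    have "0 \<le> Re (\<omega> (\<lambda>x. complex_of_real (g x)))"
      using gev by (intro state_eventually_nonneg[OF g]) (auto elim: eventually_mono)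
    moreover have "0 \<le> Re (\<omega> (\<lambda>x. complex_of_real (- g x)))"
      using gev Linf_cmult[OF g, of "-1"] by (intro state_eventually_nonneg) (auto elim: eventually_mono)
    moreover have "\<omega> (\<lambda>x. complex_of_real (- g x)) = - \<omega> (\<lambda>x. complex_of_real (g x))"
      using state_cmult[OF g, of "-1"] by simp
    ultimately show ?thesis using state_real[OF g] by (simp add: complex_eq_iff)
  qed
  have "\<omega> f = \<omega> (\<lambda>x. complex_of_real (Re (f x)) + \<i> * complex_of_real (Im (f x)))"
    by (simp add: complex_eq[symmetric])
  also have "\<dots> = \<omega> (\<lambda>x. complex_of_real (Re (f x))) + \<i> * \<omega> (\<lambda>x. complex_of_real (Im (f x)))"
    using Linf_Re_Im[OF f] by (simp add: state_add state_cmult Linf_cmult)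
  also have "\<dots> = 0"
  proof -
    have "\<forall>\<^sub>F x in at_top. Re (f x) = 0" "\<forall>\<^sub>F x in at_top. Im (f x) = 0"
      using ev by (auto elim: eventually_mono)
    then show ?thesis using zero[OF Linf_Re_Im(1)[OF f]] zero[OF Linf_Re_Im(2)[OF f]] by simp
  qed
  finally show ?thesis .
qed

lemma state_eventually_cong:
  assumes f: "f \<in> Linf {0<..}" and g: "g \<in> Linf {0<..}" and ev: "\<forall>\<^sub>F x in at_top. f x = g x"
  shows "\<omega> f = \<omega> g"
proof -
  have "\<omega> (\<lambda>x. f x + -1 * g x) = 0"
    using ev by (intro state_eventually_zero Linf_add Linf_cmult f g) (auto elim: eventually_mono)
  then show ?thesis by (simp only: state_add[OF f Linf_cmult[OF g]] state_cmult[OF g]) simp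
qed

text \<open>Taking the real part loses nothing: by \<open>state_real\<close> the state is real on
  real functions.\<close>

definition mean :: "(real \<Rightarrow> real) \<Rightarrow> real" where
  "mean f = Re (\<omega> (\<lambda>t. complex_of_real (f t)))"

lemma state_eq_mean: "bounded_measurable f \<Longrightarrow> \<omega> (\<lambda>t. complex_of_real (f t)) = complex_of_real (mean f)"
  using state_real[OF Linf_ofreal_bounded_measurable, of f] by (simp add: mean_def complex_eq_iff)

theorem mean_at_infinity: "mean_at_infinity mean"
proof
  show add: "mean (\<lambda>x. f x + g x) = mean f + mean g" if "bounded_measurable f" "bounded_measurable g" for f g
    using that by (simp add: mean_def state_add Linf_ofreal_bounded_measurable)
  show cmult: "mean (\<lambda>x. c * f x) = c * mean f" if "bounded_measurable f" for f c
    using that by (simp add: mean_def state_cmult Linf_ofreal_bounded_measurable)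
  show "mean f \<le> mean g" if f: "bounded_measurable f" and g: "bounded_measurable g" and le: "\<forall>\<^sub>F x in at_top. f x \<le> g x" for f g
  proof -
    have "0 \<le> mean (\<lambda>x. g x + -1 * f x)"
      unfolding mean_def
      by (intro state_eventually_nonneg Linf_ofreal_bounded_measurable bounded_measurable_add g bounded_measurable_cmult f)
        (use le in \<open>auto elim: eventually_mono\<close>)
    then show ?thesis using add[OF g bounded_measurable_cmult[OF f, of "-1"]] cmult[OF f, of "-1"] by simp
  qed
  show "mean (\<lambda>_. 1) = 1" by (simp add: mean_def state_one)
qed

text \<open>The description in \<open>gen_lim\<close> is unique because eventually equal functions
  have the same value under the state.\<close>

lemma gen_lim_eq_mean:
  assumes f: "bounded_measurable f" and ev: "\<forall>\<^sub>F t in at_top. f t = F t"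
  shows "gen_lim {0<..} \<omega> F = complex_of_real (mean f)"
  unfolding gen_lim_def
proof (rule the_equality)
  show "\<exists>g\<in>Linf {0<..}. (\<forall>\<^sub>F t in at_top. g t = complex_of_real (F t)) \<and> \<omega> g = complex_of_real (mean f)"
    using ev by (intro bexI[of _ "\<lambda>t. complex_of_real (f t)"] conjI state_eq_mean[OF f] Linf_ofreal_bounded_measurable[OF f])
      (auto elim: eventually_mono)
  fix c assume "\<exists>g\<in>Linf {0<..}. (\<forall>\<^sub>F t in at_top. g t = complex_of_real (F t)) \<and> \<omega> g = c"
  then obtain g where g: "g \<in> Linf {0<..}" "\<forall>\<^sub>F t in at_top. g t = complex_of_real (F t)" "\<omega> g = c" by blast
  have "\<forall>\<^sub>F t in at_top. g t = complex_of_real (f t)"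
    using ev g(2) by eventually_elim simp
  from state_eventually_cong[OF g(1) Linf_ofreal_bounded_measurable[OF f] this]
  show "c = complex_of_real (mean f)" by (simp add: g(3) state_eq_mean[OF f])
qed

end

text \<open>The functions are Lebesgue measurable and not just Borel, so composition with ln needs
  an argument: preimages under ln are images under exp, and a differentiable map of the line sends
  Lebesgue sets to Lebesgue sets and null sets to null sets.\<close>

lemma Linf_log_pullback:
  assumes "g \<in> Linf UNIV"
  shows "log_pullback g \<in> Linf {0<..}"
proof -
  obtain C where g: "g \<in> borel_measurable lebesgue" and C: "AE x in lebesgue. norm (g x) \<le> C"
    using assms unfolding Linf_def lebesgue_on_UNIV_eq by blast
  have diff: "exp differentiable_on S" for S :: "real set"
    unfolding differentiable_on_def differentiable_def
    using has_derivative_at_withinI[OF DERIV_exp[unfolded has_field_derivative_def]] by blast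
  have "(\<lambda>t. g (ln t)) \<in> borel_measurable (lebesgue_on {0<..})"
  proof (rule measurableI)
    fix B :: "complex set" assume "B \<in> sets borel"
    then have "g -` B \<in> sets lebesgue" using measurable_sets[OF g, of B] by simp
    then have "exp ` (g -` B) \<in> sets lebesgue"
      by (intro differentiable_image_in_sets_lebesgue diff) auto
    moreover have "(\<lambda>t. g (ln t)) -` B \<inter> space (lebesgue_on {0<..}) = exp ` (g -` B)"
      by (force simp: space_restrict_space image_iff intro: exp_ln[symmetric])
    ultimately show "(\<lambda>t. g (ln t)) -` B \<inter> space (lebesgue_on {0<..}) \<in> sets (lebesgue_on {0<..})"
      by (auto simp: sets_restrict_space_iff)
  qed simp
  moreover have "AE t in lebesgue_on {0<..}. norm (g (ln t)) \<le> C"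
  proof -
    obtain N where N: "{x. \<not> norm (g x) \<le> C} \<subseteq> N" "N \<in> null_sets lebesgue"
      using C by (auto simp: eventually_ae_filter)
    have "negligible (exp ` N)"
      by (rule negligible_differentiable_image_negligible) (use N diff in \<open>auto simp: negligible_iff_null_sets\<close>)
    then have "exp ` N \<in> null_sets lebesgue" by (simp add: negligible_iff_null_sets)
    then have "AE t in lebesgue. t \<notin> exp ` N" by (rule AE_not_in)
    then have "AE t in lebesgue. t \<in> {0<..} \<longrightarrow> norm (g (ln t)) \<le> C"
    proof eventually_elim
      case (elim t)
      show ?case
      proof (intro impI, rule ccontr)
        assume "t \<in> {0<..}" "\<not> norm (g (ln t)) \<le> C"
        then have "t = exp (ln t)" "ln t \<in> N" using N(1) by auto
        then show False using elim by blast
      qed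
    qed
    then show ?thesis by (simp add: AE_restrict_space_iff)
  qed
  ultimately show ?thesis unfolding Linf_def log_pullback_def comp_def by blast
qed

section \<open>Dixmier traces and zeta functions\<close>

lemma psi1_pos: "0 < t \<Longrightarrow> 0 < psi1 t"
  by (auto simp: psi1_def)

context traced_positive_contraction
begin

lemma unit_spectral_distribution_nu: "unit_spectral_distribution nu"
  by unfold_locales (simp_all add: sets_nu nu_outside)

interpretation nu: unit_spectral_distribution nu
  by (rule unit_spectral_distribution_nu)

lemma sing_val_mu: "sing_val \<tau> T = unit_spectral_distribution.mu nu"
  by (rule ext) (simp add: sing_val_eq nu.mu_def nu.D_def)

lemma dixmier_distribution_nu:
  assumes "T \<in> L1inf N \<tau>"
  obtains C where "dixmier_distribution nu C"
proof -
  obtain C where C: "\<And>t. 0 < t \<Longrightarrow> 1 / psi1 t * nu.Mt t \<le> C"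
    using assms unfolding L1inf_def bdd_above_def by (auto simp: sing_val_mu nu.Mt_def)
  \<comment> \<open>The bound from \<open>L1inf\<close> may be any real number; |C| + 1 is a
    positive one.\<close>
  have "dixmier_distribution nu (\<bar>C\<bar> + 1)"
  proof unfold_locales
    show "nu.Mt t \<le> (\<bar>C\<bar> + 1) * psi1 t" if "0 < t" for t
    proof -
      have "nu.Mt t \<le> C * psi1 t" using C[OF that] psi1_pos[OF that] by (simp add: divide_le_eq)
      also have "\<dots> \<le> (\<bar>C\<bar> + 1) * psi1 t" using psi1_pos[OF that] by (intro mult_right_mono) auto
      finally show ?thesis .
    qed
  qed simp
  then show ?thesis using that by blast
qed

end

lemma log_pullback_eventually:
  assumes "\<forall>\<^sub>F r in at_top. P r"
  shows "\<forall>\<^sub>F t::real in at_top. P (ln t)"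
  using assms ln_at_top by (rule eventually_compose_filterlim)

theorem theorem4p11:
  fixes N :: "('h::complex_hilbert_space \<Rightarrow>\<^sub>L 'h) set"
    and \<tau> :: "('h \<Rightarrow>\<^sub>L 'h) \<Rightarrow> ennreal"
    and T :: "'h \<Rightarrow>\<^sub>L 'h"
  assumes "separable_space (euclidean :: 'h topology)"
    and "semifinite_vn_algebra_with_trace N \<tau>"
    and "T \<in> L1inf N \<tau>"
    and "pos_op T"
    and "norm T \<le> 1"
  shows "(\<forall>\<omega>. admissible_state \<omega> \<and> invariant_under (dil 2) \<omega> \<and>
              (\<forall>\<alpha>>1. invariant_under (pow_sub \<alpha>) \<omega>) \<longrightarrow>
            dixmier_trace \<omega> \<tau> T = gen_lim UNIV (\<omega> \<circ> log_pullback) (scaled_zeta \<tau> T)) \<and>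
         (\<forall>l. (scaled_zeta \<tau> T \<longlongrightarrow> l) at_top \<longrightarrow>
            (\<forall>\<omega>. admissible_state \<omega> \<and> invariant_under (dil 2) \<omega> \<longrightarrow>
               dixmier_trace \<omega> \<tau> T = complex_of_real l))"
proof -
  interpret traced_positive_contraction T N \<tau>
    using assms by unfold_locales (auto simp: semifinite_vn_algebra_with_trace_def L1inf_def)
  obtain C where "dixmier_distribution nu C" using dixmier_distribution_nu[OF assms(3)] .
  then interpret d: dixmier_distribution nu C .
  have zeta: "\<forall>\<^sub>F r in at_top. scaled_zeta \<tau> T r = d.Z r"
    using eventually_gt_at_top[of 0]
    by eventually_elim (simp add: scaled_zeta_def d.Z_def d.Zt_def trace_op_powr)
  have dix: "\<forall>\<^sub>F t in at_top. d.mean_Mt t = 1 / ln (1 + t) * integral {0..t} (sing_val \<tau> T)"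
    using eventually_gt_at_top[of "exp 1"]
    by eventually_elim (simp add: d.mean_Mt_def d.Mt_def sing_val_mu)
  have bh: "bounded_measurable (\<lambda>t. d.hZ (t powr c))" for c
    by (rule bounded_measurable_compose[OF d.bounded_measurable_hZ]) simp
  show ?thesis
  proof (intro conjI allI impI; elim conjE)
    fix \<omega> assume adm: "admissible_state \<omega>" and pow: "\<forall>\<alpha>>1. invariant_under (pow_sub \<alpha>) \<omega>"
    interpret admissible \<omega> by unfold_locales (rule adm)
    define l where "l = mean d.hZ"
    have "mean (\<lambda>t. d.hZ (t powr c)) = l" if c: "0 < c" "c \<le> 1" for c
    proof (cases "c = 1")
      \<comment> \<open>\<open>t powr 1\<close> is not \<open>t\<close> at negative arguments, hence
        the comparison for large arguments.\<close>
      case True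
      have "\<forall>\<^sub>F t::real in at_top. d.hZ (t powr 1) = d.hZ t"
        using eventually_gt_at_top[of 0] by eventually_elim simp
      from mean_at_infinity.mean_eventually_cong[OF mean_at_infinity bh d.bounded_measurable_hZ this]
      show ?thesis by (simp only: True l_def)
    next
      case False
      \<comment> \<open>Invariance for \<alpha> = 1/c is applied to the function hZ (t^c) and not to
        \<open>hZ\<close>, so that the substitution undoes an exponent c < 1.\<close>
      then have "1 < 1 / c" using c by simp
      then have "\<omega> (pow_sub (1 / c) (\<lambda>t. complex_of_real (d.hZ (t powr c)))) = \<omega> (\<lambda>t. complex_of_real (d.hZ (t powr c)))"
        using pow Linf_ofreal_bounded_measurable[OF bh] unfolding invariant_under_def by blast
      moreover have "pow_sub (1 / c) (\<lambda>t. complex_of_real (d.hZ (t powr c))) = (\<lambda>t. complex_of_real (d.hZ (t powr 1)))"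
        using c by (simp only: pow_sub_def powr_powr) simp
      ultimately have "mean (\<lambda>t. d.hZ (t powr c)) = mean (\<lambda>t. d.hZ (t powr 1))"
        by (simp only: mean_def)
      moreover have "\<forall>\<^sub>F t::real in at_top. d.hZ (t powr 1) = d.hZ t"
        using eventually_gt_at_top[of 0] by eventually_elim simp
      note mean_at_infinity.mean_eventually_cong[OF mean_at_infinity bh d.bounded_measurable_hZ this]
      ultimately show ?thesis by (simp only: l_def)
    qed
    then have "mean d.mean_Mt = l" by (rule d.mean_Mt_eq[OF mean_at_infinity])
    then have lhs: "dixmier_trace \<omega> \<tau> T = complex_of_real l"
      unfolding dixmier_trace_def using gen_lim_eq_mean[OF d.bounded_measurable_mean_Mt dix] by simp
    \<comment> \<open>Every representative of the generalized limit, pulled back along ln, agrees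
      with \<open>hZ\<close> for large t, so its value does not depend on the choice.\<close>
    have state_value: "(\<omega> \<circ> log_pullback) g = complex_of_real l"
      if g: "g \<in> Linf UNIV" and ev: "\<forall>\<^sub>F r in at_top. g r = complex_of_real (scaled_zeta \<tau> T r)" for g
    proof -
      have "\<forall>\<^sub>F r in at_top. g r = complex_of_real (d.Z r)" using ev zeta by eventually_elim simp
      from log_pullback_eventually[OF this] eventually_gt_at_top[of "exp 1"]
      have "\<forall>\<^sub>F t in at_top. log_pullback g t = complex_of_real (d.hZ t)"
        by eventually_elim (simp add: log_pullback_def d.hZ_def)
      from state_eventually_cong[OF Linf_log_pullback[OF g] Linf_ofreal_bounded_measurable[OF d.bounded_measurable_hZ] this]
      show ?thesis by (simp add: l_def state_eq_mean[OF d.bounded_measurable_hZ])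
    qed
    \<comment> \<open>For existence, \<open>hZ\<close> composed with exp is a representative that is
      bounded on the whole line.\<close>
    have bZ: "bounded_measurable (\<lambda>r. d.hZ (exp r))"
      by (rule bounded_measurable_compose[OF d.bounded_measurable_hZ]) simp
    have Z_ev: "\<forall>\<^sub>F r in at_top. complex_of_real (d.hZ (exp r)) = complex_of_real (scaled_zeta \<tau> T r)"
      using zeta eventually_gt_at_top[of 1] by eventually_elim (simp add: d.hZ_def)
    have "gen_lim UNIV (\<omega> \<circ> log_pullback) (scaled_zeta \<tau> T) = complex_of_real l"
      unfolding gen_lim_def
    proof (rule the_equality)
      note Z_Linf = Linf_ofreal_bounded_measurable[OF bZ, of UNIV]
      show "\<exists>g\<in>Linf UNIV. (\<forall>\<^sub>F t in at_top. g t = complex_of_real (scaled_zeta \<tau> T t)) \<and>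
          (\<omega> \<circ> log_pullback) g = complex_of_real l"
        by (intro bexI[of _ "\<lambda>r. complex_of_real (d.hZ (exp r))"] conjI Z_ev state_value Z_Linf)
      show "c = complex_of_real l" if "\<exists>g\<in>Linf UNIV.
          (\<forall>\<^sub>F t in at_top. g t = complex_of_real (scaled_zeta \<tau> T t)) \<and> (\<omega> \<circ> log_pullback) g = c" for c
        using that state_value by metis
    qed
    then show "dixmier_trace \<omega> \<tau> T = gen_lim UNIV (\<omega> \<circ> log_pullback) (scaled_zeta \<tau> T)"
      using lhs by simp
  next
    fix l \<omega> assume lim: "(scaled_zeta \<tau> T \<longlongrightarrow> l) at_top" and adm: "admissible_state \<omega>"
    interpret admissible \<omega> by unfold_locales (rule adm)
    have "(d.Z \<longlongrightarrow> l) at_top" using lim zeta by (rule Lim_transform_eventually)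
    then have "((\<lambda>t. d.Z (ln t)) \<longlongrightarrow> l) at_top" by (rule filterlim_compose[OF _ ln_at_top])
    then have hZ_lim: "(d.hZ \<longlongrightarrow> l) at_top"
      by (rule Lim_transform_eventually)
        (use eventually_gt_at_top[of "exp 1"] in \<open>eventually_elim, simp add: d.hZ_def\<close>)
    \<comment> \<open>The substituted functions converge to the same \<open>l\<close>, and the mean
      of a convergent function is its limit.\<close>
    have "mean (\<lambda>t. d.hZ (t powr c)) = l" if c: "0 < c" "c \<le> 1" for c
    proof (rule mean_at_infinity.mean_tendsto[OF mean_at_infinity bh])
      have "filterlim (\<lambda>t::real. t powr c) at_top at_top" using c by real_asymp
      then show "((\<lambda>t. d.hZ (t powr c)) \<longlongrightarrow> l) at_top" by (rule filterlim_compose[OF hZ_lim])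
    qed
    then have "mean d.mean_Mt = l" by (rule d.mean_Mt_eq[OF mean_at_infinity])
    then show "dixmier_trace \<omega> \<tau> T = complex_of_real l"
      unfolding dixmier_trace_def using gen_lim_eq_mean[OF d.bounded_measurable_mean_Mt dix] by simp
  qed
qed

end
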